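(* For $\Lambda\in\{\mathbb{J},\mathbb{Z}^4\}$ and $m\ge1$ let $f_\Lambda(m)$ be the number of similarity sublattices of $\Lambda$ of index $m^2$, and let $F_\Lambda(s)=\sum_{m\ge1}f_\Lambda(m)\,m^{-2s}$. Then the coefficients $f_\Lambda(m)$ grow faster than linearly on average for large $m$, and one has the asymptotic behaviour $$\sum_{m\le x}f_\Lambda(m)\;\sim\;C_\Lambda\cdot x^2\log(x)\qquad(x\to\infty),$$ where the constant is given by $$C_\Lambda=2\,\operatorname{res}_{s=1}\bigl((s-1)F_\Lambda(s)\bigr)=\frac14\cdot\begin{cases}1, & \text{if }\Lambda=\mathbb{J},\\ \frac32, & \text{if }\Lambda=\mathbb{Z}^4.\end{cases}$$
   Context: $\mathbb{R}^4$ is identified with the real quaternions via the standard basis $1,i,j,k$. $\mathbb{J}=D_4^*$ is the lattice (Hurwitzian ring) of all $(x_0,x_1,x_2,x_3)$ whose coordinates either all lie in $\mathbb{Z}$ or all lie in $\mathbb{Z}+\tfrac12$. For a lattice $\Lambda$ spanning $\mathbb{R}^4$, a subset $M\subset\Lambda$ is a similarity sublattice of $\Lambda$ if there are $\alpha\in\mathbb{R}\setminus\{0\}$ and $R\in\mathrm{O}(4)$ with $M=\alpha R(\Lambda)\subset\Lambda$. Its index is the group index $[\Lambda:M]$. Similarity sublattices are counted as subsets. Growing faster than linearly on average means that $\frac1x\sum_{m\le x}f_\Lambda(m)$ grows faster than linearly in $x$. The series $F_\Lambda(s)$ is understood via its meromorphic continuation to a neighbourhood of $s=1$, and $A(x)\sim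 B(x)$ means $A(x)/B(x)\to1$. *)

theory Defs
  imports "HOL-Complex_Analysis.Complex_Analysis" "HOL-Library.Landau_Symbols"
begin

(* The Hurwitz ring, i.e. the lattice dual to D4, with real^4 carrying the coordinates with
   respect to the quaternion basis 1, i, j, k. *)
definition hurwitz_lattice :: "(real^4) set" where
  "hurwitz_lattice = {x. (\<forall>i. x $ i \<in> \<int>) \<or> (\<forall>i. x $ i - 1/2 \<in> \<int>)}"

definition integer_lattice :: "(real^4) set" where
  "integer_lattice = {x. \<forall>i. x $ i \<in> \<int>}"

definition similarity_sublattice :: "(real^4) set \<Rightarrow> (real^4) set \<Rightarrow> bool" where
  "similarity_sublattice \<Lambda> M \<longleftrightarrow>
     (\<exists>\<alpha>::real. \<exists>R. \<alpha> \<noteq> 0 \<and> orthogonal_transformation R \<and> M = (\<lambda>x. \<alpha> *\<^sub>R R x) ` \<Lambda>) \<and> M \<subseteq> \<Lambda>"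

(* The number of cosets x + M with x in \<Lambda>; the value 0 stands for an infinite index. *)
definition lattice_index :: "(real^4) set \<Rightarrow> (real^4) set \<Rightarrow> nat" where
  "lattice_index \<Lambda> M = card ((\<lambda>x. (\<lambda>y. x + y) ` M) ` \<Lambda>)"

definition num_similarity_sublattices :: "(real^4) set \<Rightarrow> nat \<Rightarrow> nat" where
  "num_similarity_sublattices \<Lambda> m =
     card {M. similarity_sublattice \<Lambda> M \<and> lattice_index \<Lambda> M = m\<^sup>2}"

definition summatory :: "(real^4) set \<Rightarrow> real \<Rightarrow> real" where
  "summatory \<Lambda> x = (\<Sum>m | 1 \<le> m \<and> real m \<le> x. real (num_similarity_sublattices \<Lambda> m))"

(* The term of index n is the one belonging to m = n + 1. *)
definition dirichlet_term :: "(real^4) set \<Rightarrow> complex \<Rightarrow> nat \<Rightarrow> complex" where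
  "dirichlet_term \<Lambda> s n =
     of_nat (num_similarity_sublattices \<Lambda> (Suc n)) * of_nat (Suc n) powr (- 2 * s)"

definition dirichlet_gf :: "(real^4) set \<Rightarrow> complex \<Rightarrow> complex" where
  "dirichlet_gf \<Lambda> s = (\<Sum>n. dirichlet_term \<Lambda> s n)"

(* G continues F from the half-plane Re s > 1 to a neighbourhood of s = 1. Since 1 lies on the
   boundary of the half-plane, G is determined near 1 up to its values at isolated points. *)
definition meromorphic_continuation_near_1 ::
    "(complex \<Rightarrow> complex) \<Rightarrow> (complex \<Rightarrow> complex) \<Rightarrow> bool" where
  "meromorphic_continuation_near_1 F G \<longleftrightarrow>
     (\<exists>U. open U \<and> 1 \<in> U \<and> G meromorphic_on U \<and> (\<forall>s\<in>U. Re s > 1 \<longrightarrow> G s = F s))"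

end

theory Submission
  imports Defs "HOL-Real_Asymp.Real_Asymp"
begin

text \<open>
  Let \<open>J\<close> be the Hurwitz ring. Every similarity of \<open>\<real>\<^sup>4\<close> is \<open>x \<mapsto> a x b\<close> or
  \<open>x \<mapsto> a x\<^sup>* b\<close> with real quaternions \<open>a, b\<close>, so the similarity sublattices of \<open>J\<close> are the
  sets \<open>a J b\<close>. One may take \<open>a\<close> primitive of odd norm and \<open>b \<in> J\<close>; then \<open>a J\<close> and
  \<open>J b\<close> are determined, and the index is \<open>(N(a) N(b))\<^sup>2\<close>. With 24 units on each side,
  \<open>576 f\<^sub>J(m)\<close> is the number of such pairs with \<open>N(a) N(b) = m\<close>. For \<open>\<int>\<^sup>4\<close> one has
  \<open>f(m) = f\<^sub>J(m)\<close> for odd \<open>m\<close> and \<open>f(m) = 3 f\<^sub>J(m)\<close> for even \<open>m\<close>.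

  Let \<open>E(w)\<close> be the Epstein zeta function \<open>\<Sum> N(x)\<^sup>-\<^sup>w\<close> over nonzero \<open>x \<in> J\<close> and \<open>\<lambda>(w)\<close> the sum
  of \<open>d\<^sup>-\<^sup>w\<close> over odd \<open>d\<close>. Splitting off powers of \<open>1 + i\<close> and odd integer factors gives
  \<open>576 F\<^sub>J(s) = E(w)\<^sup>2 (1 - 2\<^sup>-\<^sup>w) / \<lambda>(2w)\<close> with \<open>w = 2s\<close>. Counting lattice points in balls,
  \<open>#{x \<in> J. N(x) \<le> t} = \<pi>\<^sup>2 t\<^sup>2 + O(t\<^sup>3\<^sup>/\<^sup>2)\<close>, which continues \<open>E\<close> to \<open>Re w > 3/2\<close> with a simple
  pole at \<open>2\<close>, and \<open>\<lambda>(4) = \<pi>\<^sup>4/96\<close>. The summatory function is treated by the same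
  decomposition, with partial sums of \<open>\<Sum> N(x)\<^sup>-\<^sup>2\<close> in place of the series.
\<close>

unbundle no fps_syntax
no_notation fps_nth (infixl \<open>$\<close> 75)
no_notation Infinite_Set_Sum.abs_summable_on (infix \<open>abs'_summable'_on\<close> 50)

section \<open>Quaternions\<close>

text \<open>The roles of a and b are unequal because real scalars, and also 1 + i with (1 + i) J = J
  (1 + i), can pass from a through J to b; once b has collected them, the pair is unique up to
  units. Existence and uniqueness both rest on one averaging identity: the sum of e y e* over e = 1,
  i, j, k is 4 Re y. It extracts real multiples of a single factor from two-sided products, and
  primitivity with odd norm removes the factor 4.

  The pole of E comes from the series of n^(1-w). Multiplied by 1 - 2^(2-w) this becomes an
  alternating series with value ln 2 at w = 2, and ln 2 cancels against the derivative of the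
  factor.

  A continuation to a neighbourhood of s = 1 says nothing about the rest of the line Re s = 1, so
  the growth of the sums is not deduced from the pole: the residue and the asymptotics are computed
  separately and agree. With residue 2 pi^2 of E at w = 2, the coefficient of (w - 2)^(-2) is (2
  pi^2)^2 (3/4) / (576 pi^4/96) = 1/2; in s - 1 this is 1/8, and twice that is the constant
  1/4.\<close>

definition quat :: "real \<Rightarrow> real \<Rightarrow> real \<Rightarrow> real \<Rightarrow> real^4" where
  "quat a b c d = (\<chi> i. if i = 1 then a else if i = 2 then b else if i = 3 then c else d)"

lemma quat_nth [simp]:
  "quat a b c d $ 1 = a" "quat a b c d $ 2 = b" "quat a b c d $ 3 = c" "quat a b c d $ 4 = d"
  by (simp_all add: quat_def)

lemma quat_eq_iff:
  "(x :: real^4) = y \<longleftrightarrow> x$1 = y$1 \<and> x$2 = y$2 \<and> x$3 = y$3 \<and> x$4 = y$4"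
  unfolding vec_eq_iff forall_4 ..

definition qmult :: "real^4 \<Rightarrow> real^4 \<Rightarrow> real^4"  (infixl "\<odot>" 70) where
  "x \<odot> y = quat
     (x$1 * y$1 - x$2 * y$2 - x$3 * y$3 - x$4 * y$4)
     (x$1 * y$2 + x$2 * y$1 + x$3 * y$4 - x$4 * y$3)
     (x$1 * y$3 - x$2 * y$4 + x$3 * y$1 + x$4 * y$2)
     (x$1 * y$4 + x$2 * y$3 - x$3 * y$2 + x$4 * y$1)"

definition qcnj :: "real^4 \<Rightarrow> real^4" where
  "qcnj x = quat (x$1) (- x$2) (- x$3) (- x$4)"

definition qone :: "real^4" where "qone = quat 1 0 0 0"
definition qi :: "real^4" where "qi = quat 0 1 0 0"
definition qj :: "real^4" where "qj = quat 0 0 1 0"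
definition qk :: "real^4" where "qk = quat 0 0 0 1"

text \<open>The reduced norm of the quaternion algebra. Without the square root it takes integer
  values on \<open>hurwitz_lattice\<close>.\<close>

definition qnorm :: "real^4 \<Rightarrow> real" where
  "qnorm x = (norm x)\<^sup>2"

lemma inner_quat: "x \<bullet> y = x$1 * y$1 + x$2 * y$2 + x$3 * y$3 + x$4 * y$4" for x y :: "real^4"
  by (simp add: inner_vec_def sum_4)

lemma qnorm_components: "qnorm x = (x$1)\<^sup>2 + (x$2)\<^sup>2 + (x$3)\<^sup>2 + (x$4)\<^sup>2"
  unfolding qnorm_def power2_norm_eq_inner inner_quat by (simp add: power2_eq_square)

lemmas quat_simps = quat_eq_iff qmult_def qcnj_def qone_def qi_def qj_def qk_def

lemma qmult_assoc: "(x \<odot> y) \<odot> z = x \<odot> (y \<odot> z)"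
  by (simp add: quat_simps algebra_simps)

lemma qmult_add_left: "(x + y) \<odot> z = x \<odot> z + y \<odot> z"
  and qmult_add_right: "x \<odot> (y + z) = x \<odot> y + x \<odot> z"
  and qmult_diff_left: "(x - y) \<odot> z = x \<odot> z - y \<odot> z"
  and qmult_diff_right: "x \<odot> (y - z) = x \<odot> y - x \<odot> z"
  by (simp_all add: quat_simps algebra_simps)

lemma qmult_scaleR_left [simp]: "(c *\<^sub>R x) \<odot> y = c *\<^sub>R (x \<odot> y)"
  and qmult_scaleR_right [simp]: "x \<odot> (c *\<^sub>R y) = c *\<^sub>R (x \<odot> y)"
  and qmult_minus_left [simp]: "(- x) \<odot> y = - (x \<odot> y)"
  and qmult_minus_right [simp]: "x \<odot> (- y) = - (x \<odot> y)"
  by (simp_all add: quat_simps algebra_simps)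

lemma qmult_one [simp]: "qone \<odot> x = x" "x \<odot> qone = x"
  and qmult_zero [simp]: "0 \<odot> x = 0" "x \<odot> 0 = 0"
  by (simp_all add: quat_simps)

lemma qcnj_cnj [simp]: "qcnj (qcnj x) = x"
  and qcnj_mult: "qcnj (x \<odot> y) = qcnj y \<odot> qcnj x"
  and qcnj_one [simp]: "qcnj qone = qone"
  by (simp_all add: quat_simps algebra_simps)

lemma qmult_cnj [simp]: "x \<odot> qcnj x = qnorm x *\<^sub>R qone"
  and qcnj_mult_self [simp]: "qcnj x \<odot> x = qnorm x *\<^sub>R qone"
  by (simp_all add: quat_simps algebra_simps qnorm_components power2_eq_square)

text \<open>This is Euler's four-square identity; it excludes zero divisors and makes
  \<open>nrm\<close> multiplicative on \<open>J\<close>.\<close>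

lemma qnorm_mult: "qnorm (x \<odot> y) = qnorm x * qnorm y"
  by (simp add: qnorm_components qmult_def) algebra

lemma qnorm_scaleR: "qnorm (c *\<^sub>R x) = c\<^sup>2 * qnorm x"
  by (simp add: qnorm_def power_mult_distrib)

lemma qnorm_cnj [simp]: "qnorm (qcnj x) = qnorm x"
  by (simp add: qnorm_components qcnj_def)

lemma qnorm_0 [simp]: "qnorm 0 = 0" and qnorm_one [simp]: "qnorm qone = 1"
  by (simp_all add: qnorm_components qone_def)

lemma qnorm_eq_0_iff [simp]: "qnorm x = 0 \<longleftrightarrow> x = 0"
  and qnorm_nonneg [simp]: "qnorm x \<ge> 0"
  and qnorm_pos_iff [simp]: "qnorm x > 0 \<longleftrightarrow> x \<noteq> 0"
  by (simp_all add: qnorm_def)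

lemma qmult_eq_0_iff [simp]: "x \<odot> y = 0 \<longleftrightarrow> x = 0 \<or> y = 0"
proof -
  have "x \<odot> y = 0 \<longleftrightarrow> qnorm (x \<odot> y) = 0" by (simp del: qnorm_eq_0_iff add: qnorm_eq_0_iff)
  thus ?thesis by (simp add: qnorm_mult del: qnorm_eq_0_iff) simp
qed

lemma qone_nonzero [simp]: "qone \<noteq> 0"
  by (simp add: quat_simps)

lemma qmult_left_cancel: "a \<noteq> 0 \<Longrightarrow> a \<odot> x = a \<odot> y \<longleftrightarrow> x = y"
  using qmult_eq_0_iff[of a "x - y"] by (auto simp: qmult_diff_right)

lemma qmult_right_cancel: "a \<noteq> 0 \<Longrightarrow> x \<odot> a = y \<odot> a \<longleftrightarrow> x = y"
  using qmult_eq_0_iff[of "x - y" a] by (auto simp: qmult_diff_left)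

subsection \<open>Orthogonal transformations of the quaternions\<close>

text \<open>The factors are nonzero but not normalized: compositions need no rescaling, and the
  scalar \<open>sqrt m\<close> of a similarity can later be absorbed into \<open>a\<close>.\<close>

definition quaternionic :: "(real^4 \<Rightarrow> real^4) \<Rightarrow> bool" where
  "quaternionic R \<longleftrightarrow> (\<exists>a b. a \<noteq> 0 \<and> b \<noteq> 0 \<and>
     (R = (\<lambda>x. a \<odot> x \<odot> b) \<or> R = (\<lambda>x. a \<odot> qcnj x \<odot> b)))"

text \<open>Conjugating \<open>c \<odot> x \<odot> d\<close> gives
  \<open>qcnj d \<odot> qcnj x \<odot> qcnj c\<close>, so the two shapes compose like the signs +1
  and -1.\<close>

lemma quaternionic_comp:
  assumes "quaternionic R" "quaternionic S"
  shows "quaternionic (\<lambda>x. R (S x))"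
proof -
  obtain a b where ab: "a \<noteq> 0" "b \<noteq> 0"
    and R: "R = (\<lambda>x. a \<odot> x \<odot> b) \<or> R = (\<lambda>x. a \<odot> qcnj x \<odot> b)"
    using assms(1) unfolding quaternionic_def by blast
  obtain c d where cd: "c \<noteq> 0" "d \<noteq> 0"
    and S: "S = (\<lambda>x. c \<odot> x \<odot> d) \<or> S = (\<lambda>x. c \<odot> qcnj x \<odot> d)"
    using assms(2) unfolding quaternionic_def by blast
  have nz: "qcnj c \<noteq> 0" "qcnj d \<noteq> 0"
    using cd qnorm_cnj[of c] qnorm_cnj[of d] by (metis qnorm_eq_0_iff)+
  from R S show ?thesis
  proof (elim disjE)
    assume "R = (\<lambda>x. a \<odot> x \<odot> b)" "S = (\<lambda>x. c \<odot> x \<odot> d)"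
    hence "(\<lambda>x. R (S x)) = (\<lambda>x. (a \<odot> c) \<odot> x \<odot> (d \<odot> b))" by (simp add: qmult_assoc)
    thus ?thesis unfolding quaternionic_def using ab cd
      by (intro exI[of _ "a \<odot> c"] exI[of _ "d \<odot> b"]) auto
  next
    assume "R = (\<lambda>x. a \<odot> x \<odot> b)" "S = (\<lambda>x. c \<odot> qcnj x \<odot> d)"
    hence "(\<lambda>x. R (S x)) = (\<lambda>x. (a \<odot> c) \<odot> qcnj x \<odot> (d \<odot> b))" by (simp add: qmult_assoc)
    thus ?thesis unfolding quaternionic_def using ab cd
      by (intro exI[of _ "a \<odot> c"] exI[of _ "d \<odot> b"]) auto
  next
    assume "R = (\<lambda>x. a \<odot> qcnj x \<odot> b)" "S = (\<lambda>x. c \<odot> x \<odot> d)"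
    hence "(\<lambda>x. R (S x)) = (\<lambda>x. (a \<odot> qcnj d) \<odot> qcnj x \<odot> (qcnj c \<odot> b))"
      by (simp add: qmult_assoc qcnj_mult)
    thus ?thesis unfolding quaternionic_def using ab nz
      by (intro exI[of _ "a \<odot> qcnj d"] exI[of _ "qcnj c \<odot> b"]) auto
  next
    assume "R = (\<lambda>x. a \<odot> qcnj x \<odot> b)" "S = (\<lambda>x. c \<odot> qcnj x \<odot> d)"
    hence "(\<lambda>x. R (S x)) = (\<lambda>x. (a \<odot> qcnj d) \<odot> x \<odot> (qcnj c \<odot> b))"
      by (simp add: qmult_assoc qcnj_mult)
    thus ?thesis unfolding quaternionic_def using ab nz
      by (intro exI[of _ "a \<odot> qcnj d"] exI[of _ "qcnj c \<odot> b"]) auto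
  qed
qed

text \<open>Reflection in the hyperplane orthogonal to \<open>u\<close>; at \<open>u = 0\<close> it
  is the identity, which is the right value for a vector that is already in place.\<close>

definition refl_along :: "real^4 \<Rightarrow> real^4 \<Rightarrow> real^4" where
  "refl_along u x = x - (2 * (x \<bullet> u) / (u \<bullet> u)) *\<^sub>R u"

text \<open>Rests on the identity \<open>u \<odot> qcnj x \<odot> u = (2 * (x \<bullet> u))
  *\<^sub>R u - (u \<bullet> u) *\<^sub>R x\<close>.\<close>

lemma quaternionic_refl:
  assumes "u \<noteq> 0"
  shows "quaternionic (refl_along u)"
proof -
  have "refl_along u x = ((-1 / (u \<bullet> u)) *\<^sub>R u) \<odot> qcnj x \<odot> u" for x
  proof -
    have "(u \<bullet> u) *\<^sub>R (x - (2 * (x \<bullet> u) / (u \<bullet> u)) *\<^sub>R u) = (u \<bullet> u) *\<^sub>R x - (2 * (x \<bullet> u)) *\<^sub>R u"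
      using assms by (simp add: algebra_simps)
    also have "\<dots> = - (u \<odot> qcnj x \<odot> u)"
      by (simp add: quat_simps inner_quat algebra_simps)
    finally have "(u \<bullet> u) *\<^sub>R refl_along u x = - (u \<odot> qcnj x \<odot> u)"
      by (simp add: refl_along_def)
    hence "refl_along u x = (1 / (u \<bullet> u)) *\<^sub>R (- (u \<odot> qcnj x \<odot> u))"
      using assms by (metis inner_eq_zero_iff scaleR_one scaleR_scaleR nonzero_eq_divide_eq mult.commute)
    thus ?thesis by simp
  qed
  hence "refl_along u = (\<lambda>x. ((-1 / (u \<bullet> u)) *\<^sub>R u) \<odot> qcnj x \<odot> u)" by blast
  thus ?thesis unfolding quaternionic_def using assms
    by (intro exI[of _ "(-1 / (u \<bullet> u)) *\<^sub>R u"] exI[of _ u]) auto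
qed

lemma orthogonal_refl_along: "orthogonal_transformation (refl_along u)"
proof (cases "u = 0")
  case True
  thus ?thesis by (simp add: refl_along_def[abs_def] orthogonal_transformation_def linear_iff)
next
  case False
  have "linear (refl_along u)"
    unfolding linear_iff refl_along_def
    by (simp add: algebra_simps inner_add_left add_divide_distrib)
  moreover have "refl_along u v \<bullet> refl_along u w = v \<bullet> w" for v w
    using False unfolding refl_along_def
    by (simp add: inner_diff_left inner_diff_right inner_commute field_simps power2_eq_square)
  ultimately show ?thesis by (simp add: orthogonal_transformation_def)
qed

lemma refl_along_involution: "refl_along u (refl_along u x) = x"
proof (cases "u = 0")
  case False
  thus ?thesis unfolding refl_along_def
    by (simp add: inner_diff_left inner_diff_right algebra_simps)
qed (simp add: refl_along_def)

text \<open>For equal norms \<open>2 * (x \<bullet> (x - y))\<close> is the squared norm of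
  \<open>x - y\<close>, so exactly one copy of \<open>x - y\<close> is subtracted from
  \<open>x\<close>.\<close>

lemma refl_along_swap:
  assumes "norm x = norm y"
  shows "refl_along (x - y) x = y"
proof (cases "x = y")
  case False
  have "x \<bullet> x = y \<bullet> y" using assms by (simp add: norm_eq_sqrt_inner)
  hence "2 * (x \<bullet> (x - y)) = (x - y) \<bullet> (x - y)"
    by (simp add: inner_diff_left inner_diff_right inner_commute)
  moreover have "(x - y) \<bullet> (x - y) \<noteq> 0" using False by simp
  ultimately have "2 * (x \<bullet> (x - y)) / ((x - y) \<bullet> (x - y)) = 1"
    by (metis divide_self)
  thus ?thesis unfolding refl_along_def by (metis diff_diff_eq2 add_diff_cancel_left' scaleR_one)
qed (simp add: refl_along_def)

lemma refl_along_fix: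
  assumes "z \<bullet> u = 0"
  shows "refl_along u z = z"
  using assms by (simp add: refl_along_def)

text \<open>Each basis vector moved by \<open>R\<close> is repaired by one reflection, which fixes
  those treated before because they are orthogonal to the reflecting vector.\<close>
lemma orthogonal_quaternionic:
  assumes "orthogonal_transformation R"
  shows "quaternionic R"
proof -
  \<comment> \<open>The implication runs from \<open>S\<close> back to \<open>R\<close>, since
    applying the reflection once more recovers \<open>R\<close>. The property thus travels from the
    identity at the end of the chain to the given map.\<close>
  have step: "\<exists>S. orthogonal_transformation S \<and> (quaternionic S \<longrightarrow> quaternionic R) \<and> S e = e \<and>
      (\<forall>z. R z = z \<and> z \<bullet> e = 0 \<longrightarrow> S z = z)"
    if R: "orthogonal_transformation R" and e: "e \<noteq> 0" for R and e :: "real^4"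
  proof -
    let ?u = "R e - e"
    let ?S = "\<lambda>x. refl_along ?u (R x)"
    have ne: "norm (R e) = norm e" using R by (simp add: orthogonal_transformation)
    have "orthogonal_transformation ?S"
      using orthogonal_transformation_compose[OF orthogonal_refl_along R] by (simp add: o_def)
    moreover have "quaternionic ?S \<longrightarrow> quaternionic R"
    proof
      assume q: "quaternionic ?S"
      show "quaternionic R"
      proof (cases "?u = 0")
        case True
        have "?S = R" unfolding refl_along_def True by simp
        thus ?thesis using q by metis
      next
        case False
        have "quaternionic (\<lambda>x. refl_along ?u (?S x))"
          by (rule quaternionic_comp[OF quaternionic_refl[OF False] q])
        thus ?thesis by (simp add: refl_along_involution)
      qed
    qed
    moreover have "?S e = e" using refl_along_swap[OF ne] .
    moreover have "?S z = z" if z: "R z = z" "z \<bullet> e = 0" for z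
    proof -
      have "z \<bullet> R e = R z \<bullet> R e" using z by simp
      also have "\<dots> = z \<bullet> e" using R by (simp add: orthogonal_transformation_def)
      finally have "z \<bullet> ?u = 0" using z by (simp add: inner_diff_right)
      thus ?thesis using z refl_along_fix by simp
    qed
    ultimately show ?thesis by blast
  qed
  have o: "qone \<bullet> qi = 0" "qone \<bullet> qj = 0" "qone \<bullet> qk = 0" "qi \<bullet> qj = 0" "qi \<bullet> qk = 0" "qj \<bullet> qk = 0"
    "qi \<noteq> 0" "qj \<noteq> 0" "qk \<noteq> 0"
    by (simp_all add: inner_quat quat_simps)
  obtain S1 where S1: "orthogonal_transformation S1" "quaternionic S1 \<longrightarrow> quaternionic R" "S1 qone = qone"
    using step[OF assms qone_nonzero] by blast
  obtain S2 where S2: "orthogonal_transformation S2" "quaternionic S2 \<longrightarrow> quaternionic S1"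
     "S2 qone = qone" "S2 qi = qi"
    using step[OF S1(1), of qi] S1 o by blast
  obtain S3 where S3: "orthogonal_transformation S3" "quaternionic S3 \<longrightarrow> quaternionic S2"
     "S3 qone = qone" "S3 qi = qi" "S3 qj = qj"
    using step[OF S2(1), of qj] S2 o by metis
  obtain S4 where S4: "orthogonal_transformation S4" "quaternionic S4 \<longrightarrow> quaternionic S3"
     "S4 qone = qone" "S4 qi = qi" "S4 qj = qj" "S4 qk = qk"
    using step[OF S3(1), of qk] S3 o by metis
  have lin: "linear S4" using S4 orthogonal_transformation_linear by blast
  have "S4 x = x" for x
  proof -
    have x: "x = x$1 *\<^sub>R qone + x$2 *\<^sub>R qi + x$3 *\<^sub>R qj + x$4 *\<^sub>R qk"
      by (simp add: quat_simps)
    have "S4 (x$1 *\<^sub>R qone + x$2 *\<^sub>R qi + x$3 *\<^sub>R qj + x$4 *\<^sub>R qk)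
       = x$1 *\<^sub>R qone + x$2 *\<^sub>R qi + x$3 *\<^sub>R qj + x$4 *\<^sub>R qk"
      using lin S4 by (simp add: linear_add linear_scale)
    thus ?thesis using x by simp
  qed
  hence "S4 = (\<lambda>x. qone \<odot> x \<odot> qone)" by auto
  hence "quaternionic S4" unfolding quaternionic_def using qone_nonzero by blast
  thus ?thesis using S1 S2 S3 S4 by blast
qed

section \<open>The Hurwitz ring\<close>

abbreviation J :: "(real^4) set" where "J \<equiv> hurwitz_lattice"

text \<open>Coordinates with respect to the \<open>\<int>\<close>-basis \<open>(1+i+j+k)/2, i, j, k\<close>, in which membership
  and products involve no parity conditions.\<close>
definition hq :: "int \<Rightarrow> int \<Rightarrow> int \<Rightarrow> int \<Rightarrow> real^4" where
  "hq n a b c = quat (n/2) (n/2 + a) (n/2 + b) (n/2 + c)"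

lemma hq_in_J [simp]: "hq n a b c \<in> J"
proof (cases "even n")
  case True
  then obtain m where "n = 2 * m" by blast
  thus ?thesis by (auto simp: hurwitz_lattice_def hq_def forall_4)
next
  case False
  then obtain m where "n = 2 * m + 1" by (auto elim: oddE)
  thus ?thesis by (auto simp: hurwitz_lattice_def hq_def forall_4 add_divide_distrib)
qed

lemma J_cases:
  assumes "x \<in> J"
  obtains n a b c where "x = hq n a b c"
proof -
  from assms consider "\<forall>i. x $ i \<in> \<int>" | "\<forall>i. x $ i - 1/2 \<in> \<int>"
    by (auto simp: hurwitz_lattice_def)
  thus ?thesis
  proof cases
    case 1
    then obtain m1 m2 m3 m4 where "x$1 = of_int m1" "x$2 = of_int m2" "x$3 = of_int m3" "x$4 = of_int m4"
      by (meson Ints_cases)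
    hence "x = hq (2 * m1) (m2 - m1) (m3 - m1) (m4 - m1)"
      by (simp add: hq_def quat_eq_iff)
    thus ?thesis by (rule that)
  next
    case 2
    then obtain m1 m2 m3 m4 where "x$1 - 1/2 = of_int m1" "x$2 - 1/2 = of_int m2"
      "x$3 - 1/2 = of_int m3" "x$4 - 1/2 = of_int m4"
      by (meson Ints_cases)
    hence "x = hq (2 * m1 + 1) (m2 - m1) (m3 - m1) (m4 - m1)"
      by (simp add: hq_def quat_eq_iff field_simps)
    thus ?thesis by (rule that)
  qed
qed

lemma hq_add: "hq n a b c + hq m d e f = hq (n + m) (a + d) (b + e) (c + f)"
  and hq_scale: "of_int k *\<^sub>R hq n a b c = hq (k * n) (k * a) (k * b) (k * c)"
  and hq_cnj: "qcnj (hq n a b c) = hq n (- n - a) (- n - b) (- n - c)"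
  by (simp_all add: hq_def quat_simps algebra_simps)

lemma hq_mult: "hq n a b c \<odot> hq m d e f = hq
     (- n * m - n * (d + e + f) - m * (a + b + c) - 2 * (a * d + b * e + c * f))
     (n * m + n * d + n * f + m * a + m * b + b * f - c * e + a * d + b * e + c * f)
     (n * m + n * e + n * d + m * b + m * c + c * d - a * f + a * d + b * e + c * f)
     (n * m + n * f + n * e + m * c + m * a + a * e - b * d + a * d + b * e + c * f)"
  by (simp add: hq_def quat_simps field_simps)

lemma qnorm_hq: "qnorm (hq n a b c) = of_int (n * n + n * (a + b + c) + a * a + b * b + c * c)"
  by (simp add: hq_def qnorm_components power2_eq_square field_simps)

lemma J_add: "x \<in> J \<Longrightarrow> y \<in> J \<Longrightarrow> x + y \<in> J"
  by (elim J_cases) (simp add: hq_add)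

lemma J_mult: "x \<in> J \<Longrightarrow> y \<in> J \<Longrightarrow> x \<odot> y \<in> J"
  by (elim J_cases) (simp add: hq_mult)

lemma J_scale: "x \<in> J \<Longrightarrow> of_int k *\<^sub>R x \<in> J"
  by (elim J_cases) (simp add: hq_scale)

lemma J_scale_nat: "x \<in> J \<Longrightarrow> of_nat k *\<^sub>R x \<in> J"
  using J_scale[of x "int k"] by simp

lemma J_minus: "x \<in> J \<Longrightarrow> - x \<in> J"
  using J_scale[of x "-1"] by simp

lemma J_diff: "x \<in> J \<Longrightarrow> y \<in> J \<Longrightarrow> x - y \<in> J"
  using J_add[of x "-y"] J_minus[of y] by simp

lemma J_cnj: "x \<in> J \<Longrightarrow> qcnj x \<in> J"
  by (elim J_cases) (simp add: hq_cnj)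

lemma J_cnj_iff [simp]: "qcnj x \<in> J \<longleftrightarrow> x \<in> J"
  using J_cnj[of x] J_cnj[of "qcnj x"] by auto

lemma qcnj_image_J: "qcnj ` J = J"
  using J_cnj by (auto simp: image_iff) (metis qcnj_cnj J_cnj)

lemma basis_in_J [simp]: "0 \<in> J" "qone \<in> J" "qi \<in> J" "qj \<in> J" "qk \<in> J"
proof -
  have "0 = hq 0 0 0 0" "qone = hq 2 (-1) (-1) (-1)" "qi = hq 0 1 0 0" "qj = hq 0 0 1 0" "qk = hq 0 0 0 1"
    by (simp_all add: hq_def quat_simps)
  thus "0 \<in> J" "qone \<in> J" "qi \<in> J" "qj \<in> J" "qk \<in> J" by (metis hq_in_J)+
qed

text \<open>A natural number, so that parity and divisibility make sense. The floor is exact on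
  \<open>J\<close> by \<open>real_nrm\<close>; elsewhere the value carries no meaning.\<close>

definition nrm :: "real^4 \<Rightarrow> nat" where
  "nrm x = nat \<lfloor>qnorm x\<rfloor>"

lemma real_nrm:
  assumes "x \<in> J"
  shows "real (nrm x) = qnorm x"
proof -
  obtain k where k: "qnorm x = of_int k" using assms by (elim J_cases) (metis qnorm_hq)
  have "of_int k \<ge> (0::real)" unfolding k[symmetric] by simp
  hence "k \<ge> 0" by simp
  thus ?thesis by (simp add: nrm_def k)
qed

lemma nrm_mult: "x \<in> J \<Longrightarrow> y \<in> J \<Longrightarrow> nrm (x \<odot> y) = nrm x * nrm y"
  by (simp flip: of_nat_eq_iff[where 'a = real] add: real_nrm J_mult qnorm_mult)

lemma nrm_scale: "x \<in> J \<Longrightarrow> nrm (real k *\<^sub>R x) = k^2 * nrm x"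
  by (simp flip: of_nat_eq_iff[where 'a = real] add: real_nrm J_scale_nat qnorm_scaleR)

lemma nrm_cnj [simp]: "nrm (qcnj x) = nrm x"
  by (simp add: nrm_def)

lemma nrm_pos_iff: "x \<in> J \<Longrightarrow> nrm x > 0 \<longleftrightarrow> x \<noteq> 0"
  using real_nrm[of x] by (metis gr0I of_nat_0 of_nat_0_less_iff qnorm_eq_0_iff qnorm_pos_iff)

text \<open>The prime above 2 in the Hurwitz ring: it generates the two-sided ideal of elements of
  even norm.\<close>

definition one_plus_i :: "real^4" where "one_plus_i = qone + qi"

lemma one_plus_i_in_J [simp]: "one_plus_i \<in> J"
  by (simp add: one_plus_i_def J_add)

lemma nrm_one_plus_i [simp]: "nrm one_plus_i = 2" and qnorm_one_plus_i [simp]: "qnorm one_plus_i = 2"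
  by (simp_all add: nrm_def one_plus_i_def qnorm_components quat_simps)

text \<open>Modulo 2 the norm form is (n + 1)(a + b + c + 1) + 1, so an even norm forces
  \<open>n\<close> and \<open>a + b + c\<close> to be even. The quotient, half of
  \<open>qcnj one_plus_i \<odot> x\<close>, then has integer coordinates.\<close>

lemma even_nrm_left_factor:
  assumes "x \<in> J" "even (nrm x)"
  obtains y where "y \<in> J" "x = one_plus_i \<odot> y"
proof -
  obtain n a b c where x: "x = hq n a b c" using assms J_cases by blast
  have "real (nrm x) = of_int (n * n + n * (a + b + c) + a * a + b * b + c * c)"
    using real_nrm[OF assms(1)] by (simp add: x qnorm_hq)
  hence "int (nrm x) = n * n + n * (a + b + c) + a * a + b * b + c * c" by linarith
  hence "even (n * n + n * (a + b + c) + a * a + b * b + c * c)"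
    using assms(2) by (metis even_of_nat)
  hence "even n" "even (a + b + c)" by (auto simp: even_add)
  then obtain m k where m: "n = 2 * m" and k: "a + b + c = 2 * k" by (metis evenE)
  have c: "c = 2 * k - a - b" using k by simp
  have "x = one_plus_i \<odot> hq (2 * m + a) (- m) (k - a) (k - a - b - m)"
    by (simp add: x m c hq_def one_plus_i_def quat_simps field_simps)
  thus ?thesis using that hq_in_J by blast
qed

lemma even_nrm_right_factor:
  assumes "x \<in> J" "even (nrm x)"
  obtains y where "y \<in> J" "x = y \<odot> one_plus_i"
proof -
  obtain y where y: "y \<in> J" "qcnj x = one_plus_i \<odot> y"
    using even_nrm_left_factor[of "qcnj x"] assms by auto
  have "x = qcnj (one_plus_i \<odot> y)" using y(2) by (metis qcnj_cnj)
  \<comment> \<open>1 - i = (-i)(1 + i): conjugation changes the factor 1 + i only by a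
    unit.\<close>
  also have "\<dots> = qcnj y \<odot> ((- qi) \<odot> one_plus_i)"
    unfolding qcnj_mult by (simp add: one_plus_i_def quat_simps)
  finally have "x = (qcnj y \<odot> (- qi)) \<odot> one_plus_i" by (simp only: qmult_assoc)
  thus ?thesis
    by (rule that[rotated]) (intro J_mult J_minus J_cnj y basis_in_J)
qed

text \<open>The left and the right ideal of 1 + i coincide, both being the elements of even norm.
  This lets a factor 1 + i pass through \<open>J\<close> from one side to the other.\<close>

lemma one_plus_i_J_swap:
  assumes "x \<in> J"
  obtains y where "y \<in> J" "one_plus_i \<odot> x = y \<odot> one_plus_i"
  using even_nrm_right_factor[of "one_plus_i \<odot> x"] assms by (auto simp: J_mult nrm_mult)

lemma J_swap_one_plus_i:
  assumes "x \<in> J"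
  obtains y where "y \<in> J" "x \<odot> one_plus_i = one_plus_i \<odot> y"
  using even_nrm_left_factor[of "x \<odot> one_plus_i"] assms by (auto simp: J_mult nrm_mult)

lemma finite_J_norm_le: "finite {x \<in> J. norm x \<le> r}"
proof -
  let ?K = "{- (nat \<lceil>2 * r\<rceil>) .. int (nat \<lceil>2 * r\<rceil>)}"
  have "{x \<in> J. norm x \<le> r} \<subseteq> (\<lambda>(n, a, b, c). hq n a b c) ` (?K \<times> ?K \<times> ?K \<times> ?K)"
  proof
    fix x assume x: "x \<in> {x \<in> J. norm x \<le> r}"
    then obtain n a b c where h: "x = hq n a b c" using J_cases by blast
    have "\<bar>x $ i\<bar> \<le> r" for i using x component_le_norm_cart[of x i] by auto
    from this[of 1] this[of 2] this[of 3] this[of 4]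
    have "\<bar>of_int n\<bar> \<le> 2 * r" "\<bar>of_int a\<bar> \<le> 2 * r" "\<bar>of_int b\<bar> \<le> 2 * r" "\<bar>of_int c\<bar> \<le> 2 * r"
      by (auto simp: h hq_def)
    moreover have "m \<in> ?K" if "\<bar>of_int m\<bar> \<le> 2 * r" for m :: int
    proof -
      have "\<bar>m\<bar> \<le> \<lceil>2 * r\<rceil>" using that by linarith
      thus ?thesis by (auto simp: abs_le_iff) (linarith | simp)+
    qed
    ultimately have "n \<in> ?K" "a \<in> ?K" "b \<in> ?K" "c \<in> ?K" by blast+
    thus "x \<in> (\<lambda>(n, a, b, c). hq n a b c) ` (?K \<times> ?K \<times> ?K \<times> ?K)"
      unfolding h by force
  qed
  thus ?thesis
    by (rule finite_subset) (intro finite_imageI finite_cartesian_product finite_atLeastAtMost_int)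
qed

lemma norm_le_sqrt_iff: "norm x \<le> sqrt t \<longleftrightarrow> qnorm x \<le> t"
  using real_sqrt_le_iff[of "(norm x)\<^sup>2" t] by (simp add: qnorm_def)

lemma finite_J_nrm_le: "finite {x \<in> J. nrm x \<le> n}"
  by (rule finite_subset[OF _ finite_J_norm_le[of "sqrt n"]])
     (auto simp: norm_le_sqrt_iff simp flip: real_nrm)

lemma finite_J_nrm_eq: "finite {x \<in> J. nrm x = n}"
  by (rule finite_subset[OF _ finite_J_nrm_le[of n]]) auto

subsection \<open>Units\<close>

definition J_units :: "(real^4) set" where
  "J_units = {u \<in> J. nrm u = 1}"

lemma J_unitsD: "u \<in> J_units \<Longrightarrow> u \<in> J" "u \<in> J_units \<Longrightarrow> qnorm u = 1"
  using real_nrm[of u] by (auto simp: J_units_def)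

lemma J_units_inverse:
  "u \<in> J_units \<Longrightarrow> u \<odot> qcnj u = qone" "u \<in> J_units \<Longrightarrow> qcnj u \<odot> u = qone"
  by (auto dest: J_unitsD)

lemma J_unitsI:
  assumes "x \<in> J" "y \<in> J" "x \<odot> y = qone"
  shows "x \<in> J_units" "y \<in> J_units"
proof -
  have "nrm x * nrm y = 1"
    using assms by (simp flip: nrm_mult) (simp add: nrm_def)
  thus "x \<in> J_units" "y \<in> J_units" using assms by (auto simp: J_units_def)
qed

text \<open>Norm 1 confines the four integer coordinates to a small box, which is then searched by
  evaluation.\<close>

lemma card_J_units: "card J_units = 24"
proof -
  define K where "K = List.filter (\<lambda>(n, a, b, c). n * n + n * (a + b + c) + a * a + b * b + c * c = (1::int))
     (List.product [-2..2] (List.product [-1..1] (List.product [-1..1] [-1..1])))"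
  have "inj_on (\<lambda>(n, a, b, c). hq n a b c) (set K)"
    unfolding inj_on_def hq_def quat_eq_iff by (simp add: Ball_def split: prod.split)
  moreover have "(\<lambda>(n, a, b, c). hq n a b c) ` set K = J_units"
  proof (intro equalityI subsetI)
    fix x assume "x \<in> (\<lambda>(n, a, b, c). hq n a b c) ` set K"
    then obtain n a b c where h: "x = hq n a b c" and k: "(n, a, b, c) \<in> set K" by auto
    have "n * n + n * (a + b + c) + a * a + b * b + c * c = 1"
      using k unfolding K_def set_filter by simp
    hence "qnorm x = of_int 1" unfolding h qnorm_hq by (simp only:)
    thus "x \<in> J_units" by (simp add: J_units_def nrm_def h)
  next
    fix x assume x: "x \<in> J_units"
    then obtain n a b c where h: "x = hq n a b c" using J_unitsD J_cases by blast
    have "qnorm (hq n a b c) = 1" using x J_unitsD h by blast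
    hence 1: "n * n + n * (a + b + c) + a * a + b * b + c * c = 1"
      unfolding qnorm_hq by linarith
    have q: "(x$1)\<^sup>2 + (x$2)\<^sup>2 + (x$3)\<^sup>2 + (x$4)\<^sup>2 = 1"
      using J_unitsD(2)[OF x] by (simp only: qnorm_components)
    have "n\<^sup>2 \<le> 4"
    proof -
      have "(of_int n :: real)\<^sup>2 = 4 * (x$1)\<^sup>2" by (simp add: h hq_def power_divide)
      also have "\<dots> \<le> 4" using q by (smt (verit) zero_le_power2)
      finally show ?thesis by (simp flip: of_int_power)
    qed
    \<comment> \<open>From (y - x)^2 <= 2 (x^2 + y^2); any bound below 4 confines the integer
      \<open>d\<close> to -1, 0, 1.\<close>
    have ad: "d\<^sup>2 \<le> 3" if "of_int d = y - x$1" "(x$1)\<^sup>2 + y\<^sup>2 \<le> 1" for d :: int and y :: real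
    proof -
      have "(of_int d :: real)\<^sup>2 \<le> 2 * ((x$1)\<^sup>2 + y\<^sup>2)"
        using zero_le_power2[of "x$1 + y"] unfolding that(1) by (simp add: power2_eq_square algebra_simps)
      also have "\<dots> \<le> 3" using that(2) by simp
      finally show ?thesis by (simp flip: of_int_power)
    qed
    have "a\<^sup>2 \<le> 3" "b\<^sup>2 \<le> 3" "c\<^sup>2 \<le> 3"
      using q zero_le_power2[of "x$2"] zero_le_power2[of "x$3"] zero_le_power2[of "x$4"]
      by (intro ad[of a "x$2"] ad[of b "x$3"] ad[of c "x$4"]; (simp add: h hq_def; fail | linarith))+
    note sq = this \<open>n\<^sup>2 \<le> 4\<close>
    have bd: "\<bar>d\<bar> \<le> e" if "d\<^sup>2 < (e + 1)\<^sup>2" "e \<ge> 0" for d e :: int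
      using that abs_le_square_iff[of "e + 1" d] by linarith
    have "n \<in> {-2..2}" "a \<in> {-1..1}" "b \<in> {-1..1}" "c \<in> {-1..1}"
      using sq bd[of n 2] bd[of a 1] bd[of b 1] bd[of c 1] by auto
    hence "(n, a, b, c) \<in> set K" using 1 unfolding K_def by (simp only: set_filter mem_Collect_eq set_product set_upto mem_Sigma_iff case_prod_conv simp_thms)
    thus "x \<in> (\<lambda>(n, a, b, c). hq n a b c) ` set K" unfolding h by force
  qed
  ultimately have "card J_units = card (set K)" by (metis card_image)
  also have "\<dots> = length K" 
    unfolding K_def by (intro distinct_card distinct_filter distinct_product distinct_upto)
  also have "length K = 24" unfolding K_def by code_simp
  finally show ?thesis .
qed

subsection \<open>Primitive elements of odd norm\<close>

text \<open>For \<open>d = 0\<close> the scaled vector is 0 and lies in \<open>J\<close>; the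
  conclusion is therefore \<open>d \<le> 1\<close> and not \<open>d = 1\<close>.\<close>

definition odd_prims :: "(real^4) set" where
  "odd_prims = {x \<in> J. odd (nrm x) \<and> (\<forall>d::nat. (1 / real d) *\<^sub>R x \<in> J \<longrightarrow> d \<le> 1)}"

lemma odd_primsD:
  assumes "x \<in> odd_prims"
  shows "x \<in> J" "odd (nrm x)" "x \<noteq> 0" "\<And>d::nat. (1 / real d) *\<^sub>R x \<in> J \<Longrightarrow> d \<le> 1"
  using assms by (auto simp: odd_prims_def nrm_def)

lemma odd_nrm_factor:
  assumes "x \<in> J" "odd (nrm x)"
  obtains d :: nat and y where "d > 0" "odd d" "y \<in> odd_prims" "x = real d *\<^sub>R y"
  using assms
proof (induction "nrm x" arbitrary: x thesis rule: less_induct)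
  case less
  show ?case
  proof (cases "x \<in> odd_prims")
    case True
    thus ?thesis using less.prems(1)[of 1 x] by simp
  next
    case False
    then obtain e :: nat where e: "(1 / real e) *\<^sub>R x \<in> J" "e > 1"
      using less.prems by (auto simp: odd_prims_def not_le)
    let ?y = "(1 / real e) *\<^sub>R x"
    have x: "x = real e *\<^sub>R ?y" using e(2) by simp
    have n: "nrm x = e\<^sup>2 * nrm ?y" using nrm_scale[OF e(1)] x by metis
    hence o: "odd (nrm ?y)" "odd e" using less.prems(3) by auto
    have "nrm ?y > 0" using o by (metis even_zero gr0I)
    moreover have "e\<^sup>2 > 1" using e(2) by (intro one_less_power) auto
    ultimately have "nrm ?y < nrm x" 
      using mult_less_mono1[of 1 "e\<^sup>2" "nrm ?y"] n by (simp only: mult_1)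
    then obtain d y where d: "d > 0" "odd d" "y \<in> odd_prims" "?y = real d *\<^sub>R y"
      using less.hyps e(1) o(1) by metis
    have "x = real (e * d) *\<^sub>R y" using x d(4) by simp
    thus ?thesis using less.prems(1)[of "e * d" y] d o e by simp
  qed
qed

lemma bezout_closed:
  fixes G :: "int set"
  assumes "\<And>x y. x \<in> G \<Longrightarrow> y \<in> G \<Longrightarrow> x + y \<in> G" "\<And>x c. x \<in> G \<Longrightarrow> c * x \<in> G"
    and "x \<in> G" "y \<in> G"
  shows "gcd x y \<in> G"
  using bezout_int[of x y] assms by metis

text \<open>The integers \<open>m\<close> with \<open>m b \<in> J\<close> form an ideal. It contains the odd number \<open>nrm a\<close> and,
  by hypothesis, four times the coordinates of \<open>a\<close>, so its generator divides \<open>a\<close>.\<close>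
lemma odd_prim_cancel:
  assumes a: "a \<in> odd_prims"
    and c: "\<And>i. (4 * a $ i) *\<^sub>R b \<in> J" and n: "qnorm a *\<^sub>R b \<in> J"
  shows "b \<in> J"
proof -
  define G where "G = {m::int. of_int m *\<^sub>R b \<in> J}"
  have G_add: "x + y \<in> G" if "x \<in> G" "y \<in> G" for x y
    using J_add[of "of_int x *\<^sub>R b" "of_int y *\<^sub>R b"] that by (simp add: G_def scaleR_add_left)
  have G_mult: "k * x \<in> G" if "x \<in> G" for k x
    using J_scale[of "of_int x *\<^sub>R b" k] that by (simp add: G_def)
  have G_gcd: "gcd x y \<in> G" if "x \<in> G" "y \<in> G" for x y
    using bezout_closed[of G x y] G_add G_mult that by blast
  obtain m p q r where h: "a = hq m p q r" using odd_primsD(1)[OF a] J_cases by blast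
  \<comment> \<open>\<open>4 * a $ 1\<close> equals \<open>2 * m\<close>, and the differences of the
    other coordinates from the first give \<open>4 * p\<close>, \<open>4 * q\<close>,
    \<open>4 * r\<close>.\<close>
  have m: "2 * m \<in> G" using c[of 1] by (simp add: h hq_def G_def)
  have pqr: "4 * p \<in> G" "4 * q \<in> G" "4 * r \<in> G"
    using J_diff[OF c[of 2] c[of 1]] J_diff[OF c[of 3] c[of 1]] J_diff[OF c[of 4] c[of 1]]
    by (simp_all add: h hq_def G_def flip: scaleR_diff_left)
  have N: "int (nrm a) \<in> G" using n by (simp add: G_def real_nrm[OF odd_primsD(1)[OF a]])
  define g where "g = gcd (int (nrm a)) (gcd (2 * m) (gcd (4 * p) (gcd (4 * q) (4 * r))))"
  have gG: "g \<in> G" unfolding g_def by (intro G_gcd N m pqr)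
  have dvd: "g dvd int (nrm a)" "g dvd 2 * m" "g dvd 4 * p" "g dvd 4 * q" "g dvd 4 * r"
    unfolding g_def by (meson dvd_trans gcd_dvd1 gcd_dvd2)+
  \<comment> \<open>An odd \<open>g\<close> is coprime to 2 and 4, so the factors caused by the
    half-integers and by the averaging drop out; primitivity of \<open>a\<close> then gives
    \<open>g = 1\<close>.\<close>
  have "odd g" using dvd(1) odd_primsD(2)[OF a] by (meson dvd_trans even_of_nat)
  hence "coprime g 2" by simp
  moreover from this have "coprime g (2 ^ 2)" by (simp only: coprime_power_right_iff simp_thms)
  hence "coprime g 4" by simp
  ultimately have "g dvd m" "g dvd p" "g dvd q" "g dvd r"
    using dvd by (meson coprime_dvd_mult_right_iff)+
  then obtain m' p' q' r' where "m = g * m'" "p = g * p'" "q = g * q'" "r = g * r'"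
    by (meson dvdE)
  hence a': "a = of_int g *\<^sub>R hq m' p' q' r'" by (simp add: h hq_scale)
  have "g \<ge> 0" by (simp add: g_def)
  moreover have "g \<noteq> 0" using \<open>odd g\<close> by auto
  ultimately have g: "g > 0" by simp
  hence "(1 / real (nat g)) *\<^sub>R a = hq m' p' q' r'" unfolding a' by simp
  hence "(1 / real (nat g)) *\<^sub>R a \<in> J" by simp
  hence "nat g \<le> 1" by (rule odd_primsD(4)[OF a])
  hence "g = 1" using g by simp
  thus ?thesis using gG by (simp add: G_def)
qed

text \<open>Each imaginary unit is fixed by two of the four conjugations and negated by the other
  two, so only the real part survives.\<close>

lemma conj_sum:
  "y + qi \<odot> y \<odot> qcnj qi + qj \<odot> y \<odot> qcnj qj + qk \<odot> y \<odot> qcnj qk = (4 * y $ 1) *\<^sub>R qone"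
  by (simp add: quat_simps)

lemma qmult_basis_nth1:
  "(x \<odot> qone) $ 1 = x $ 1" "(x \<odot> qi) $ 1 = - x $ 2" "(x \<odot> qj) $ 1 = - x $ 3" "(x \<odot> qk) $ 1 = - x $ 4"
  by (simp_all add: quat_simps)

text \<open>Right multiplication by 1, i, j, k brings every coordinate, up to sign, into the real
  place, which is the one that \<open>conj_sum\<close> controls.\<close>

lemma J_coordinateI:
  assumes "\<And>f. f \<in> J \<Longrightarrow> (4 * (a \<odot> f) $ 1) *\<^sub>R b \<in> J"
  shows "(4 * a $ i) *\<^sub>R b \<in> J"
proof -
  have "(4 * a$1) *\<^sub>R b \<in> J" "- ((4 * a$2) *\<^sub>R b) \<in> J" "- ((4 * a$3) *\<^sub>R b) \<in> J" "- ((4 * a$4) *\<^sub>R b) \<in> J"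
    using assms[of qone] assms[of qi] assms[of qj] assms[of qk]
    by (simp_all add: qmult_basis_nth1)
  hence "\<forall>i. (4 * a $ i) *\<^sub>R b \<in> J" unfolding forall_4 by (metis J_minus minus_minus)
  thus ?thesis by blast
qed

section \<open>The lattices a J b and the uniqueness of their factors\<close>

definition bimod :: "real^4 \<Rightarrow> real^4 \<Rightarrow> (real^4) set" where
  "bimod a b = (\<lambda>x. a \<odot> x \<odot> b) ` J"

text \<open>Since \<open>a\<close> is primitive of odd norm, the two-sided ideal \<open>J a J\<close> is all of \<open>J\<close>.\<close>
lemma bimod_subset_J_right:
  assumes a: "a \<in> odd_prims" and sub: "bimod a b \<subseteq> J"
  shows "b \<in> J"
proof (rule odd_prim_cancel[OF a])
  have ab: "x \<odot> (a \<odot> y \<odot> b) \<in> J" if "x \<in> J" "y \<in> J" for x y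
    using that sub J_mult[of x "a \<odot> y \<odot> b"] by (auto simp: bimod_def)
  show "(4 * a $ i) *\<^sub>R b \<in> J" for i
  proof (rule J_coordinateI)
    fix f assume f: "f \<in> J"
    let ?y = "a \<odot> f"
    have "(4 * ?y $ 1) *\<^sub>R b =
       (?y + qi \<odot> ?y \<odot> qcnj qi + qj \<odot> ?y \<odot> qcnj qj + qk \<odot> ?y \<odot> qcnj qk) \<odot> b"
      unfolding conj_sum by simp
    also have "\<dots> = qone \<odot> (a \<odot> f \<odot> b) + qi \<odot> (a \<odot> (f \<odot> qcnj qi) \<odot> b)
        + qj \<odot> (a \<odot> (f \<odot> qcnj qj) \<odot> b) + qk \<odot> (a \<odot> (f \<odot> qcnj qk) \<odot> b)"
      by (simp add: qmult_add_left qmult_assoc)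
    also have "\<dots> \<in> J" using f by (intro J_add ab J_mult J_cnj basis_in_J)
    finally show "(4 * ?y $ 1) *\<^sub>R b \<in> J" .
  qed
  have "qnorm a *\<^sub>R b = qcnj a \<odot> (a \<odot> qone \<odot> b)"
    by (simp flip: qmult_assoc)
  also have "\<dots> \<in> J" using odd_primsD(1)[OF a] by (intro ab J_cnj basis_in_J)
  finally show "qnorm a *\<^sub>R b \<in> J" .
qed

text \<open>\<open>odd_prim_cancel\<close> is applied to the inverse \<open>b\<close> of
  \<open>y\<close>: as J y lies in y J, each term of \<open>conj_sum\<close> for
  \<open>y \<odot> f\<close> is \<open>y\<close> times an element of \<open>J\<close>, so
  \<open>b\<close> times their sum stays in \<open>J\<close>. Hence \<open>b\<close> itself lies in
  \<open>J\<close>.\<close>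

lemma odd_prim_normalizer_unit:
  assumes y: "y \<in> odd_prims" and st: "\<And>x. x \<in> J \<Longrightarrow> \<exists>z\<in>J. x \<odot> y = y \<odot> z"
  shows "y \<in> J_units"
proof -
  define b where "b = (1 / qnorm y) *\<^sub>R qcnj y"
  have yJ: "y \<in> J" and y0: "y \<noteq> 0" using odd_primsD[OF y] by auto
  have binv: "b \<odot> y = qone" and yinv: "y \<odot> b = qone" using y0 by (simp_all add: b_def)
  have "b \<in> J"
  proof (rule odd_prim_cancel[OF y])
    show "(4 * y $ i) *\<^sub>R b \<in> J" for i
    proof (rule J_coordinateI)
      fix f assume f: "f \<in> J"
      have *: "\<exists>w\<in>J. e \<odot> (y \<odot> f) \<odot> qcnj e = y \<odot> w" if e: "e \<in> J" for e
      proof -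
        obtain z where z: "z \<in> J" "e \<odot> y = y \<odot> z" using st[OF e] by blast
        have "e \<odot> (y \<odot> f) \<odot> qcnj e = y \<odot> (z \<odot> f \<odot> qcnj e)"
          using z(2) by (metis qmult_assoc)
        thus ?thesis using z f e by (intro bexI[of _ "z \<odot> f \<odot> qcnj e"] J_mult) auto
      qed
      obtain w1 w2 w3 where w: "w1 \<in> J" "w2 \<in> J" "w3 \<in> J"
        "qi \<odot> (y \<odot> f) \<odot> qcnj qi = y \<odot> w1" "qj \<odot> (y \<odot> f) \<odot> qcnj qj = y \<odot> w2"
        "qk \<odot> (y \<odot> f) \<odot> qcnj qk = y \<odot> w3"
        using *[of qi] *[of qj] *[of qk] by auto
      have "(4 * (y \<odot> f) $ 1) *\<^sub>R b = b \<odot> ((4 * (y \<odot> f) $ 1) *\<^sub>R qone)" by simp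
      also have "\<dots> = b \<odot> (y \<odot> f + y \<odot> w1 + y \<odot> w2 + y \<odot> w3)"
        unfolding conj_sum[symmetric] w ..
      also have "\<dots> = (b \<odot> y) \<odot> (f + w1 + w2 + w3)"
        by (simp add: qmult_add_right qmult_assoc)
      also have "\<dots> = f + w1 + w2 + w3" by (simp add: binv)
      also have "\<dots> \<in> J" using f w by (intro J_add)
      finally show "(4 * (y \<odot> f) $ 1) *\<^sub>R b \<in> J" .
    qed
    show "qnorm y *\<^sub>R b \<in> J" using y0 yJ by (simp add: b_def)
  qed
  thus ?thesis using J_unitsI yinv yJ by blast
qed

lemma odd_prims_mult_unit:
  assumes "a \<in> odd_prims" "u \<in> J_units"
  shows "a \<odot> u \<in> odd_prims"
proof -
  have "d \<le> 1" if "(1 / real d) *\<^sub>R (a \<odot> u) \<in> J" for d :: nat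
  proof -
    have "(1 / real d) *\<^sub>R (a \<odot> u) \<odot> qcnj u \<in> J"
      using that assms by (intro J_mult) (auto dest: J_unitsD)
    hence "(1 / real d) *\<^sub>R a \<in> J"
      by (simp only: qmult_assoc qmult_scaleR_left J_units_inverse[OF assms(2)] qmult_one)
    thus ?thesis by (rule odd_primsD(4)[OF assms(1)])
  qed
  thus ?thesis using odd_primsD[OF assms(1)] assms(2)
    by (auto simp: odd_prims_def nrm_mult J_units_def J_mult)
qed

text \<open>After division by the gcd, Bezout writes \<open>x\<close> as \<open>n'\<close> times an
  element of \<open>J\<close>; primitivity gives \<open>n' = 1\<close>, so \<open>n\<close> divides
  \<open>m\<close>. The roles are symmetric.\<close>

lemma odd_prims_scale_eq:
  assumes "x \<in> odd_prims" "y \<in> odd_prims" "real m *\<^sub>R x = real n *\<^sub>R y" "m > 0" "n > 0"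
  shows "m = n" "x = y"
proof -
  have *: "n \<le> m" if "x \<in> odd_prims" "y \<in> odd_prims" "real m *\<^sub>R x = real n *\<^sub>R y" "m > 0" "n > 0"
    for x y m n
  proof -
    define g where "g = gcd m n"
    have g: "g > 0" using that by (simp add: g_def)
    obtain m' n' where mn: "m = g * m'" "n = g * n'" and co: "coprime m' n'"
      using gcd_coprime_exists[of m n] g unfolding g_def mult.commute[of "gcd m n"] by blast
    have n': "n' > 0" using mn that by auto
    have "real g *\<^sub>R (real m' *\<^sub>R x) = real g *\<^sub>R (real n' *\<^sub>R y)" using that(3) mn by simp
    hence e: "real m' *\<^sub>R x = real n' *\<^sub>R y" unfolding scaleR_cancel_left using g by simp
    obtain u v where uv: "u * int m' + v * int n' = 1"
      using bezout_int[of "int m'" "int n'"] co by (auto simp: coprime_iff_gcd_eq_1)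
    have "x = of_int (u * int m' + v * int n') *\<^sub>R x" using uv by simp
    also have "\<dots> = of_int u *\<^sub>R (real m' *\<^sub>R x) + real n' *\<^sub>R (of_int v *\<^sub>R x)"
      by (simp add: algebra_simps)
    also have "\<dots> = real n' *\<^sub>R (of_int u *\<^sub>R y + of_int v *\<^sub>R x)"
      unfolding e by (simp add: algebra_simps)
    finally have "(1 / real n') *\<^sub>R x = (1 / real n') *\<^sub>R (real n' *\<^sub>R (of_int u *\<^sub>R y + of_int v *\<^sub>R x))"
      by (rule arg_cong)
    also have "\<dots> = of_int u *\<^sub>R y + of_int v *\<^sub>R x" using n' by simp
    also have "\<dots> \<in> J" using that odd_primsD by (intro J_add J_scale) auto
    finally have "n' \<le> 1" by (rule odd_primsD(4)[OF that(1)])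
    hence "n = g" using n' mn(2) by simp
    thus ?thesis using mn(1) that(4) by (simp add: dvd_imp_le)
  qed
  show "m = n" using *[of x y m n] *[of y x n m] assms by simp
  thus "x = y" using assms by simp
qed

lemma bimod_unit:
  assumes "u \<in> J_units" "v \<in> J_units"
  shows "bimod (a \<odot> u) (v \<odot> b) = bimod a b"
proof -
  have "\<exists>y\<in>J. a \<odot> x \<odot> b = (a \<odot> u) \<odot> y \<odot> (v \<odot> b)" if "x \<in> J" for x
  proof -
    have "(a \<odot> u) \<odot> (qcnj u \<odot> x \<odot> qcnj v) \<odot> (v \<odot> b) = a \<odot> ((u \<odot> qcnj u) \<odot> (x \<odot> ((qcnj v \<odot> v) \<odot> b)))"
      by (simp only: qmult_assoc)
    also have "\<dots> = a \<odot> x \<odot> b" using assms by (simp only: J_units_inverse qmult_one qmult_assoc)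
    finally show ?thesis using that assms J_unitsD
      by (intro bexI[of _ "qcnj u \<odot> x \<odot> qcnj v"] J_mult J_cnj) auto
  qed
  moreover have "\<exists>y\<in>J. (a \<odot> u) \<odot> x \<odot> (v \<odot> b) = a \<odot> y \<odot> b" if "x \<in> J" for x
    using that assms J_unitsD
    by (intro bexI[of _ "u \<odot> x \<odot> v"] J_mult) (auto simp: qmult_assoc)
  ultimately show ?thesis unfolding bimod_def by (auto simp: image_iff)
qed

text \<open>The left order \<open>a J a\<inverse>\<close> of \<open>a J b\<close> determines \<open>a\<close> up to the normalizer of \<open>J\<close>, and the
  only elements of odd norm that normalize \<open>J\<close> are integer multiples of units.\<close>
lemma bimod_eq_imp_units:
  assumes a: "a \<in> odd_prims" "a' \<in> odd_prims" and b: "b \<noteq> 0" "b' \<noteq> 0"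
    and eq: "bimod a b = bimod a' b'"
  obtains u v where "u \<in> J_units" "v \<in> J_units" "a' = a \<odot> u" "b' = v \<odot> b"
proof -
  have aJ: "a \<in> J" "a' \<in> J" using a odd_primsD by auto
  have "qcnj a \<odot> a' \<in> J" "odd (nrm (qcnj a \<odot> a'))"
    using a odd_primsD by (auto simp: J_mult nrm_mult)
  then obtain n :: nat and y where n: "n > 0" and y: "y \<in> odd_prims" "qcnj a \<odot> a' = real n *\<^sub>R y"
    using odd_nrm_factor by metis
  \<comment> \<open>Multiplying the two equal lattices by \<open>qcnj a\<close> on the left gives n
    y J b' = N(a) J b; \<open>key\<close> and \<open>key2\<close> are the two inclusions.\<close>
  have key: "\<exists>z\<in>J. real n *\<^sub>R (y \<odot> w \<odot> b') = qnorm a *\<^sub>R (z \<odot> b)" if w: "w \<in> J" for w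
  proof -
    have "a' \<odot> w \<odot> b' \<in> bimod a b" using w eq by (auto simp: bimod_def)
    then obtain z where z: "z \<in> J" "a' \<odot> w \<odot> b' = a \<odot> z \<odot> b" by (auto simp: bimod_def)
    have "real n *\<^sub>R (y \<odot> w \<odot> b') = (qcnj a \<odot> a') \<odot> w \<odot> b'" by (simp add: y(2))
    also have "\<dots> = qcnj a \<odot> (a' \<odot> w \<odot> b')" by (simp only: qmult_assoc)
    also have "\<dots> = (qcnj a \<odot> a) \<odot> (z \<odot> b)" unfolding z(2) by (simp only: qmult_assoc)
    finally show ?thesis using z(1) by auto
  qed
  have key2: "\<exists>w\<in>J. qnorm a *\<^sub>R (z \<odot> b) = real n *\<^sub>R (y \<odot> w \<odot> b')" if z: "z \<in> J" for z
  proof -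
    have "a \<odot> z \<odot> b \<in> bimod a' b'" using z eq[symmetric] by (auto simp: bimod_def)
    then obtain w where w: "w \<in> J" "a \<odot> z \<odot> b = a' \<odot> w \<odot> b'" by (auto simp: bimod_def)
    have "real n *\<^sub>R (y \<odot> w \<odot> b') = (qcnj a \<odot> a') \<odot> w \<odot> b'" by (simp add: y(2))
    also have "\<dots> = qcnj a \<odot> (a' \<odot> w \<odot> b')" by (simp only: qmult_assoc)
    also have "\<dots> = (qcnj a \<odot> a) \<odot> (z \<odot> b)" unfolding w(2)[symmetric] by (simp only: qmult_assoc)
    finally show ?thesis using w(1) by (intro bexI[of _ w]) auto
  qed
  \<comment> \<open>N(a) J b is stable under left multiplication by \<open>J\<close>, hence so is n
    y J b'; cancelling \<open>n\<close> and \<open>b'\<close> leaves that \<open>y\<close>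
    normalizes \<open>J\<close> from one side.\<close>
  have "\<exists>z\<in>J. x \<odot> y = y \<odot> z" if x: "x \<in> J" for x
  proof -
    obtain x1 where x1: "x1 \<in> J" "real n *\<^sub>R (y \<odot> qone \<odot> b') = qnorm a *\<^sub>R (x1 \<odot> b)"
      using key basis_in_J by blast
    obtain z where z: "z \<in> J" "qnorm a *\<^sub>R ((x \<odot> x1) \<odot> b) = real n *\<^sub>R (y \<odot> z \<odot> b')"
      using key2[of "x \<odot> x1"] x x1 J_mult by blast
    have "real n *\<^sub>R ((x \<odot> y) \<odot> b') = x \<odot> (real n *\<^sub>R (y \<odot> qone \<odot> b'))"
      by (simp add: qmult_assoc)
    also have "\<dots> = real n *\<^sub>R ((y \<odot> z) \<odot> b')" unfolding x1(2) using z(2) by (simp add: qmult_assoc)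
    finally have "(x \<odot> y) \<odot> b' = (y \<odot> z) \<odot> b'" using n by simp
    thus ?thesis using z(1) b(2) qmult_right_cancel by blast
  qed
  hence yu: "y \<in> J_units" by (rule odd_prim_normalizer_unit[OF y(1)])
  \<comment> \<open>\<open>a'\<close> and \<open>a \<odot> y\<close> are both primitive and have a
    common positive integer multiple, so they are equal.\<close>
  have "real (nrm a) *\<^sub>R a' = a \<odot> (qcnj a \<odot> a')"
    by (simp add: real_nrm[OF aJ(1)] flip: qmult_assoc)
  also have "\<dots> = real n *\<^sub>R (a \<odot> y)" by (simp add: y(2))
  finally have "a' = a \<odot> y"
    using odd_prims_scale_eq(2)[OF a(2) odd_prims_mult_unit[OF a(1) yu]] n odd_primsD[OF a(1)] nrm_pos_iff
    by blast
  moreover obtain v where "v \<in> J_units" "b' = v \<odot> b"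
  proof -
    have "bimod a b = bimod a b'"
      using bimod_unit[OF yu, of qone a b'] eq \<open>a' = a \<odot> y\<close> by (simp add: J_units_def nrm_def)
    hence "a \<odot> qone \<odot> b \<in> bimod a b'" "a \<odot> qone \<odot> b' \<in> bimod a b"
      by (metis bimod_def basis_in_J(2) imageI)+
    then obtain x x' where x: "x \<in> J" "x' \<in> J" "a \<odot> b = a \<odot> x \<odot> b'" "a \<odot> b' = a \<odot> x' \<odot> b"
      by (auto simp: bimod_def)
    hence xx: "b = x \<odot> b'" "b' = x' \<odot> b" using qmult_left_cancel odd_primsD(3)[OF a(1)]
      by (simp_all add: qmult_assoc)
    hence "qone \<odot> b = (x \<odot> x') \<odot> b" by (simp add: qmult_assoc)
    hence "x \<odot> x' = qone" using b(1) qmult_right_cancel by metis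
    thus ?thesis using that J_unitsI x xx by blast
  qed
  ultimately show ?thesis using that yu by blast
qed

section \<open>Lattice points in balls and the index\<close>

text \<open>In dimension 4 the half-diagonal of the unit cube is exactly 1; this is the shift by 1
  in the radii of the counting bounds.\<close>

lemma norm_le_1_quat:
  fixes x :: "real^4"
  assumes "\<And>i. \<bar>x $ i\<bar> \<le> 1/2"
  shows "norm x \<le> 1"
proof -
  have "(x $ i)\<^sup>2 \<le> 1/4" for i
    using power_mono[OF assms[of i], of 2] by (simp add: power2_eq_square)
  from this[of 1] this[of 2] this[of 3] this[of 4] have "(norm x)\<^sup>2 \<le> 1\<^sup>2"
    using qnorm_components[of x] by (simp add: qnorm_def)
  thus ?thesis by (rule power2_le_imp_le) simp
qed

text \<open>Closed cubes around grid points cover the space and serve the lower bound; the open ones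
  below are disjoint and serve the upper bound.\<close>

definition unit_cube :: "real^4 \<Rightarrow> (real^4) set" where
  "unit_cube x = cbox (\<chi> i. x $ i - 1/2) (\<chi> i. x $ i + 1/2)"

definition open_unit_cube :: "real^4 \<Rightarrow> (real^4) set" where
  "open_unit_cube x = box (\<chi> i. x $ i - 1/2) (\<chi> i. x $ i + 1/2)"

lemma measure_unit_cube:
  "measure lborel (unit_cube x) = 1" "measure lborel (open_unit_cube x) = 1"
proof -
  have ne: "cbox (\<chi> i. x $ i - 1/2) (\<chi> i. x $ i + 1/2) \<noteq> {}"
    by (simp add: interval_ne_empty_cart)
  show 1: "measure lborel (unit_cube x) = 1"
    unfolding unit_cube_def using content_cbox_cart[OF ne] by simp
  show "measure lborel (open_unit_cube x) = 1"
    using 1 unfolding unit_cube_def open_unit_cube_def by (simp add: measure_lborel_box_eq measure_lborel_cbox_eq)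
qed

lemma mem_unit_cube:
  "y \<in> unit_cube x \<longleftrightarrow> (\<forall>i. \<bar>y $ i - x $ i\<bar> \<le> 1/2)"
  "y \<in> open_unit_cube x \<longleftrightarrow> (\<forall>i. \<bar>y $ i - x $ i\<bar> < 1/2)"
proof -
  have "a - 1/2 \<le> b \<and> b \<le> a + 1/2 \<longleftrightarrow> \<bar>b - a\<bar> \<le> 1/2"
    "a - 1/2 < b \<and> b < a + 1/2 \<longleftrightarrow> \<bar>b - a\<bar> < 1/2" for a b :: real
    by (auto simp: abs_if)
  thus "y \<in> unit_cube x \<longleftrightarrow> (\<forall>i. \<bar>y $ i - x $ i\<bar> \<le> 1/2)"
    "y \<in> open_unit_cube x \<longleftrightarrow> (\<forall>i. \<bar>y $ i - x $ i\<bar> < 1/2)"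
    by (simp_all add: unit_cube_def open_unit_cube_def mem_box_cart)
qed

lemma unit_cube_dist:
  "y \<in> unit_cube x \<Longrightarrow> norm (y - x) \<le> 1" "y \<in> open_unit_cube x \<Longrightarrow> norm (y - x) \<le> 1"
  using norm_le_1_quat[of "y - x"] by (auto simp: mem_unit_cube less_imp_le)

text \<open>A coset of the integer lattice. \<open>J\<close> is the union of two of them, that of 0
  and that of (1/2, 1/2, 1/2, 1/2).\<close>

definition grid :: "real^4 \<Rightarrow> (real^4) set" where
  "grid v = {x. \<forall>i. x $ i - v $ i \<in> \<int>}"

text \<open>The open unit cubes around the points are disjoint and lie in the ball of radius
  \<open>r + 1\<close>. The set \<open>X\<close> is assumed finite because the finiteness of grid
  balls is itself deduced from this bound.\<close>

lemma card_grid_upper: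
  assumes X: "finite X" "X \<subseteq> grid v" "\<And>x. x \<in> X \<Longrightarrow> norm x \<le> r" and r: "r \<ge> 0"
  shows "real (card X) \<le> pi\<^sup>2 / 2 * (r + 1) ^ 4"
proof -
  have fm: "open_unit_cube x \<in> fmeasurable lborel" for x
    unfolding open_unit_cube_def by (simp add: fmeasurable_def emeasure_lborel_box_eq)
  have "pairwise (\<lambda>x y. disjnt (open_unit_cube x) (open_unit_cube y)) X"
  proof (rule pairwiseI)
    fix x y assume xy: "x \<in> X" "y \<in> X" "x \<noteq> y"
    show "disjnt (open_unit_cube x) (open_unit_cube y)"
    proof (rule ccontr)
      assume "\<not> ?thesis"
      then obtain z where z: "z \<in> open_unit_cube x" "z \<in> open_unit_cube y" by (auto simp: disjnt_iff)
      have "x $ i = y $ i" for i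
      proof -
        have "x $ i - v $ i - (y $ i - v $ i) \<in> \<int>"
          using xy X(2) by (intro Ints_diff[of "x $ i - v $ i"]) (auto simp: grid_def)
        then obtain k where k: "x $ i - y $ i = of_int k" by (auto elim: Ints_cases)
        moreover have "\<bar>z $ i - x $ i\<bar> < 1/2" "\<bar>z $ i - y $ i\<bar> < 1/2"
          using z by (auto simp: mem_unit_cube)
        ultimately have "k = 0" by linarith
        thus ?thesis using k by simp
      qed
      thus False using xy(3) by (simp add: vec_eq_iff)
    qed
  qed
  hence "measure lborel (\<Union>x\<in>X. open_unit_cube x) = (\<Sum>x\<in>X. measure lborel (open_unit_cube x))"
    by (intro measure_UNION' X(1) fm)
  hence "real (card X) = measure lborel (\<Union>x\<in>X. open_unit_cube x)"
    by (simp add: measure_unit_cube)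
  also have "\<dots> \<le> measure lborel (cball 0 (r + 1) :: (real^4) set)"
  proof (rule measure_mono_fmeasurable)
    show "(\<Union>x\<in>X. open_unit_cube x) \<subseteq> cball 0 (r + 1)"
    proof
      fix y assume "y \<in> (\<Union>x\<in>X. open_unit_cube x)"
      then obtain x where "x \<in> X" "y \<in> open_unit_cube x" by blast
      hence "norm x \<le> r" "norm (y - x) \<le> 1" using X(3) unit_cube_dist by auto
      thus "y \<in> cball 0 (r + 1)" using norm_triangle_ineq[of "y - x" x] by simp
    qed
    show "cball 0 (r + 1) \<in> fmeasurable lborel"
      using r by (simp add: fmeasurable_def emeasure_cball)
  qed (use fm X in \<open>auto simp: open_unit_cube_def\<close>)
  also have "\<dots> = pi\<^sup>2 / 2 * (r + 1) ^ 4" using r by (simp add: content_cball unit_ball_vol_4)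
  finally show ?thesis .
qed

lemma finite_grid_ball: "finite {x \<in> grid v. norm x \<le> r}"
proof (cases "r \<ge> 0")
  case True
  show ?thesis
  proof (rule ccontr)
    assume inf: "infinite {x \<in> grid v. norm x \<le> r}"
    define n where "n = Suc (nat \<lceil>pi\<^sup>2 / 2 * (r + 1) ^ 4\<rceil>)"
    obtain X where X: "X \<subseteq> {x \<in> grid v. norm x \<le> r}" "finite X" "card X = n"
      using infinite_arbitrarily_large[OF inf] by blast
    have "real n \<le> pi\<^sup>2 / 2 * (r + 1) ^ 4"
      using card_grid_upper[of X v r] X True by auto
    thus False unfolding n_def by linarith
  qed
next
  case False
  hence "{x \<in> grid v. norm x \<le> r} = {}" by (auto intro: order_trans[OF norm_ge_zero])
  thus ?thesis by (simp only: finite.emptyI)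
qed

text \<open>Rounding the coordinates moves a point of the ball of radius \<open>r - 1\<close> by at
  most 1, so the closed cubes around the counted points cover that ball.\<close>

lemma card_grid_lower:
  assumes r: "r \<ge> 1"
  shows "real (card {x \<in> grid v. norm x \<le> r}) \<ge> pi\<^sup>2 / 2 * (r - 1) ^ 4"
proof -
  let ?X = "{x \<in> grid v. norm x \<le> r}"
  have "pi\<^sup>2 / 2 * (r - 1) ^ 4 = measure lborel (cball 0 (r - 1) :: (real^4) set)"
    using r by (simp add: content_cball unit_ball_vol_4)
  also have "\<dots> \<le> measure lborel (\<Union>x\<in>?X. unit_cube x)"
  proof (rule measure_mono_fmeasurable)
    show "cball 0 (r - 1) \<subseteq> (\<Union>x\<in>?X. unit_cube x)"
    proof
      fix y :: "real^4" assume y: "y \<in> cball 0 (r - 1)"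
      define x :: "real^4" where "x = (\<chi> i. v $ i + of_int (round (y $ i - v $ i)))"
      have *: "\<bar>x $ i - y $ i\<bar> \<le> 1/2" for i
        using of_int_round_abs_le[of "y $ i - v $ i"] by (simp add: x_def algebra_simps)
      have "norm (x - y) \<le> 1" by (rule norm_le_1_quat) (use * in simp)
      hence "norm x \<le> r" using y norm_triangle_ineq[of "x - y" y] by simp
      moreover have "x \<in> grid v" by (simp add: grid_def x_def)
      moreover have "y \<in> unit_cube x"
        using * by (simp add: mem_unit_cube abs_minus_commute)
      ultimately show "y \<in> (\<Union>x\<in>?X. unit_cube x)" by blast
    qed
    show "(\<Union>x\<in>?X. unit_cube x) \<in> fmeasurable lborel"
      by (intro fmeasurable.finite_UN finite_grid_ball)
         (simp add: fmeasurable_def emeasure_lborel_cbox_eq unit_cube_def)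
  qed auto
  also have "\<dots> \<le> (\<Sum>x\<in>?X. measure lborel (unit_cube x))"
    by (rule measure_UNION_le[OF finite_grid_ball]) (simp add: unit_cube_def)
  also have "\<dots> = real (card ?X)" by (simp add: measure_unit_cube)
  finally show ?thesis .
qed

definition ball_count :: "(real^4) set \<Rightarrow> real \<Rightarrow> nat" where
  "ball_count \<Lambda> r = card {x \<in> \<Lambda>. norm x \<le> r}"

lemma ball_count_grid:
  assumes "r \<ge> 1"
  shows "\<bar>real (ball_count (grid v) r) - pi\<^sup>2 / 2 * r ^ 4\<bar> \<le> 15 * (pi\<^sup>2 / 2) * r ^ 3"
proof -
  have r: "1 \<le> r" "r \<le> r ^ 3" "r\<^sup>2 \<le> r ^ 3" "1 \<le> r ^ 3" "0 \<le> r\<^sup>2"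
    using assms power_increasing[of 1 3 r] power_increasing[of 2 3 r] by auto
  have e: "(r + 1) ^ 4 = r ^ 4 + 4 * r ^ 3 + 6 * r\<^sup>2 + 4 * r + 1"
    "(r - 1) ^ 4 = r ^ 4 - 4 * r ^ 3 + 6 * r\<^sup>2 - 4 * r + 1"
    by (simp_all add: power4_eq_xxxx power3_eq_cube power2_eq_square algebra_simps)
  \<comment> \<open>15 = 4 + 6 + 4 + 1: for \<open>r \<ge> 1\<close> all lower powers are bounded by
    \<open>r ^ 3\<close>.\<close>
  have 1: "(r + 1) ^ 4 \<le> r ^ 4 + 15 * r ^ 3" "(r - 1) ^ 4 \<ge> r ^ 4 - 15 * r ^ 3"
    unfolding e using r by linarith+
  have "real (ball_count (grid v) r) \<le> pi\<^sup>2 / 2 * (r + 1) ^ 4"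
    unfolding ball_count_def by (rule card_grid_upper[OF finite_grid_ball]) (use assms in auto)
  also have "\<dots> \<le> pi\<^sup>2 / 2 * (r ^ 4 + 15 * r ^ 3)" by (intro mult_left_mono 1) simp
  finally have 2: "real (ball_count (grid v) r) \<le> \<dots>" .
  have "pi\<^sup>2 / 2 * (r ^ 4 - 15 * r ^ 3) \<le> pi\<^sup>2 / 2 * (r - 1) ^ 4" by (intro mult_left_mono 1) simp
  also have "\<dots> \<le> real (ball_count (grid v) r)"
    unfolding ball_count_def by (rule card_grid_lower[OF assms])
  finally show ?thesis using 2 unfolding abs_le_iff by (simp add: algebra_simps)
qed

lemma integer_lattice_eq_grid: "integer_lattice = grid 0"
  by (simp add: integer_lattice_def grid_def)

lemma ball_count_hurwitz:
  assumes "r \<ge> 1"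
  shows "\<bar>real (ball_count J r) - pi\<^sup>2 * r ^ 4\<bar> \<le> 15 * pi\<^sup>2 * r ^ 3"
proof -
  define h :: "real^4" where "h = (\<chi> i. 1/2)"
  have J: "J = grid 0 \<union> grid h" by (auto simp: hurwitz_lattice_def grid_def h_def)
  have "grid 0 \<inter> grid h = {}"
  proof -
    have False if "x \<in> grid 0" "x \<in> grid h" for x
    proof -
      have "x $ 1 - (x $ 1 - 1/2) \<in> \<int>" using that by (intro Ints_diff) (auto simp: grid_def h_def)
      then obtain k :: int where "1 / 2 = (of_int k :: real)" by (auto elim: Ints_cases)
      hence "(1::real) = of_int (2 * k)" by simp
      hence "1 = 2 * k" by linarith
      thus False by presburger
    qed
    thus ?thesis by blast
  qed
  moreover have "{x \<in> J. norm x \<le> r} = {x \<in> grid 0. norm x \<le> r} \<union> {x \<in> grid h. norm x \<le> r}"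
    using J by blast
  ultimately have "ball_count J r = ball_count (grid 0) r + ball_count (grid h) r"
    unfolding ball_count_def by (subst card_Un_disjoint[symmetric]) (auto simp: finite_grid_ball)
  thus ?thesis using ball_count_grid[OF assms, of 0] ball_count_grid[OF assms, of h]
    unfolding abs_le_iff by (simp add: algebra_simps)
qed

section \<open>Density of a lattice and the index of a similar sublattice\<close>

lemma tendsto_ratio_power4:
  assumes "\<And>r. r \<ge> 1 \<Longrightarrow> \<bar>f r - c * r ^ 4\<bar> \<le> K * r ^ 3"
  shows "((\<lambda>r. f r / r ^ 4) \<longlongrightarrow> (c::real)) at_top"
proof (rule Lim_transform[of "\<lambda>r. c"])
  show "((\<lambda>r. f r / r ^ 4 - c) \<longlongrightarrow> 0) at_top"
  proof (rule Lim_null_comparison)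
    show "\<forall>\<^sub>F r in at_top. norm (f r / r ^ 4 - c) \<le> K / r"
    proof (rule eventually_mono[OF eventually_ge_at_top[of 1]])
      fix r :: real assume r: "r \<ge> 1"
      have "norm (f r / r ^ 4 - c) = \<bar>f r - c * r ^ 4\<bar> / r ^ 4"
      proof -
        have "f r / r ^ 4 - c = (f r - c * r ^ 4) / r ^ 4" using r by (simp add: field_simps)
        thus ?thesis using r by (simp add: abs_divide)
      qed
      also have "\<dots> \<le> K * r ^ 3 / r ^ 4" using assms[OF r] r by (intro divide_right_mono) auto
      also have "\<dots> = K / r" using r by (simp add: field_simps power4_eq_xxxx power3_eq_cube)
      finally show "norm (f r / r ^ 4 - c) \<le> K / r" .
    qed
    show "((\<lambda>r. K / r) \<longlongrightarrow> 0) at_top" by real_asymp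
  qed
qed simp

text \<open>Covers both lattices by one argument. The constant \<open>c\<close> is the volume of the
  unit ball divided by the covolume.\<close>

definition lattice_density :: "(real^4) set \<Rightarrow> real \<Rightarrow> bool" where
  "lattice_density \<Lambda> c \<longleftrightarrow> c > 0 \<and> 0 \<in> \<Lambda> \<and> (\<forall>x\<in>\<Lambda>. \<forall>y\<in>\<Lambda>. x - y \<in> \<Lambda>) \<and>
     (\<forall>r. finite {x \<in> \<Lambda>. norm x \<le> r}) \<and> ((\<lambda>r. real (ball_count \<Lambda> r) / r ^ 4) \<longlongrightarrow> c) at_top"

lemma lattice_density_hurwitz: "lattice_density J (pi\<^sup>2)"
  unfolding lattice_density_def
  using finite_J_norm_le J_diff tendsto_ratio_power4[OF ball_count_hurwitz] by auto

lemma lattice_density_integer: "lattice_density integer_lattice (pi\<^sup>2 / 2)"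
  unfolding lattice_density_def integer_lattice_eq_grid
  using finite_grid_ball[of 0] tendsto_ratio_power4[OF ball_count_grid[of _ 0]] by (auto simp: grid_def)

text \<open>Every coset of \<open>\<alpha> R \<Lambda>\<close> has density \<open>c / \<alpha>\<^sup>4\<close>; comparing with the density \<open>c\<close>
  of \<open>\<Lambda>\<close> gives the number of cosets.\<close>
lemma lattice_index_similar:
  assumes L: "lattice_density \<Lambda> c" and \<alpha>: "\<alpha> \<noteq> 0" and R: "orthogonal_transformation R"
    and sub: "(\<lambda>x. \<alpha> *\<^sub>R R x) ` \<Lambda> \<subseteq> \<Lambda>"
  shows "real (lattice_index \<Lambda> ((\<lambda>x. \<alpha> *\<^sub>R R x) ` \<Lambda>)) = \<alpha> ^ 4"
proof -
  define M where "M = (\<lambda>x. \<alpha> *\<^sub>R R x) ` \<Lambda>"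
  define coset where "coset = (\<lambda>x::real^4. (\<lambda>y. x + y) ` M)"
  have c: "c > 0" and fin: "\<And>r. finite {x \<in> \<Lambda>. norm x \<le> r}"
    and lim: "((\<lambda>r. real (ball_count \<Lambda> r) / r ^ 4) \<longlongrightarrow> c) at_top"
    and diffL: "\<And>x y. x \<in> \<Lambda> \<Longrightarrow> y \<in> \<Lambda> \<Longrightarrow> x - y \<in> \<Lambda>" and zeroL: "0 \<in> \<Lambda>"
    using L by (auto simp: lattice_density_def)
  have addL: "x + y \<in> \<Lambda>" if "x \<in> \<Lambda>" "y \<in> \<Lambda>" for x y
    using diffL[of x "0 - y"] diffL[of 0 y] zeroL that by simp
  have lin: "linear R" and nR: "norm (R x) = norm x" for x
    using R by (auto simp: orthogonal_transformation)
  have diffM: "x - y \<in> M" if "x \<in> M" "y \<in> M" for x y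
  proof -
    from that obtain u w where "u \<in> \<Lambda>" "x = \<alpha> *\<^sub>R R u" "w \<in> \<Lambda>" "y = \<alpha> *\<^sub>R R w"
      by (auto simp: M_def)
    thus ?thesis unfolding M_def using diffL[of u w]
      by (intro image_eqI[of _ _ "u - w"]) (simp_all add: linear_diff[OF lin] scaleR_diff_right)
  qed
  have zeroM: "0 \<in> M" unfolding M_def using zeroL linear_0[OF lin] by (auto simp: image_iff)
  have addM: "x + y \<in> M" if "x \<in> M" "y \<in> M" for x y
    using diffM[of x "0 - y"] diffM[of 0 y] zeroM that by simp
  have MsubL: "M \<subseteq> \<Lambda>" using sub by (simp add: M_def)
  have countM: "card {x \<in> M. norm x \<le> r} = ball_count \<Lambda> (r / \<bar>\<alpha>\<bar>)" for r
  proof -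
    have "{x \<in> M. norm x \<le> r} = (\<lambda>x. \<alpha> *\<^sub>R R x) ` {x \<in> \<Lambda>. norm x \<le> r / \<bar>\<alpha>\<bar>}"
      using \<alpha> by (auto simp: M_def nR field_simps)
    moreover have "inj_on (\<lambda>x. \<alpha> *\<^sub>R R x) A" for A
    proof (rule inj_onI)
      fix x y assume "\<alpha> *\<^sub>R R x = \<alpha> *\<^sub>R R y"
      hence "norm (R (x - y)) = 0" using \<alpha> by (simp add: linear_diff[OF lin])
      thus "x = y" by (simp add: nR)
    qed
    ultimately show ?thesis unfolding ball_count_def by (simp add: card_image)
  qed
  have finM: "finite {x \<in> M. norm x \<le> r}" for r
    by (rule finite_subset[OF _ fin[of r]]) (use MsubL in auto)
  have finC: "finite {y \<in> coset x. norm y \<le> r}" if "x \<in> \<Lambda>" for x r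
    by (rule finite_subset[OF _ fin[of r]]) (use that MsubL addL in \<open>auto simp: coset_def\<close>)
  have lower: "ball_count \<Lambda> ((r - norm x) / \<bar>\<alpha>\<bar>) \<le> card {y \<in> coset x. norm y \<le> r}" if "x \<in> \<Lambda>" for x r
    unfolding countM[symmetric]
  proof (rule card_inj_on_le[where f = "\<lambda>y. x + y"])
    show "(\<lambda>y. x + y) ` {y \<in> M. norm y \<le> r - norm x} \<subseteq> {y \<in> coset x. norm y \<le> r}"
      using norm_triangle_ineq[of x] by (auto simp: coset_def) (smt (verit))
  qed (use finC[OF that] in auto)
  have upper: "card {y \<in> coset x. norm y \<le> r} \<le> ball_count \<Lambda> ((r + norm x) / \<bar>\<alpha>\<bar>)" if "x \<in> \<Lambda>" for x r
    unfolding countM[symmetric]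
  proof (rule card_inj_on_le[where f = "\<lambda>y. y - x"])
    show "(\<lambda>y. y - x) ` {y \<in> coset x. norm y \<le> r} \<subseteq> {y \<in> M. norm y \<le> r + norm x}"
      by (auto simp: coset_def) (smt (verit) add_diff_cancel_left' norm_triangle_ineq4)
  qed (use finM in auto)
  have coset_disj: "coset x = coset y" if "z \<in> coset x" "z \<in> coset y" for x y z
  proof -
    from that obtain m n where mn: "m \<in> M" "n \<in> M" "z = x + m" "z = y + n" by (auto simp: coset_def)
    have "x + w \<in> coset y" if "w \<in> M" for w
    proof -
      have "x + w = y + (n - m + w)" using mn by (simp add: algebra_simps)
      thus ?thesis unfolding coset_def using addM diffM mn that by blast
    qed
    moreover have "y + w \<in> coset x" if "w \<in> M" for w
    proof -
      have "y + w = x + (m - n + w)" using mn by (simp add: algebra_simps)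
      thus ?thesis unfolding coset_def using addM diffM mn that by blast
    qed
    ultimately show ?thesis by (auto simp: coset_def)
  qed
  have self: "x \<in> coset x" for x using zeroM by (auto simp: coset_def)
  \<comment> \<open>A bounded change \<open>t\<close> of the radius does not affect the leading
    term; the factor \<open>1 / \<alpha> ^ 4\<close> comes from dividing the radius by
    \<open>\<bar>\<alpha>\<bar>\<close>.\<close>
  have shift: "((\<lambda>r. real (ball_count \<Lambda> ((r + t) / \<bar>\<alpha>\<bar>)) / r ^ 4) \<longlongrightarrow> c / \<alpha> ^ 4) at_top" for t
  proof -
    have "filterlim (\<lambda>r. (r + t) / k) at_top at_top" if "k > 0" for k :: real
      using that by real_asymp
    hence "filterlim (\<lambda>r. (r + t) / \<bar>\<alpha>\<bar>) at_top at_top" using \<alpha> by simp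
    hence "((\<lambda>r. real (ball_count \<Lambda> ((r + t) / \<bar>\<alpha>\<bar>)) / ((r + t) / \<bar>\<alpha>\<bar>) ^ 4) \<longlongrightarrow> c) at_top"
      by (rule filterlim_compose[OF lim])
    moreover have "((\<lambda>r::real. ((r + t) / r) ^ 4 / \<bar>\<alpha>\<bar> ^ 4) \<longlongrightarrow> 1 ^ 4 / \<bar>\<alpha>\<bar> ^ 4) at_top"
      using \<alpha> by (intro tendsto_intros) (real_asymp | simp)+
    ultimately have "((\<lambda>r. real (ball_count \<Lambda> ((r + t) / \<bar>\<alpha>\<bar>)) / ((r + t) / \<bar>\<alpha>\<bar>) ^ 4 *
        (((r + t) / r) ^ 4 / \<bar>\<alpha>\<bar> ^ 4)) \<longlongrightarrow> c * (1 ^ 4 / \<bar>\<alpha>\<bar> ^ 4)) at_top"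
      by (rule tendsto_mult)
    hence "((\<lambda>r. real (ball_count \<Lambda> ((r + t) / \<bar>\<alpha>\<bar>)) / r ^ 4) \<longlongrightarrow> c * (1 ^ 4 / \<bar>\<alpha>\<bar> ^ 4)) at_top"
    proof (rule Lim_transform_eventually)
      show "\<forall>\<^sub>F r in at_top. real (ball_count \<Lambda> ((r + t) / \<bar>\<alpha>\<bar>)) / ((r + t) / \<bar>\<alpha>\<bar>) ^ 4 *
        (((r + t) / r) ^ 4 / \<bar>\<alpha>\<bar> ^ 4) = real (ball_count \<Lambda> ((r + t) / \<bar>\<alpha>\<bar>)) / r ^ 4"
        using eventually_gt_at_top[of "max 0 (- t)"]
        by eventually_elim (use \<alpha> in \<open>simp add: power_divide\<close>)
    qed
    thus ?thesis by simp
  qed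
  have \<alpha>4: "\<alpha> ^ 4 > 0" using \<alpha> by simp
  \<comment> \<open>Finite sets of cosets come first, since the index is not yet known to be finite
    and \<open>card\<close> of an infinite set would be 0. Disjoint cosets have densities adding up
    to at most \<open>c\<close>.\<close>
  have bound: "real (card S) \<le> \<alpha> ^ 4" if S: "finite S" "S \<subseteq> coset ` \<Lambda>" for S
  proof -
    obtain X where X: "X \<subseteq> \<Lambda>" "inj_on coset X" "S = coset ` X"
      using S(2) by (metis subset_image_inj)
    have finX: "finite X" using X S by (metis finite_imageD)
    have "real (card X) * (c / \<alpha> ^ 4) = (\<Sum>x\<in>X. c / \<alpha> ^ 4)" by simp
    also have "\<dots> \<le> c"
    proof (rule tendsto_le[OF _ lim])
      show "((\<lambda>r. \<Sum>x\<in>X. real (ball_count \<Lambda> ((r + - norm x) / \<bar>\<alpha>\<bar>)) / r ^ 4) \<longlongrightarrow> (\<Sum>x\<in>X. c / \<alpha> ^ 4)) at_top"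
        by (intro tendsto_sum shift)
      show "\<forall>\<^sub>F r in at_top. (\<Sum>x\<in>X. real (ball_count \<Lambda> ((r + - norm x) / \<bar>\<alpha>\<bar>)) / r ^ 4)
         \<le> real (ball_count \<Lambda> r) / r ^ 4"
      proof (rule eventually_mono[OF eventually_gt_at_top[of 0]])
        fix r :: real assume r: "r > 0"
        have "(\<Sum>x\<in>X. ball_count \<Lambda> ((r - norm x) / \<bar>\<alpha>\<bar>)) \<le> (\<Sum>x\<in>X. card {y \<in> coset x. norm y \<le> r})"
          using X lower by (intro sum_mono) auto
        also have "\<dots> = card (\<Union>x\<in>X. {y \<in> coset x. norm y \<le> r})"
        proof (rule card_UN_disjoint[symmetric, OF finX])
          show "\<forall>x\<in>X. finite {y \<in> coset x. norm y \<le> r}" using finC X by blast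
          show "\<forall>x\<in>X. \<forall>y\<in>X. x \<noteq> y \<longrightarrow> {z \<in> coset x. norm z \<le> r} \<inter> {z \<in> coset y. norm z \<le> r} = {}"
          proof (intro ballI impI, rule ccontr)
            fix x y assume xy: "x \<in> X" "y \<in> X" "x \<noteq> y"
              "{z \<in> coset x. norm z \<le> r} \<inter> {z \<in> coset y. norm z \<le> r} \<noteq> {}"
            then obtain z where "z \<in> coset x" "z \<in> coset y" by blast
            hence "coset x = coset y" by (rule coset_disj)
            thus False using xy X(2) by (auto dest: inj_onD)
          qed
        qed
        also have "\<dots> \<le> ball_count \<Lambda> r" unfolding ball_count_def
          using X MsubL addL by (intro card_mono fin) (auto simp: coset_def)
        finally have "real (\<Sum>x\<in>X. ball_count \<Lambda> ((r - norm x) / \<bar>\<alpha>\<bar>)) \<le> real (ball_count \<Lambda> r)"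
          by (rule of_nat_mono)
        thus "(\<Sum>x\<in>X. real (ball_count \<Lambda> ((r + - norm x) / \<bar>\<alpha>\<bar>)) / r ^ 4) \<le> real (ball_count \<Lambda> r) / r ^ 4"
          using r by (simp add: divide_right_mono flip: sum_divide_distrib)
      qed
    qed simp
    finally have "real (card X) * c \<le> \<alpha> ^ 4 * c" using \<alpha>4 by (simp add: field_simps)
    hence "real (card X) \<le> \<alpha> ^ 4" using c by simp
    thus ?thesis using X by (simp add: card_image)
  qed
  have finS: "finite (coset ` \<Lambda>)"
  proof (rule ccontr)
    assume "infinite (coset ` \<Lambda>)"
    from infinite_arbitrarily_large[OF this, of "Suc (nat \<lceil>\<alpha> ^ 4\<rceil>)"]
    obtain S where "finite S" "card S = Suc (nat \<lceil>\<alpha> ^ 4\<rceil>)" "S \<subseteq> coset ` \<Lambda>" by blast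
    with bound[of S] show False by simp linarith
  qed
  obtain X where X: "X \<subseteq> \<Lambda>" "inj_on coset X" "coset ` \<Lambda> = coset ` X"
    using iffD1[OF subset_image_inj, OF order_refl[of "coset ` \<Lambda>"]] by metis
  have finX: "finite X" using X finS by (metis finite_imageD)
  \<comment> \<open>The converse: a full set of cosets covers the lattice, so their densities add up
    to at least \<open>c\<close>.\<close>
  have "c \<le> (\<Sum>x\<in>X. c / \<alpha> ^ 4)"
  proof (rule tendsto_le[OF _ _ lim])
    show "((\<lambda>r. \<Sum>x\<in>X. real (ball_count \<Lambda> ((r + norm x) / \<bar>\<alpha>\<bar>)) / r ^ 4) \<longlongrightarrow> (\<Sum>x\<in>X. c / \<alpha> ^ 4)) at_top"
      by (intro tendsto_sum shift)
    show "\<forall>\<^sub>F r in at_top. real (ball_count \<Lambda> r) / r ^ 4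
      \<le> (\<Sum>x\<in>X. real (ball_count \<Lambda> ((r + norm x) / \<bar>\<alpha>\<bar>)) / r ^ 4)"
    proof (rule eventually_mono[OF eventually_gt_at_top[of 0]])
      fix r :: real assume r: "r > 0"
      have "ball_count \<Lambda> r \<le> card (\<Union>x\<in>X. {y \<in> coset x. norm y \<le> r})"
        unfolding ball_count_def
      proof (rule card_mono)
        show "{x \<in> \<Lambda>. norm x \<le> r} \<subseteq> (\<Union>x\<in>X. {y \<in> coset x. norm y \<le> r})"
        proof
          fix z assume z: "z \<in> {x \<in> \<Lambda>. norm x \<le> r}"
          then obtain x where "x \<in> X" "coset z = coset x" using X(3) by blast
          thus "z \<in> (\<Union>x\<in>X. {y \<in> coset x. norm y \<le> r})" using self[of z] z by auto
        qed
      qed (use finX finC X in auto)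
      also have "\<dots> \<le> (\<Sum>x\<in>X. card {y \<in> coset x. norm y \<le> r})" by (rule card_UN_le[OF finX])
      also have "\<dots> \<le> (\<Sum>x\<in>X. ball_count \<Lambda> ((r + norm x) / \<bar>\<alpha>\<bar>))"
        using X upper by (intro sum_mono) auto
      finally have "real (ball_count \<Lambda> r) \<le> real (\<Sum>x\<in>X. ball_count \<Lambda> ((r + norm x) / \<bar>\<alpha>\<bar>))"
        by (rule of_nat_mono)
      thus "real (ball_count \<Lambda> r) / r ^ 4 \<le> (\<Sum>x\<in>X. real (ball_count \<Lambda> ((r + norm x) / \<bar>\<alpha>\<bar>)) / r ^ 4)"
        using r by (simp add: divide_right_mono flip: sum_divide_distrib)
    qed
  qed simp
  hence "\<alpha> ^ 4 * c \<le> real (card X) * c" using \<alpha>4 by (simp add: field_simps)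
  hence "\<alpha> ^ 4 \<le> real (card X)" using c by simp
  moreover have "real (card X) \<le> \<alpha> ^ 4" using bound[OF finS] X by (simp add: card_image)
  ultimately have "real (card (coset ` \<Lambda>)) = \<alpha> ^ 4" using X by (simp add: card_image)
  thus ?thesis by (simp add: lattice_index_def M_def coset_def)
qed

section \<open>Counting similarity sublattices\<close>

text \<open>\<open>m\<close> is the factor of the squared norm: in dimension 4 the image of a
  lattice then has index \<open>m\<^sup>2\<close>, in accordance with the counting.\<close>

definition similarity :: "real \<Rightarrow> (real^4 \<Rightarrow> real^4) \<Rightarrow> bool" where
  "similarity m T \<longleftrightarrow> linear T \<and> (\<forall>x. qnorm (T x) = m * qnorm x)"

lemma similarityI_orthogonal:
  assumes "orthogonal_transformation R"
  shows "similarity (\<alpha>\<^sup>2) (\<lambda>x. \<alpha> *\<^sub>R R x)"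
proof -
  have "linear R" "\<And>x. norm (R x) = norm x" using assms by (auto simp: orthogonal_transformation)
  thus ?thesis unfolding similarity_def
    by (auto intro!: linear_compose_scale_right simp: qnorm_def power_mult_distrib)
qed

lemma similarity_orthogonal:
  assumes "similarity m T" "m > 0"
  obtains R where "orthogonal_transformation R" "T = (\<lambda>x. sqrt m *\<^sub>R R x)"
proof -
  define R where "R = (\<lambda>x. (1 / sqrt m) *\<^sub>R T x)"
  have lin: "linear R" unfolding R_def using assms by (intro linear_compose_scale_right) (auto simp: similarity_def)
  have "qnorm (R x) = qnorm x" for x
    using assms by (simp add: R_def qnorm_scaleR similarity_def power_divide)
  hence "norm (R x) = norm x" for x unfolding qnorm_def by (simp add: power2_eq_iff_nonneg)
  with lin have "orthogonal_transformation R" by (simp add: orthogonal_transformation)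
  moreover have "T = (\<lambda>x. sqrt m *\<^sub>R R x)" using assms by (simp add: R_def fun_eq_iff)
  ultimately show ?thesis using that by blast
qed

definition ssl :: "(real^4) set \<Rightarrow> nat \<Rightarrow> (real^4) set set" where
  "ssl \<Lambda> m = {M. similarity_sublattice \<Lambda> M \<and> lattice_index \<Lambda> M = m\<^sup>2}"

text \<open>The index is \<open>\<alpha> ^ 4\<close>, so index \<open>m\<^sup>2\<close> means
  \<open>\<alpha>\<^sup>2 = m\<close>; the sign of \<open>\<alpha>\<close> is absorbed into
  \<open>T\<close>.\<close>

lemma ssl_eq:
  assumes \<Lambda>: "lattice_density \<Lambda> c" and m: "m > 0"
  shows "ssl \<Lambda> m = {T ` \<Lambda> | T. similarity m T \<and> T ` \<Lambda> \<subseteq> \<Lambda>}"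
proof (intro equalityI subsetI)
  fix M assume "M \<in> ssl \<Lambda> m"
  then obtain \<alpha> R where R: "\<alpha> \<noteq> 0" "orthogonal_transformation R" "M = (\<lambda>x. \<alpha> *\<^sub>R R x) ` \<Lambda>" "M \<subseteq> \<Lambda>"
    and ind: "lattice_index \<Lambda> M = m\<^sup>2"
    by (auto simp: ssl_def similarity_sublattice_def)
  have "real (m\<^sup>2) = \<alpha> ^ 4"
    using lattice_index_similar[OF \<Lambda> R(1,2)] R ind by simp
  hence "(\<alpha>\<^sup>2)\<^sup>2 = (real m)\<^sup>2" by simp
  hence "\<alpha>\<^sup>2 = real m" by (rule power2_eq_imp_eq) auto
  thus "M \<in> {T ` \<Lambda> | T. similarity m T \<and> T ` \<Lambda> \<subseteq> \<Lambda>}"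
    using similarityI_orthogonal[OF R(2), of \<alpha>] R by auto
next
  fix M assume "M \<in> {T ` \<Lambda> | T. similarity m T \<and> T ` \<Lambda> \<subseteq> \<Lambda>}"
  then obtain T where T: "similarity m T" "T ` \<Lambda> \<subseteq> \<Lambda>" "M = T ` \<Lambda>" by blast
  obtain R where R: "orthogonal_transformation R" "T = (\<lambda>x. sqrt m *\<^sub>R R x)"
    using similarity_orthogonal[OF T(1)] m by auto
  have "similarity_sublattice \<Lambda> M" unfolding similarity_sublattice_def
    using R T m by (intro conjI exI[of _ "sqrt m"] exI[of _ R]) auto
  moreover have "real (lattice_index \<Lambda> M) = sqrt m ^ 4"
    using lattice_index_similar[OF \<Lambda> _ R(1), of "sqrt m"] R T m by simp
  hence "real (lattice_index \<Lambda> M) = real (m\<^sup>2)"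
    by (simp add: power4_eq_xxxx power2_eq_square)
  ultimately show "M \<in> ssl \<Lambda> m" by (simp add: ssl_def)
qed

lemma similarity_bimult: "similarity (qnorm a * qnorm b) (\<lambda>x. a \<odot> x \<odot> b)"
  unfolding similarity_def linear_iff
  by (simp add: qnorm_mult qmult_add_left qmult_add_right)

text \<open>\<open>J\<close> is stable under conjugation, so orientation-reversing similarities
  yield lattices of the same form. The relation between the norms is read off at
  \<open>qone\<close>.\<close>

lemma similarity_J_bimod:
  assumes "similarity m T" "m > 0"
  obtains a b where "a \<noteq> 0" "b \<noteq> 0" "T ` J = bimod a b" "qnorm a * qnorm b = m"
proof -
  obtain R where R: "orthogonal_transformation R" "T = (\<lambda>x. sqrt m *\<^sub>R R x)"
    using similarity_orthogonal[OF assms] .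
  obtain a b where ab: "a \<noteq> 0" "b \<noteq> 0" "R = (\<lambda>x. a \<odot> x \<odot> b) \<or> R = (\<lambda>x. a \<odot> qcnj x \<odot> b)"
    using orthogonal_quaternionic[OF R(1)] by (auto simp: quaternionic_def)
  have "T ` J = bimod (sqrt m *\<^sub>R a) b"
    using ab(3)
  proof
    assume "R = (\<lambda>x. a \<odot> x \<odot> b)" thus ?thesis by (simp add: R bimod_def)
  next
    assume *: "R = (\<lambda>x. a \<odot> qcnj x \<odot> b)"
    have "T ` J = (\<lambda>x. (sqrt m *\<^sub>R a) \<odot> x \<odot> b) ` (qcnj ` J)"
      by (simp add: R * image_image)
    thus ?thesis by (simp add: qcnj_image_J bimod_def)
  qed
  moreover have "qnorm (sqrt m *\<^sub>R a) * qnorm b = m"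
  proof -
    have "qnorm (R qone) = qnorm qone" using R(1) by (simp add: orthogonal_transformation qnorm_def)
    hence "qnorm a * qnorm b = 1" using ab(3) by (auto simp: qnorm_mult)
    thus ?thesis using assms by (simp add: qnorm_scaleR)
  qed
  ultimately show ?thesis using that[of "sqrt m *\<^sub>R a" b] ab assms by simp
qed

lemma bimod_rescale:
  assumes "t \<noteq> 0"
  shows "bimod (t *\<^sub>R a) ((1 / t) *\<^sub>R b) = bimod a b"
  using assms by (simp add: bimod_def)

lemma bimod_move_one_plus_i: "bimod (a \<odot> one_plus_i) b = bimod a (one_plus_i \<odot> b)"
proof -
  have "\<exists>y\<in>J. (a \<odot> one_plus_i) \<odot> x \<odot> b = a \<odot> y \<odot> (one_plus_i \<odot> b)" if x: "x \<in> J" for x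
  proof -
    obtain y where "y \<in> J" "one_plus_i \<odot> x = y \<odot> one_plus_i" using one_plus_i_J_swap[OF x] .
    thus ?thesis by (intro bexI[of _ y]) (metis qmult_assoc)+
  qed
  moreover have "\<exists>y\<in>J. a \<odot> x \<odot> (one_plus_i \<odot> b) = (a \<odot> one_plus_i) \<odot> y \<odot> b" if x: "x \<in> J" for x
  proof -
    obtain y where "y \<in> J" "x \<odot> one_plus_i = one_plus_i \<odot> y" using J_swap_one_plus_i[OF x] .
    thus ?thesis by (intro bexI[of _ y]) (metis qmult_assoc)+
  qed
  ultimately show ?thesis unfolding bimod_def by (auto simp: image_iff)
qed

text \<open>Since \<open>\<Sum>\<^sub>e (a e b) d e\<^sup>* = 4 Re (b d) a\<close> over the basis quaternions \<open>e\<close>, a real multiple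
  of \<open>a\<close> lies in \<open>J\<close>. Among the possible \<open>a\<close> one of minimal norm is primitive of odd norm.\<close>
lemma bimod_normal_form:
  assumes nz: "a \<noteq> 0" "b \<noteq> 0" and sub: "bimod a b \<subseteq> J"
  obtains a' b' where "a' \<in> odd_prims" "b' \<in> J" "b' \<noteq> 0" "bimod a' b' = bimod a b"
    "qnorm a' * qnorm b' = qnorm a * qnorm b"
proof -
  define P where "P = (\<lambda>a'. a' \<in> J \<and> a' \<noteq> 0 \<and> (\<exists>b'. b' \<noteq> 0 \<and> bimod a' b' = bimod a b \<and>
     qnorm a' * qnorm b' = qnorm a * qnorm b))"
  have "\<exists>d\<in>{qone, qi, qj, qk}. (b \<odot> d) $ 1 \<noteq> 0"
    using nz(2) by (auto simp: qmult_basis_nth1 quat_eq_iff)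
  then obtain d where d: "d \<in> J" "(b \<odot> d) $ 1 \<noteq> 0" using basis_in_J by blast
  define t where "t = 4 * (b \<odot> d) $ 1"
  have "t *\<^sub>R a = a \<odot> (t *\<^sub>R qone)" by simp
  also have "\<dots> = a \<odot> ((b \<odot> d) + qi \<odot> (b \<odot> d) \<odot> qcnj qi + qj \<odot> (b \<odot> d) \<odot> qcnj qj + qk \<odot> (b \<odot> d) \<odot> qcnj qk)"
    unfolding t_def conj_sum ..
  also have "\<dots> = (a \<odot> qone \<odot> b) \<odot> d + (a \<odot> qi \<odot> b) \<odot> (d \<odot> qcnj qi)
      + (a \<odot> qj \<odot> b) \<odot> (d \<odot> qcnj qj) + (a \<odot> qk \<odot> b) \<odot> (d \<odot> qcnj qk)"
    by (simp add: qmult_add_right qmult_assoc)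
  also have "\<dots> \<in> J"
  proof -
    have mem: "(a \<odot> e \<odot> b) \<odot> f \<in> J" if "e \<in> J" "f \<in> J" for e f
      using sub that by (intro J_mult[of "a \<odot> e \<odot> b"]) (auto simp: bimod_def)
    show ?thesis by (intro J_add mem J_mult[of d] J_cnj basis_in_J d(1))
  qed
  finally have ta: "t *\<^sub>R a \<in> J" .
  have t: "t \<noteq> 0" using d by (simp add: t_def)
  have "P (t *\<^sub>R a)" unfolding P_def
  proof (intro conjI exI[of _ "(1 / t) *\<^sub>R b"])
    show "qnorm (t *\<^sub>R a) * qnorm ((1 / t) *\<^sub>R b) = qnorm a * qnorm b"
      using t by (simp add: qnorm_scaleR power_divide)
  qed (use ta t nz bimod_rescale[OF t] in simp_all)
  then obtain a' where a': "P a'" and min: "\<And>x. P x \<Longrightarrow> nrm a' \<le> nrm x"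
    using arg_min_nat_lemma[of P _ nrm] by metis
  then obtain b' where b': "b' \<noteq> 0" "bimod a' b' = bimod a b" "qnorm a' * qnorm b' = qnorm a * qnorm b"
    by (auto simp: P_def)
  have aJ: "a' \<in> J" "a' \<noteq> 0" using a' by (auto simp: P_def)
  hence pos: "nrm a' > 0" by (simp add: nrm_pos_iff)
  \<comment> \<open>Otherwise a factor 1 + i could move from \<open>a'\<close> to \<open>b'\<close>,
    halving the minimal norm.\<close>
  have "odd (nrm a')"
  proof
    assume "even (nrm a')"
    then obtain y where y: "y \<in> J" "a' = y \<odot> one_plus_i" using even_nrm_right_factor[OF aJ(1)] by blast
    have "P y" unfolding P_def
    proof (intro conjI exI[of _ "one_plus_i \<odot> b'"])
      show "qnorm y * qnorm (one_plus_i \<odot> b') = qnorm a * qnorm b"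
        using y b' by (simp add: qnorm_mult)
      show "bimod y (one_plus_i \<odot> b') = bimod a b"
        using y b' bimod_move_one_plus_i[of y b'] by simp
    qed (use y aJ b' in auto)
    hence "nrm a' \<le> nrm y" by (rule min)
    thus False using pos y by (simp add: nrm_mult)
  qed
  \<comment> \<open>An integer divisor \<open>e\<close> of \<open>a'\<close> could likewise be moved
    to \<open>b'\<close>, against minimality.\<close>
  moreover have "e \<le> 1" if e: "(1 / real e) *\<^sub>R a' \<in> J" for e :: nat
  proof (rule ccontr)
    assume "\<not> e \<le> 1"
    hence e1: "real e \<noteq> 0" "1 < e" by auto
    let ?y = "(1 / real e) *\<^sub>R a'"
    have "P ?y" unfolding P_def
    proof (intro conjI exI[of _ "real e *\<^sub>R b'"])
      show "qnorm ?y * qnorm (real e *\<^sub>R b') = qnorm a * qnorm b"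
        using e1 b' by (simp add: qnorm_scaleR power_divide)
      show "bimod ?y (real e *\<^sub>R b') = bimod a b"
        using bimod_rescale[of "1 / real e" a' b'] e1 b' by simp
    qed (use e e1 aJ b' in simp_all)
    hence "nrm a' \<le> nrm ?y" by (rule min)
    moreover have "nrm a' = e\<^sup>2 * nrm ?y" using nrm_scale[OF e, of e] e1 by simp
    moreover have "1 < e\<^sup>2" using e1(2) by (intro one_less_power) auto
    ultimately show False using pos by (cases "nrm ?y = 0") auto
  qed
  ultimately have op: "a' \<in> odd_prims" using aJ by (auto simp: odd_prims_def)
  moreover have "b' \<in> J" by (rule bimod_subset_J_right[OF op]) (use sub b' in simp)
  ultimately show ?thesis using that b' by blast
qed

definition hurwitz_pairs :: "nat \<Rightarrow> ((real^4) \<times> (real^4)) set" where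
  "hurwitz_pairs m = {(a, b). a \<in> odd_prims \<and> b \<in> J - {0} \<and> nrm a * nrm b = m}"

lemma finite_hurwitz_pairs:
  assumes "m > 0"
  shows "finite (hurwitz_pairs m)"
proof (rule finite_subset)
  show "hurwitz_pairs m \<subseteq> {x \<in> J. nrm x \<le> m} \<times> {x \<in> J. nrm x \<le> m}"
  proof
    fix p assume "p \<in> hurwitz_pairs m"
    then obtain a b where p: "p = (a, b)" "a \<in> J" "b \<in> J" "nrm a * nrm b = m"
      by (auto simp: hurwitz_pairs_def dest: odd_primsD)
    hence "nrm a dvd m" "nrm b dvd m" by (metis dvd_triv_left, metis dvd_triv_right)
    thus "p \<in> {x \<in> J. nrm x \<le> m} \<times> {x \<in> J. nrm x \<le> m}"
      using p assms by (auto dest: dvd_imp_le)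
  qed
qed (use finite_J_nrm_le in blast)

lemma ssl_hurwitz:
  assumes m: "m > 0"
  shows "ssl J m = (\<lambda>(a, b). bimod a b) ` hurwitz_pairs m"
  unfolding ssl_eq[OF lattice_density_hurwitz m]
proof (intro equalityI subsetI)
  fix M assume "M \<in> {T ` J | T. similarity m T \<and> T ` J \<subseteq> J}"
  then obtain T where T: "similarity m T" "T ` J \<subseteq> J" "M = T ` J" by blast
  obtain a b where ab: "a \<noteq> 0" "b \<noteq> 0" "T ` J = bimod a b" "qnorm a * qnorm b = m"
    using similarity_J_bimod[OF T(1)] m by auto
  obtain a' b' where ab': "a' \<in> odd_prims" "b' \<in> J" "b' \<noteq> 0" "bimod a' b' = bimod a b"
    "qnorm a' * qnorm b' = qnorm a * qnorm b"
    using bimod_normal_form[OF ab(1,2)] ab T by metis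
  have "real (nrm a' * nrm b') = real m"
    using ab ab' odd_primsD(1)[OF ab'(1)] by (simp add: real_nrm)
  hence "(a', b') \<in> hurwitz_pairs m" using ab' by (simp add: hurwitz_pairs_def del: of_nat_mult)
  moreover have "M = bimod a' b'" using ab ab' T by simp
  ultimately show "M \<in> (\<lambda>(a, b). bimod a b) ` hurwitz_pairs m" by force
next
  fix M assume "M \<in> (\<lambda>(a, b). bimod a b) ` hurwitz_pairs m"
  then obtain a b where ab: "a \<in> odd_prims" "b \<in> J" "nrm a * nrm b = m" "M = bimod a b"
    by (auto simp: hurwitz_pairs_def)
  have aJ: "a \<in> J" using ab odd_primsD by blast
  have "real m = qnorm a * qnorm b" using ab aJ by (metis of_nat_mult real_nrm)
  hence "similarity m (\<lambda>x. a \<odot> x \<odot> b)" using similarity_bimult by simp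
  moreover have "bimod a b \<subseteq> J" using ab aJ by (auto simp: bimod_def J_mult)
  ultimately show "M \<in> {T ` J | T. similarity m T \<and> T ` J \<subseteq> J}"
    using ab(4) unfolding bimod_def by blast
qed

text \<open>The fibres of the parametrization are the orbits of
  \<open>J_units \<times> J_units\<close> acting by \<open>(a \<odot> u, v \<odot> b)\<close>. The
  action is free, and 576 = 24 * 24.\<close>

lemma card_hurwitz_pairs:
  assumes m: "m > 0"
  shows "card (hurwitz_pairs m) = 576 * card (ssl J m)"
proof -
  let ?f = "\<lambda>(a, b). bimod a b"
  have fiber: "card {p \<in> hurwitz_pairs m. ?f p = M} = 576" if M: "M \<in> ?f ` hurwitz_pairs m" for M
  proof -
    obtain a b where ab: "a \<in> odd_prims" "b \<in> J" "b \<noteq> 0" "nrm a * nrm b = m" "M = bimod a b"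
      using M by (auto simp: hurwitz_pairs_def)
    let ?g = "\<lambda>(u, v). (a \<odot> u, v \<odot> b)"
    have "{p \<in> hurwitz_pairs m. ?f p = M} = ?g ` (J_units \<times> J_units)"
    proof (intro equalityI subsetI)
      fix p assume "p \<in> {p \<in> hurwitz_pairs m. ?f p = M}"
      then obtain a' b' where p: "p = (a', b')" "a' \<in> odd_prims" "b' \<noteq> 0" "bimod a' b' = M"
        by (auto simp: hurwitz_pairs_def)
      obtain u v where "u \<in> J_units" "v \<in> J_units" "a' = a \<odot> u" "b' = v \<odot> b"
        using bimod_eq_imp_units[OF ab(1) p(2) ab(3) p(3)] ab(5) p(4) by metis
      thus "p \<in> ?g ` (J_units \<times> J_units)" using p by force
    next
      fix p assume "p \<in> ?g ` (J_units \<times> J_units)"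
      then obtain u v where uv: "u \<in> J_units" "v \<in> J_units" "p = (a \<odot> u, v \<odot> b)" by auto
      have "v \<noteq> 0" using uv by (auto simp: J_units_def nrm_def)
      thus "p \<in> {p \<in> hurwitz_pairs m. ?f p = M}"
        using uv ab odd_prims_mult_unit[OF ab(1) uv(1)] bimod_unit[OF uv(1,2), of a b] odd_primsD(1)[OF ab(1)]
        by (auto simp: hurwitz_pairs_def nrm_mult J_mult J_units_def)
    qed
    moreover have "inj_on ?g (J_units \<times> J_units)"
      using qmult_left_cancel[OF odd_primsD(3)[OF ab(1)]] qmult_right_cancel[OF ab(3)]
      by (auto simp: inj_on_def)
    ultimately have "card {p \<in> hurwitz_pairs m. ?f p = M} = card (J_units \<times> J_units)"
      by (simp add: card_image)
    thus ?thesis by (simp add: card_cartesian_product card_J_units)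
  qed
  have "card (hurwitz_pairs m) = (\<Sum>p\<in>hurwitz_pairs m. 1)" by simp
  also have "\<dots> = (\<Sum>M\<in>?f ` hurwitz_pairs m. \<Sum>p\<in>{p \<in> hurwitz_pairs m. ?f p = M}. 1)"
    by (rule sum.image_gen[OF finite_hurwitz_pairs[OF m]])
  also have "\<dots> = (\<Sum>M\<in>?f ` hurwitz_pairs m. 576)"
    by (intro sum.cong refl) (simp only: fiber card_eq_sum[symmetric])
  also have "\<dots> = 576 * card (ssl J m)" by (simp add: ssl_hurwitz[OF m])
  finally show ?thesis .
qed


subsection \<open>Sublattices of the integer lattice\<close>

lemma even_nrm_hq: "even (nrm (hq n a b c)) \<longleftrightarrow> even n \<and> even (a + b + c)"
proof -
  have "real (nrm (hq n a b c)) = of_int (n * n + n * (a + b + c) + a * a + b * b + c * c)"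
    by (simp only: real_nrm[OF hq_in_J] qnorm_hq)
  hence "int (nrm (hq n a b c)) = n * n + n * (a + b + c) + a * a + b * b + c * c" by linarith
  hence "even (nrm (hq n a b c)) \<longleftrightarrow> even (n * n + n * (a + b + c) + a * a + b * b + c * c)"
    by (metis even_of_nat)
  thus ?thesis by (auto simp: even_add)
qed

lemma hq_diff: "hq n a b c - hq m d e f = hq (n - m) (a - d) (b - e) (c - f)"
  by (simp add: hq_def quat_simps field_simps)

lemma hq_integer_iff: "hq n a b c \<in> integer_lattice \<longleftrightarrow> even n"
proof
  assume "even n"
  thus "hq n a b c \<in> integer_lattice" by (auto simp: integer_lattice_def hq_def forall_4)
next
  assume "hq n a b c \<in> integer_lattice"
  hence "hq n a b c $ 1 \<in> \<int>" by (auto simp: integer_lattice_def)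
  then obtain k :: int where "of_int n / 2 = (of_int k :: real)" by (auto simp: hq_def elim: Ints_cases)
  hence "of_int n = (of_int (2 * k) :: real)" by simp
  hence "n = 2 * k" by linarith
  thus "even n" by simp
qed

lemma integer_lattice_subset_J: "integer_lattice \<subseteq> J"
  by (auto simp: integer_lattice_def hurwitz_lattice_def)

text \<open>The index-two overlattices of \<open>D\<^sub>4 = {y \<in> J. even (nrm y)}\<close> in \<open>J\<close> are
  \<open>D\<^sub>4 \<union> (v + D\<^sub>4)\<close> for the three cube roots of unity \<open>v\<close>; \<open>v = 1\<close> gives \<open>\<int>\<^sup>4\<close>.\<close>
definition d4_ext :: "real^4 \<Rightarrow> (real^4) set" where
  "d4_ext s = {y \<in> J. even (nrm y) \<or> even (nrm (y - s))}"

text \<open>The primitive cube roots of unity (-1+i+j+k)/2 and, below, its conjugate. With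
  \<open>qone\<close> they represent the three nonzero classes of \<open>J\<close> modulo
  D4.\<close>

definition omega :: "real^4" where "omega = hq (-1) 1 1 1"

definition omega' :: "real^4" where "omega' = hq (-1) 0 0 0"

lemma qone_hq: "qone = hq 2 (-1) (-1) (-1)"
  by (simp add: hq_def quat_simps)

lemma J_subsets_eqI:
  assumes "A \<subseteq> J" "B \<subseteq> J" "\<And>n a b c. hq n a b c \<in> A \<longleftrightarrow> hq n a b c \<in> B"
  shows "A = B"
proof (rule set_eqI)
  fix x show "x \<in> A \<longleftrightarrow> x \<in> B"
  proof (cases "x \<in> J")
    case True
    thus ?thesis by (rule J_cases) (simp add: assms(3))
  qed (use assms in blast)
qed

lemma integer_lattice_d4_ext: "integer_lattice = d4_ext qone"
proof -
  have "hq n a b c \<in> integer_lattice \<longleftrightarrow> hq n a b c \<in> d4_ext qone" for n a b c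
    unfolding d4_ext_def qone_hq hq_integer_iff by (auto simp: hq_diff even_nrm_hq)
  moreover have "d4_ext qone \<subseteq> J" by (auto simp: d4_ext_def)
  ultimately show ?thesis using integer_lattice_subset_J by (intro J_subsets_eqI)
qed

lemma omegas:
  "omega \<in> J" "omega' \<in> J" "nrm qone = 1" "nrm omega = 1" "nrm omega' = 1"
  "odd (nrm (qone - omega))" "odd (nrm (qone - omega'))" "odd (nrm (omega - omega'))"
  "omega \<noteq> qone" "omega' \<noteq> qone" "omega \<noteq> omega'"
proof -
  show "omega \<in> J" "omega' \<in> J" by (simp_all add: omega_def omega'_def)
  show "nrm qone = 1" by (simp add: nrm_def)
  show "nrm omega = 1" "nrm omega' = 1"
    unfolding omega_def omega'_def nrm_def qnorm_hq by simp_all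
  show "odd (nrm (qone - omega))" "odd (nrm (qone - omega'))" "odd (nrm (omega - omega'))"
    unfolding omega_def omega'_def qone_hq hq_diff even_nrm_hq by simp_all
  thus "omega \<noteq> qone" "omega' \<noteq> qone" "omega \<noteq> omega'" by (auto simp: nrm_def)
qed

text \<open>\<open>d4_ext s\<close> depends only on the class of \<open>s\<close> modulo D4, that is
  on the parities of \<open>n\<close> and \<open>a + b + c\<close>; an odd norm excludes the zero
  class.\<close>

lemma d4_ext_eq_omegas:
  assumes "s \<in> J" "odd (nrm s)"
  obtains v where "v \<in> {qone, omega, omega'}" "d4_ext s = d4_ext v"
proof -
  obtain n a b c where s: "s = hq n a b c" using assms J_cases by blast
  have *: "d4_ext (hq n a b c) = d4_ext (hq m d e f)"
    if "even (n - m)" "even ((a + b + c) - (d + e + f))" for m d e f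
  proof -
    have "hq k p q r \<in> d4_ext (hq n a b c) \<longleftrightarrow> hq k p q r \<in> d4_ext (hq m d e f)" for k p q r
      unfolding d4_ext_def using that by (auto simp: hq_diff even_nrm_hq)
    moreover have "d4_ext (hq n a b c) \<subseteq> J" "d4_ext (hq m d e f) \<subseteq> J" by (auto simp: d4_ext_def)
    ultimately show ?thesis by (intro J_subsets_eqI)
  qed
  have "odd n \<or> odd (a + b + c)" using assms by (auto simp: s even_nrm_hq)
  then consider "even n" "odd (a + b + c)" | "odd n" "odd (a + b + c)" | "odd n" "even (a + b + c)" by blast
  thus ?thesis
  proof cases
    case 1
    thus ?thesis using that[of qone] *[of 2 "-1" "-1" "-1"] by (auto simp: s qone_hq)
  next
    case 2
    thus ?thesis using that[of omega] *[of "-1" 1 1 1] by (auto simp: s omega_def)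
  next
    case 3
    thus ?thesis using that[of omega'] *[of "-1" 0 0 0] by (auto simp: s omega'_def)
  qed
qed

text \<open>A sum of four squares is divisible by 4 only if all four bases have the same parity.
  Only \<open>integer_lattice\<close> and the norm occur on the right, so the description can be
  transported by similarities.\<close>

lemma J_iff_double:
  "x \<in> J \<longleftrightarrow> 2 *\<^sub>R x \<in> integer_lattice \<and> qnorm x \<in> \<int>"
proof
  assume "x \<in> J"
  then obtain n a b c where x: "x = hq n a b c" using J_cases by blast
  have "2 *\<^sub>R x = hq (2 * n) (2 * a) (2 * b) (2 * c)" using hq_scale[of 2 n a b c] by (simp add: x)
  thus "2 *\<^sub>R x \<in> integer_lattice \<and> qnorm x \<in> \<int>"
    unfolding x by (simp add: hq_integer_iff qnorm_hq del: of_int_add of_int_mult)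
next
  assume *: "2 *\<^sub>R x \<in> integer_lattice \<and> qnorm x \<in> \<int>"
  hence "\<forall>i. 2 * x $ i \<in> \<int>" by (simp add: integer_lattice_def)
  then obtain a b c d :: int where x: "2 * x$1 = a" "2 * x$2 = b" "2 * x$3 = c" "2 * x$4 = d"
    by (meson Ints_cases)
  obtain k :: int where k: "qnorm x = k" using * by (auto elim: Ints_cases)
  have "(2 * x$1)\<^sup>2 + (2 * x$2)\<^sup>2 + (2 * x$3)\<^sup>2 + (2 * x$4)\<^sup>2 = 4 * qnorm x"
    by (simp add: qnorm_components)
  hence "of_int (a\<^sup>2 + b\<^sup>2 + c\<^sup>2 + d\<^sup>2) = (of_int (4 * k) :: real)" unfolding x k by simp
  hence e: "a\<^sup>2 + b\<^sup>2 + c\<^sup>2 + d\<^sup>2 = 4 * k" by linarith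
  have sq: "\<exists>r. t\<^sup>2 = 4 * r + (if even t then 0 else 1)" for t :: int
  proof (cases "even t")
    case True
    then obtain u where "t = 2 * u" by blast
    thus ?thesis by (intro exI[of _ "u\<^sup>2"]) (simp add: power2_eq_square)
  next
    case False
    then obtain u where "t = 2 * u + 1" by (auto elim: oddE)
    thus ?thesis by (intro exI[of _ "u\<^sup>2 + u"]) (simp add: power2_eq_square algebra_simps)
  qed
  obtain r1 r2 r3 r4 where "a\<^sup>2 = 4 * r1 + (if even a then 0 else 1)" "b\<^sup>2 = 4 * r2 + (if even b then 0 else 1)"
    "c\<^sup>2 = 4 * r3 + (if even c then 0 else 1)" "d\<^sup>2 = 4 * r4 + (if even d then 0 else 1)"
    using sq by metis
  hence "even a = even b" "even a = even c" "even a = even d"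
    using e by (cases "even a"; cases "even b"; cases "even c"; cases "even d"; simp; presburger)+
  hence "even (b - a)" "even (c - a)" "even (d - a)" by auto
  then obtain b' c' d' where "b = a + 2 * b'" "c = a + 2 * c'" "d = a + 2 * d'"
    by (metis add.commute diff_add_cancel evenE)
  hence "x = hq a b' c' d'" using x by (simp add: hq_def quat_eq_iff field_simps)
  thus "x \<in> J" by simp
qed

text \<open>The right-hand side of \<open>J_iff_double\<close> after a similarity of factor
  \<open>m\<close>. It recovers the image of \<open>J\<close> from that of
  \<open>integer_lattice\<close> without reference to the similarity, and so maps sublattices of
  \<open>integer_lattice\<close> to sublattices of \<open>J\<close>.\<close>

definition big_hull :: "nat \<Rightarrow> (real^4) set \<Rightarrow> (real^4) set" where
  "big_hull m M = {x. 2 *\<^sub>R x \<in> M \<and> qnorm x / m \<in> \<int>}"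

lemma similarity_bij:
  assumes "similarity m T" "m > 0"
  shows "linear T" "inj T" "surj T"
proof -
  show l: "linear T" using assms by (simp add: similarity_def)
  show i: "inj T"
  proof (rule injI)
    fix x y assume "T x = T y"
    hence "qnorm (T (x - y)) = 0" by (simp add: linear_diff[OF l])
    moreover have "qnorm (T (x - y)) = m * qnorm (x - y)" using assms by (simp add: similarity_def)
    ultimately show "x = y" using assms(2) by simp
  qed
  show "surj T" by (rule linear_inj_imp_surj[OF l i])
qed

lemma hull_similarity:
  assumes T: "similarity (real m) T" and m: "m > 0"
  shows "big_hull m (T ` integer_lattice) = T ` J"
proof -
  have b: "linear T" "inj T" "surj T" using similarity_bij[OF T] m by auto
  have "T y \<in> big_hull m (T ` integer_lattice) \<longleftrightarrow> y \<in> J" for y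
  proof -
    have "2 *\<^sub>R T y \<in> T ` integer_lattice \<longleftrightarrow> 2 *\<^sub>R y \<in> integer_lattice"
      using b(2) by (simp add: inj_image_mem_iff flip: linear_scale[OF b(1)])
    thus ?thesis using T m unfolding big_hull_def J_iff_double by (simp add: similarity_def)
  qed
  thus ?thesis using b(3) by (auto simp: image_iff) (metis surjD)+
qed

lemma similarity_nrm:
  assumes T: "similarity (real m) T" "T ` J \<subseteq> J" and x: "x \<in> J"
  shows "nrm (T x) = m * nrm x"
proof -
  have "real (nrm (T x)) = real (m * nrm x)"
    using assms by (subst real_nrm) (auto simp: similarity_def real_nrm)
  thus ?thesis by linarith
qed

text \<open>\<open>T'\<close> followed by the inverse of \<open>T\<close> is an isometry mapping
  \<open>J\<close> onto itself. It preserves norms, hence D4, and carries \<open>d4_ext qone\<close>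
  to \<open>d4_ext s\<close>, where \<open>s\<close> is the image of \<open>qone\<close>.\<close>

lemma similarity_image_d4_ext:
  assumes T: "similarity (real m) T" and m: "m > 0" and T': "similarity (real m) T'"
    and eq: "T ` J = T' ` J"
  obtains s where "s \<in> J" "nrm s = 1" "T s = T' qone" "T' ` integer_lattice = T ` d4_ext s"
proof -
  have b: "linear T" "linear T'" using similarity_bij T T' m by auto
  have q: "qnorm (T x) = m * qnorm x" "qnorm (T' x) = m * qnorm x" for x
    using T T' by (auto simp: similarity_def)
  have "T' qone \<in> T ` J" using eq by simp
  then obtain s where s: "s \<in> J" "T s = T' qone" by auto
  have key: "nrm z = nrm y \<and> nrm (z - s) = nrm (y - qone)" if "T z = T' y" for y z
  proof -
    have "m * qnorm z = m * qnorm y" using that q by metis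
    moreover have "m * qnorm (z - s) = m * qnorm (y - qone)"
    proof -
      have "T (z - s) = T' (y - qone)" using that s by (simp add: linear_diff[OF b(1)] linear_diff[OF b(2)])
      thus ?thesis using q by metis
    qed
    ultimately show ?thesis using m by (simp add: nrm_def)
  qed
  have "T' ` integer_lattice = T ` d4_ext s"
  proof (intro equalityI subsetI)
    fix x assume "x \<in> T' ` integer_lattice"
    then obtain y where y: "y \<in> J" "even (nrm y) \<or> even (nrm (y - qone))" "x = T' y"
      by (auto simp: integer_lattice_d4_ext d4_ext_def)
    then obtain z where "z \<in> J" "T z = T' y" using eq by (metis imageE imageI)
    thus "x \<in> T ` d4_ext s" using y key[of z y] by (auto simp: d4_ext_def image_iff intro!: bexI[of _ z])
  next
    fix x assume "x \<in> T ` d4_ext s"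
    then obtain z where z: "z \<in> J" "even (nrm z) \<or> even (nrm (z - s))" "x = T z"
      by (auto simp: d4_ext_def)
    then obtain y where "y \<in> J" "T z = T' y" using eq by (metis imageE imageI)
    thus "x \<in> T' ` integer_lattice" using z key[of z y]
      by (auto simp: integer_lattice_d4_ext d4_ext_def image_iff intro!: bexI[of _ y])
  qed
  moreover have "nrm s = 1"
  proof -
    have "m * qnorm s = m * qnorm qone" using s q by metis
    thus ?thesis using m by (simp add: nrm_def)
  qed
  ultimately show ?thesis using that s by blast
qed

lemma d4_ext_unit:
  assumes "v \<in> J_units"
  shows "d4_ext v = (\<lambda>x. v \<odot> x) ` integer_lattice"
proof -
  have v: "v \<in> J" "nrm v = 1" using assms by (auto simp: J_units_def)
  have *: "nrm (v \<odot> x) = nrm x" "nrm (v \<odot> x - v) = nrm (x - qone)" if "x \<in> J" for x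
    using that v nrm_mult[of v "x - qone"] by (simp_all add: nrm_mult J_diff qmult_diff_right)
  show ?thesis
  proof (intro equalityI subsetI)
    fix y assume y: "y \<in> d4_ext v"
    let ?x = "qcnj v \<odot> y"
    have "y = v \<odot> ?x" using J_units_inverse[OF assms] by (simp flip: qmult_assoc)
    moreover have "?x \<in> J" using y v by (auto simp: d4_ext_def J_mult)
    ultimately show "y \<in> (\<lambda>x. v \<odot> x) ` integer_lattice"
      using y *[of ?x] by (auto simp: d4_ext_def integer_lattice_d4_ext image_iff intro!: bexI[of _ ?x])
  next
    fix y assume "y \<in> (\<lambda>x. v \<odot> x) ` integer_lattice"
    thus "y \<in> d4_ext v" using * v by (auto simp: d4_ext_def integer_lattice_d4_ext J_mult)
  qed
qed

text \<open>The candidates are the images of \<open>d4_ext v\<close> for the three roots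
  \<open>v\<close>. The image of D4 always has even norms and lies in
  \<open>integer_lattice\<close>, so \<open>v\<close> is admissible iff \<open>T v\<close> is
  integral. For even \<open>m\<close> this always holds; for odd \<open>m\<close> the three
  \<open>T v\<close> occupy the three nonzero classes modulo D4, one of which is integral.\<close>

lemma ssl_integer_fiber:
  assumes T: "similarity (real m) T" "T ` J \<subseteq> J" and m: "m > 0"
  shows "card {M \<in> ssl integer_lattice m. big_hull m M = T ` J} = (if even m then 3 else 1)"
proof -
  let ?V = "{qone, omega, omega'}"
  note b = similarity_bij[OF T(1)]
  have lin: "linear T" and inj: "inj T" using b m by auto
  have VJ: "v \<in> J" "nrm v = 1" if "v \<in> ?V" for v using that omegas by auto
  have Tn: "nrm (T x) = m * nrm x" if "x \<in> J" for x using similarity_nrm[OF T that] .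
  have TJ: "T x \<in> J" if "x \<in> J" for x using T(2) that by blast
  have D4: "x \<in> integer_lattice" if "x \<in> J" "even (nrm x)" for x
    using that by (simp add: integer_lattice_d4_ext d4_ext_def)
  have "{M \<in> ssl integer_lattice m. big_hull m M = T ` J} = (\<lambda>v. T ` d4_ext v) ` {v \<in> ?V. T v \<in> integer_lattice}"
  proof (intro equalityI subsetI)
    fix M assume "M \<in> {M \<in> ssl integer_lattice m. big_hull m M = T ` J}"
    then obtain T' where T': "similarity (real m) T'" "T' ` integer_lattice \<subseteq> integer_lattice"
      "M = T' ` integer_lattice" "big_hull m M = T ` J"
      by (auto simp: ssl_eq[OF lattice_density_integer m])
    hence "T ` J = T' ` J" using hull_similarity m by metis
    then obtain s where s: "s \<in> J" "nrm s = 1" "T s = T' qone" "T' ` integer_lattice = T ` d4_ext s"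
      using similarity_image_d4_ext[OF T(1) m T'(1)] by metis
    then obtain v where v: "v \<in> ?V" "d4_ext s = d4_ext v"
      using d4_ext_eq_omegas[of s] by (metis odd_one)
    have "v \<in> d4_ext v" using VJ[OF v(1)] by (simp add: d4_ext_def nrm_def)
    hence "T v \<in> integer_lattice" using T'(2) s(4) v(2) by auto
    thus "M \<in> (\<lambda>v. T ` d4_ext v) ` {v \<in> ?V. T v \<in> integer_lattice}"
      using v s T' by auto
  next
    fix M assume "M \<in> (\<lambda>v. T ` d4_ext v) ` {v \<in> ?V. T v \<in> integer_lattice}"
    then obtain v where v: "v \<in> ?V" "T v \<in> integer_lattice" "M = T ` d4_ext v" by auto
    have vu: "v \<in> J_units" using VJ[OF v(1)] by (simp add: J_units_def)
    have M: "M = (\<lambda>x. T (v \<odot> x)) ` integer_lattice"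
      by (simp add: v(3) d4_ext_unit[OF vu] image_image)
    have sim: "similarity (real m) (\<lambda>x. T (v \<odot> x))"
      using T(1) J_unitsD(2)[OF vu] unfolding similarity_def linear_iff
      by (simp add: qmult_add_right qnorm_mult)
    have "T y \<in> integer_lattice" if y: "y \<in> d4_ext v" for y
    proof (cases "even (nrm y)")
      case True
      thus ?thesis using y by (intro D4) (auto simp: d4_ext_def TJ Tn)
    next
      case False
      hence "T (y - v) \<in> integer_lattice"
        using y VJ[OF v(1)] by (intro D4) (auto simp: d4_ext_def TJ Tn J_diff)
      hence "T (y - v) + T v \<in> integer_lattice" using v(2) by (auto simp: integer_lattice_def)
      thus ?thesis by (simp add: linear_diff[OF lin])
    qed
    hence sub: "M \<subseteq> integer_lattice" using v(3) by auto
    have "M \<in> ssl integer_lattice m"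
      unfolding ssl_eq[OF lattice_density_integer m]
      by (intro CollectI exI[of _ "\<lambda>x. T (v \<odot> x)"] conjI sim M sub[unfolded M])
    moreover have "big_hull m M = T ` J"
    proof -
      have "(\<lambda>x. v \<odot> x) ` J = J"
      proof -
        have "bimod (qone \<odot> v) (qone \<odot> qone) = bimod qone qone"
          by (rule bimod_unit[OF vu]) (simp add: J_units_def nrm_def)
        thus ?thesis by (simp add: bimod_def)
      qed
      moreover have "big_hull m M = (\<lambda>x. T (v \<odot> x)) ` J" unfolding M by (rule hull_similarity[OF sim m])
      ultimately show ?thesis by (metis image_image)
    qed
    ultimately show "M \<in> {M \<in> ssl integer_lattice m. big_hull m M = T ` J}" by blast
  qed
  moreover have "inj_on (\<lambda>v. T ` d4_ext v) {v \<in> ?V. T v \<in> integer_lattice}"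
  proof (rule inj_onI, rule ccontr)
    fix v w assume vw: "v \<in> {v \<in> ?V. T v \<in> integer_lattice}" "w \<in> {v \<in> ?V. T v \<in> integer_lattice}"
      "T ` d4_ext v = T ` d4_ext w" "v \<noteq> w"
    hence "d4_ext v = d4_ext w" using inj by (simp add: inj_image_eq_iff)
    moreover have "v \<in> d4_ext v" using vw(1) VJ by (simp add: d4_ext_def nrm_def)
    ultimately have "even (nrm (v - w))" using vw(1) VJ[of v] by (auto simp: d4_ext_def)
    moreover have "nrm (v - w) = nrm (w - v)"
      by (simp add: nrm_def qnorm_def norm_minus_commute)
    ultimately show False using vw omegas by auto
  qed
  ultimately have c: "card {M \<in> ssl integer_lattice m. big_hull m M = T ` J}
      = card {v \<in> ?V. T v \<in> integer_lattice}" by (simp add: card_image)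
  show ?thesis
  proof (cases "even m")
    case True
    have "{v \<in> ?V. T v \<in> integer_lattice} = ?V"
      using True VJ by (auto intro!: D4 simp: TJ Tn)
    moreover have "card ?V = 3" using omegas by simp
    ultimately show ?thesis using c True by (simp only: if_True)
  next
    case False
    obtain n p q r where h1: "T qone = hq n p q r" using TJ[of qone] J_cases basis_in_J by blast
    obtain n' p' q' r' where h2: "T omega = hq n' p' q' r'" using TJ[of omega] J_cases omegas by blast
    \<comment> \<open>The three cube roots of unity sum to 0, so the parities of
      \<open>T omega'\<close> follow from those of the other two images.\<close>
    have "omega' = - qone - omega" by (simp add: omega_def omega'_def hq_def quat_simps)
    hence "T omega' = T (- qone - omega)" by (rule arg_cong)
    also have "\<dots> = - T qone - T omega" by (simp only: linear_diff[OF lin] linear_neg[OF lin])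
    finally have "T omega' = - T qone - T omega" .
    hence "T omega' = - hq n p q r - hq n' p' q' r'" unfolding h1 h2 .
    also have "\<dots> = hq (- n - n') (- p - p') (- q - q') (- r - r')"
      by (simp add: hq_def quat_eq_iff field_simps)
    finally have h3: "T omega' = hq (- n - n') (- p - p') (- q - q') (- r - r')" .
    have odd: "odd (nrm (T qone))" "odd (nrm (T omega))" "odd (nrm (T omega'))"
      using False omegas by (simp_all add: Tn)
    have i: "T qone \<in> integer_lattice \<longleftrightarrow> even n" "T omega \<in> integer_lattice \<longleftrightarrow> even n'"
      "T omega' \<in> integer_lattice \<longleftrightarrow> even (n + n')"
      by (auto simp: h1 h2 h3 hq_integer_iff)
    \<comment> \<open>If both were even, odd norms would make both sums \<open>p + q + r\<close> and
      \<open>p' + q' + r'\<close> odd, and \<open>T omega'\<close> would have even norm.\<close>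
    have "\<not> (even n \<and> even n')" using odd unfolding h1 h2 h3 even_nrm_hq by auto
    then consider "even n" "odd n'" | "odd n" "even n'" | "odd n" "odd n'" by blast
    hence "\<exists>v. {v \<in> ?V. T v \<in> integer_lattice} = {v}"
    proof cases
      case 1 thus ?thesis using i by (intro exI[of _ qone]) auto
    next
      case 2 thus ?thesis using i by (intro exI[of _ omega]) auto
    next
      case 3 thus ?thesis using i by (intro exI[of _ omega']) auto
    qed
    thus ?thesis using c False by auto
  qed
qed

lemma card_ssl_integer:
  assumes m: "m > 0"
  shows "card (ssl integer_lattice m) = (if even m then 3 else 1) * card (ssl J m)"
proof -
  let ?S = "ssl integer_lattice m" and ?k = "(if even m then 3 else 1) :: nat"
  have T: "\<exists>T. similarity (real m) T \<and> T ` J \<subseteq> J \<and> N = T ` J" if "N \<in> ssl J m" for N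
    using that by (auto simp: ssl_eq[OF lattice_density_hurwitz m])
  have fib: "card {M \<in> ?S. big_hull m M = N} = ?k" if "N \<in> ssl J m" for N
    using T[OF that] ssl_integer_fiber[OF _ _ m] by blast
  have finJ: "finite (ssl J m)" using ssl_hurwitz[OF m] finite_hurwitz_pairs[OF m] by simp
  have hullJ: "big_hull m M \<in> ssl J m" if M: "M \<in> ?S" for M
  proof -
    obtain T where T: "similarity (real m) T" "T ` integer_lattice \<subseteq> integer_lattice" "M = T ` integer_lattice"
      using M by (auto simp: ssl_eq[OF lattice_density_integer m])
    have "big_hull m M \<subseteq> J"
    proof
      fix x assume "x \<in> big_hull m M"
      hence x: "2 *\<^sub>R x \<in> integer_lattice" "qnorm x / m \<in> \<int>" using T by (auto simp: big_hull_def)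
      have "real m * (qnorm x / m) \<in> \<int>" using x(2) by (intro Ints_mult) auto
      thus "x \<in> J" using x(1) m by (simp add: J_iff_double)
    qed
    thus ?thesis using hull_similarity[OF T(1) m] T by (auto simp: ssl_eq[OF lattice_density_hurwitz m])
  qed
  have "?S = (\<Union>N\<in>ssl J m. {M \<in> ?S. big_hull m M = N})" using hullJ by auto
  moreover have "card \<dots> = (\<Sum>N\<in>ssl J m. card {M \<in> ?S. big_hull m M = N})"
  proof (rule card_UN_disjoint[OF finJ])
    show "\<forall>N\<in>ssl J m. finite {M \<in> ?S. big_hull m M = N}"
    proof
      fix N assume "N \<in> ssl J m"
      hence "card {M \<in> ?S. big_hull m M = N} \<noteq> 0" using fib by simp
      thus "finite {M \<in> ?S. big_hull m M = N}" by (meson card.infinite)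
    qed
  qed auto
  ultimately have "card ?S = (\<Sum>N\<in>ssl J m. card {M \<in> ?S. big_hull m M = N})" by simp
  also have "\<dots> = (\<Sum>N\<in>ssl J m. ?k)" using fib by (intro sum.cong) auto
  finally show ?thesis by simp
qed

lemma num_similarity_sublattices_ssl: "num_similarity_sublattices \<Lambda> m = card (ssl \<Lambda> m)"
  by (simp add: num_similarity_sublattices_def ssl_def)

section \<open>The sum of inverse fourth powers\<close>

text \<open>Zagier's kernel for the elementary proof of zeta(2)^2 = (5/2) zeta(4). The factor 5/2 is
  the diagonal: \<open>zagier n n\<close> is (5/2) / n^4.\<close>

definition zagier :: "nat \<Rightarrow> nat \<Rightarrow> real" where
  "zagier m n = 1 / (real m * real n ^ 3) + 1 / (2 * real m ^ 2 * real n ^ 2) + 1 / (real m ^ 3 * real n)"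

lemma zagier_commute: "zagier m n = zagier n m"
  by (simp add: zagier_def mult.commute)

lemma zagier_identity:
  assumes "m > 0" "n > 0"
  shows "zagier m n - zagier (m + n) n - zagier m (m + n) = 1 / (real m ^ 2 * real n ^ 2)"
proof -
  have "1 / (x * y ^ 3) + 1 / (2 * x ^ 2 * y ^ 2) + 1 / (x ^ 3 * y)
      - (1 / (z * y ^ 3) + 1 / (2 * z ^ 2 * y ^ 2) + 1 / (z ^ 3 * y))
      - (1 / (x * z ^ 3) + 1 / (2 * x ^ 2 * z ^ 2) + 1 / (x ^ 3 * z)) = 1 / (x ^ 2 * y ^ 2)"
    if "x > 0" "y > 0" "z = x + y" for x y z :: real
  proof -
    have z: "z > 0" using that by simp
    have "(1 / (x * y ^ 3) + 1 / (2 * x ^ 2 * y ^ 2) + 1 / (x ^ 3 * y)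
      - (1 / (z * y ^ 3) + 1 / (2 * z ^ 2 * y ^ 2) + 1 / (z ^ 3 * y))
      - (1 / (x * z ^ 3) + 1 / (2 * x ^ 2 * z ^ 2) + 1 / (x ^ 3 * z))) * (2 * x ^ 3 * y ^ 3 * z ^ 3)
      = 2 * x\<^sup>2 * z ^ 3 + x * y * z ^ 3 + 2 * y\<^sup>2 * z ^ 3
      - (2 * x ^ 3 * z\<^sup>2 + x ^ 3 * y * z + 2 * x ^ 3 * y\<^sup>2)
      - (2 * x\<^sup>2 * y ^ 3 + x * y ^ 3 * z + 2 * y ^ 3 * z\<^sup>2)"
      using that(1,2) z by (simp add: field_simps power2_eq_square power3_eq_cube)
    also have "\<dots> = 2 * x * y * z ^ 3"
      unfolding that(3) by (simp add: algebra_simps power2_eq_square power3_eq_cube)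
    also have "\<dots> = 1 / (x ^ 2 * y ^ 2) * (2 * x ^ 3 * y ^ 3 * z ^ 3)"
      using that(1,2) by (simp add: field_simps power2_eq_square power3_eq_cube)
    finally show ?thesis
      by (rule mult_right_cancel[THEN iffD1, rotated]) (use that(1,2) z in simp)
  qed
  from this[of "real m" "real n" "real (m + n)"] show ?thesis using assms by (simp add: zagier_def)
qed

lemma inverse_squares_le: "(\<Sum>n\<in>{1..N}. 1 / real n ^ 2) \<le> 2"
proof (cases "N = 0")
  case False
  have "(\<Sum>n\<in>{1..N}. 1 / real n ^ 2) \<le> 2 - 1 / real N" if "N \<ge> 1" for N
    using that
  proof (induction N rule: dec_induct)
    case (step n)
    have "1 / real (Suc n) ^ 2 \<le> 1 / (real n * real (Suc n))"
      using step by (intro divide_left_mono) (auto simp: power2_eq_square)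
    also have "\<dots> = 1 / real n - 1 / real (Suc n)" using step by (simp add: field_simps)
    finally show ?case using step by simp
  qed simp
  from this[of N] False show ?thesis by (smt (verit) divide_nonneg_nonneg of_nat_0_le_iff less_one not_le)
qed simp

text \<open>Summing Zagier's identity over \<open>m + n \<le> N\<close>, everything cancels except the diagonal
  and the pairs with \<open>a \<le> N < a + b\<close>, which contribute \<open>O(1/N)\<close>.\<close>
lemma zagier_sum:
  fixes N :: nat
  assumes N: "N > 0"
  defines "T \<equiv> {(m, n). m \<ge> 1 \<and> n \<ge> 1 \<and> m + n \<le> N}"
  shows "\<bar>(\<Sum>(m, n)\<in>T. 1 / (real m ^ 2 * real n ^ 2)) - 5/2 * (\<Sum>a\<in>{1..N div 2}. 1 / real a ^ 4)\<bar> \<le> 20 / real N"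
proof -
  let ?z = "\<lambda>(m, n). zagier m n"
  define U where "U = {(a, b). b \<ge> 1 \<and> b < a \<and> a \<le> N}"
  define R where "R = {(a, b). b \<ge> 1 \<and> b < a \<and> a \<le> N \<and> N < a + b}"
  define T1 where "T1 = {(a, b). b \<ge> 1 \<and> b < a \<and> a + b \<le> N}"
  define T2 where "T2 = {(a, b). a \<ge> 1 \<and> a < b \<and> a + b \<le> N}"
  define T0 where "T0 = (\<lambda>a. (a, a)) ` {1..N div 2}"
  have sub: "T \<subseteq> {1..N} \<times> {1..N}" "U \<subseteq> {1..N} \<times> {1..N}"
    by (auto simp: T_def U_def)
  have fin: "finite T" "finite U" using finite_subset[OF sub(1)] finite_subset[OF sub(2)] by auto
  have UR: "U = T1 \<union> R" "T1 \<inter> R = {}" by (auto simp: U_def T1_def R_def)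
  have TT: "T = T1 \<union> (T2 \<union> T0)" "T1 \<inter> (T2 \<union> T0) = {}" "T2 \<inter> T0 = {}"
    by (auto simp: T_def T1_def T2_def T0_def image_iff)
  have fin': "finite T1" "finite T2" "finite T0" "finite R"
    using fin UR(1) TT(1) by auto
  have "(\<Sum>(m, n)\<in>T. 1 / (real m ^ 2 * real n ^ 2)) =
    (\<Sum>(m, n)\<in>T. zagier m n - zagier (m + n) n - zagier m (m + n))"
    by (intro sum.cong) (auto simp: T_def zagier_identity)
  also have "\<dots> = sum ?z T - (\<Sum>(m, n)\<in>T. zagier (m + n) n) - (\<Sum>(m, n)\<in>T. zagier m (m + n))"
    by (simp add: sum_subtractf case_prod_unfold)
  \<comment> \<open>Both shifted sums run over the pairs \<open>b < a \<le> N\<close>, while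
    \<open>T\<close> consists of two mirror halves and the diagonal; the pairs with
    \<open>a + b \<le> N\<close> cancel.\<close>
  also have "(\<Sum>(m, n)\<in>T. zagier (m + n) n) = sum ?z U"
    by (rule sum.reindex_bij_witness[of _ "\<lambda>(a, b). (a - b, b)" "\<lambda>(m, n). (m + n, n)"])
       (auto simp: T_def U_def)
  also have "(\<Sum>(m, n)\<in>T. zagier m (m + n)) = sum ?z U"
    by (rule sum.reindex_bij_witness[of _ "\<lambda>(a, b). (b, a - b)" "\<lambda>(m, n). (m + n, m)"])
       (auto simp: T_def U_def zagier_commute)
  also have "sum ?z T = sum ?z T1 + (sum ?z T2 + sum ?z T0)"
    unfolding TT(1) using fin' TT by (subst sum.union_disjoint; simp add: sum.union_disjoint)
  also have "sum ?z T2 = sum ?z T1"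
    by (rule sum.reindex_bij_witness[of _ "\<lambda>(a, b). (b, a)" "\<lambda>(a, b). (b, a)"])
       (auto simp: T1_def T2_def zagier_commute)
  also have "sum ?z U = sum ?z T1 + sum ?z R"
    unfolding UR(1) by (rule sum.union_disjoint[OF fin'(1,4) UR(2)])
  also have "sum ?z T0 = 5/2 * (\<Sum>a\<in>{1..N div 2}. 1 / real a ^ 4)"
    unfolding T0_def
    by (subst sum.reindex)
       (auto simp: inj_on_def sum_distrib_left zagier_def power2_eq_square power3_eq_cube power4_eq_xxxx
          field_simps intro!: sum.cong)
  finally have eq: "(\<Sum>(m, n)\<in>T. 1 / (real m ^ 2 * real n ^ 2)) - 5/2 * (\<Sum>a\<in>{1..N div 2}. 1 / real a ^ 4)
    = - (2 * sum ?z R)" by simp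
  \<comment> \<open>On \<open>R\<close> one has \<open>b < a\<close> and \<open>N < 2 * a\<close>:
    the three terms of \<open>zagier a b\<close> are at most 1, 1/2 and 1 times 1/(a b^3), and 1/a
    is below 2/N.\<close>
  have "sum ?z R \<le> (\<Sum>(a, b)\<in>R. 5 / (real N * real b ^ 3))"
  proof (rule sum_mono, clarify)
    fix a b assume "(a, b) \<in> R"
    hence ab: "b \<ge> 1" "b < a" "a \<le> N" "N < a + b" by (auto simp: R_def)
    let ?a = "real a" and ?b = "real b"
    have p: "?b > 0" "?a > 0" "?b \<le> ?a" "real N \<le> 2 * ?a" using ab by auto
    have "1 / (2 * ?a ^ 2 * ?b ^ 2) \<le> 1 / (2 * (?a * ?b ^ 3))"
      using p mult_mono[of ?b ?a "?a * ?b\<^sup>2" "?a * ?b\<^sup>2"]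
      by (intro divide_left_mono) (auto simp: power2_eq_square power3_eq_cube mult_ac)
    moreover have "1 / (?a ^ 3 * ?b) \<le> 1 / (?a * ?b ^ 3)"
    proof (rule divide_left_mono)
      have "?b * ?b \<le> ?a * ?a" using p by (intro mult_mono) auto
      hence "(?b * ?b) * (?a * ?b) \<le> (?a * ?a) * (?a * ?b)" using p by (intro mult_right_mono) auto
      thus "?a * ?b ^ 3 \<le> ?a ^ 3 * ?b" by (simp add: power3_eq_cube mult_ac)
    qed (use p in auto)
    ultimately have "zagier a b \<le> 1 / (?a * ?b ^ 3) + 1 / (2 * (?a * ?b ^ 3)) + 1 / (?a * ?b ^ 3)"
      unfolding zagier_def by linarith
    also have "\<dots> = 5 / (2 * ?a * ?b ^ 3)" using p by (simp add: field_simps)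
    also have "\<dots> \<le> 5 / (real N * ?b ^ 3)"
      using p N by (intro divide_left_mono mult_right_mono) auto
    finally show "zagier a b \<le> 5 / (real N * ?b ^ 3)" .
  qed
  \<comment> \<open>For fixed \<open>b\<close> there are at most \<open>b\<close> values of
    \<open>a\<close>, which lowers the exponent from 3 to 2. With \<open>inverse_squares_le\<close>
    the total is at most 10/N, doubled by \<open>eq\<close>.\<close>
  also have "\<dots> \<le> (\<Sum>(b, a)\<in>(SIGMA b:{1..N}. {N - b<..N}). 5 / (real N * real b ^ 3))"
  proof -
    have "(\<Sum>(a, b)\<in>R. 5 / (real N * real b ^ 3)) = (\<Sum>(b, a)\<in>(\<lambda>(a, b). (b, a)) ` R. 5 / (real N * real b ^ 3))"
      by (subst sum.reindex) (auto simp: inj_on_def intro!: sum.cong)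
    also have "\<dots> \<le> (\<Sum>(b, a)\<in>(SIGMA b:{1..N}. {N - b<..N}). 5 / (real N * real b ^ 3))"
      by (rule sum_mono2) (auto simp: R_def)
    finally show ?thesis .
  qed
  also have "\<dots> = (\<Sum>b\<in>{1..N}. \<Sum>a\<in>{N - b<..N}. 5 / (real N * real b ^ 3))"
    by (subst sum.Sigma) auto
  also have "\<dots> = (\<Sum>b\<in>{1..N}. 5 / real N * (1 / real b ^ 2))"
    by (intro sum.cong) (auto simp: power2_eq_square power3_eq_cube field_simps)
  also have "\<dots> \<le> 5 / real N * 2"
    unfolding sum_distrib_left[symmetric] using N by (intro mult_left_mono inverse_squares_le) auto
  finally have "sum ?z R \<le> 10 / real N" by simp
  moreover have "sum ?z R \<ge> 0" by (intro sum_nonneg) (auto simp: zagier_def)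
  ultimately show ?thesis unfolding eq by simp
qed

text \<open>The triangle \<open>m + n \<le> N\<close> lies between the squares of side
  \<open>N div 2\<close> and \<open>N\<close>, so its sum tends to zeta(2)^2 = pi^4/36; two fifths
  of this is the value.\<close>

lemma inverse_fourth_powers_sums: "(\<lambda>n. 1 / real (n + 1) ^ 4) sums (pi ^ 4 / 90)"
proof -
  define z where "z = (\<lambda>N. \<Sum>a\<in>{1..N}. 1 / real a ^ 4)"
  define y where "y = (\<lambda>N. \<Sum>a\<in>{1..N}. 1 / real a ^ 2)"
  define T where "T = (\<lambda>N::nat. {(m, n). m \<ge> 1 \<and> n \<ge> 1 \<and> m + n \<le> N})"
  define t where "t = (\<lambda>N. \<Sum>(m, n)\<in>T N. 1 / (real m ^ 2 * real n ^ 2))"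
  have shift: "(\<Sum>a\<in>{1..N}. f a) = (\<Sum>n<N. f (n + 1))" for f :: "nat \<Rightarrow> real" and N
    by (rule sum.reindex_bij_witness[of _ Suc "\<lambda>n. n - 1"]) auto
  have y: "y \<longlonglongrightarrow> pi\<^sup>2 / 6"
    using inverse_squares_sums unfolding sums_def y_def shift by simp
  have div2: "filterlim (\<lambda>N::nat. N div 2) at_top at_top"
    unfolding filterlim_at_top
  proof
    fix Z :: nat
    show "\<forall>\<^sub>F N in sequentially. Z \<le> N div 2"
      using eventually_ge_at_top[of "2 * Z"] by eventually_elim presburger
  qed
  have sq: "(\<Sum>(m, n)\<in>{1..N} \<times> {1..N}. 1 / (real m ^ 2 * real n ^ 2)) = y N * y N" for N
    unfolding y_def by (subst sum_product) (simp add: sum.cartesian_product)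
  have fin: "finite (T N)" for N
    by (rule finite_subset[of _ "{1..N} \<times> {1..N}"]) (auto simp: T_def)
  have "t N \<le> y N * y N" for N
    unfolding t_def sq[symmetric] by (rule sum_mono2) (auto simp: T_def)
  moreover have "y (N div 2) * y (N div 2) \<le> t N" for N
    unfolding t_def sq[symmetric] by (rule sum_mono2[OF fin]) (auto simp: T_def)
  moreover have "(\<lambda>N. y N * y N) \<longlonglongrightarrow> pi\<^sup>2 / 6 * (pi\<^sup>2 / 6)"
    by (intro tendsto_mult y)
  moreover have "(\<lambda>N. y (N div 2) * y (N div 2)) \<longlonglongrightarrow> pi\<^sup>2 / 6 * (pi\<^sup>2 / 6)"
    by (intro tendsto_mult filterlim_compose[OF y div2])
  ultimately have t: "t \<longlonglongrightarrow> pi\<^sup>2 / 6 * (pi\<^sup>2 / 6)"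
    by (intro tendsto_sandwich[of "\<lambda>N. y (N div 2) * y (N div 2)" t _ "\<lambda>N. y N * y N"]) auto
  have "(\<lambda>N. t N - 5/2 * z (N div 2)) \<longlonglongrightarrow> 0"
  proof (rule Lim_null_comparison)
    show "\<forall>\<^sub>F N in sequentially. norm (t N - 5/2 * z (N div 2)) \<le> 20 / real N"
      using eventually_gt_at_top[of 0]
      by eventually_elim (use zagier_sum in \<open>simp add: t_def z_def T_def\<close>)
    show "(\<lambda>N. 20 / real N) \<longlonglongrightarrow> 0" by real_asymp
  qed
  from tendsto_diff[OF t this] have "(\<lambda>N. 5/2 * z (N div 2)) \<longlonglongrightarrow> pi\<^sup>2 / 6 * (pi\<^sup>2 / 6)" by simp
  moreover have "filterlim (\<lambda>N::nat. 2 * N) at_top at_top" by real_asymp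
  ultimately have "(\<lambda>N. 5/2 * z (2 * N div 2)) \<longlonglongrightarrow> pi\<^sup>2 / 6 * (pi\<^sup>2 / 6)"
    by (rule filterlim_compose)
  from tendsto_mult_left[OF this, of "2/5"] have "z \<longlonglongrightarrow> pi ^ 4 / 90" by (simp add: power4_eq_xxxx power2_eq_square mult.assoc)
  thus ?thesis unfolding sums_def z_def shift by simp
qed

text \<open>Series are indexed by \<open>n\<close> for the integer \<open>n + 1\<close>, so the
  indices \<open>2 * n + 1\<close> belong to the even integers.\<close>

lemma sums_double_index:
  fixes f :: "nat \<Rightarrow> 'a :: real_normed_vector"
  assumes "\<And>n. even n \<Longrightarrow> f n = 0" "(\<lambda>n. f (2 * n + 1)) sums c"
  shows "f sums c"
proof -
  have "f n = 0" if n: "n \<notin> range (\<lambda>n. 2 * n + 1)" for n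
  proof (rule assms(1), rule ccontr)
    assume "odd n"
    then obtain k where "n = 2 * k + 1" by (rule oddE)
    thus False using n by blast
  qed
  moreover have "strict_mono (\<lambda>n::nat. 2 * n + 1)" by (simp add: strict_mono_def)
  ultimately show ?thesis using sums_mono_reindex[of "\<lambda>n. 2 * n + 1" f c] assms(2) by blast
qed

text \<open>The even integers contribute the fraction 1/16, which leaves 15/16 of pi^4/90. A term of
  even index belongs to an odd integer.\<close>

lemma inverse_odd_fourth_powers_sums:
  "(\<lambda>n. if even n then 1 / real (n + 1) ^ 4 else 0) sums (pi ^ 4 / 96)"
proof -
  let ?f = "\<lambda>n. 1 / real (n + 1) ^ 4"
  have s: "(\<lambda>n. 1/16 * ?f n) sums (1/16 * (pi ^ 4 / 90))"
    by (intro sums_mult inverse_fourth_powers_sums)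
  have e: "1/16 * ?f n = (if odd (2 * n + 1) then ?f (2 * n + 1) else 0)" for n
  proof -
    have r: "real (2 * n + 1 + 1) = 2 * real (n + 1)" by simp
    have "1/16 * ?f n = 1 / (2 * real (n + 1)) ^ 4" unfolding power_mult_distrib by simp
    thus ?thesis unfolding r[symmetric] by simp
  qed
  have "(\<lambda>n. if odd n then ?f n else 0) sums (1/16 * (pi ^ 4 / 90))"
  proof (rule sums_double_index)
    show "(\<lambda>n. if odd (2 * n + 1) then ?f (2 * n + 1) else 0) sums (1/16 * (pi ^ 4 / 90))"
      using s unfolding e .
  qed simp
  from sums_diff[OF inverse_fourth_powers_sums this]
  have "(\<lambda>n. ?f n - (if odd n then ?f n else 0)) sums (pi ^ 4 / 96)" by simp
  also have "(\<lambda>n. ?f n - (if odd n then ?f n else 0)) = (\<lambda>n. if even n then ?f n else 0)" by auto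
  finally show ?thesis .
qed

section \<open>Dirichlet series\<close>

definition ds_term :: "(nat \<Rightarrow> complex) \<Rightarrow> complex \<Rightarrow> nat \<Rightarrow> complex" where
  "ds_term u w n = u (Suc n) * of_nat (Suc n) powr (- w)"

definition ds :: "(nat \<Rightarrow> complex) \<Rightarrow> complex \<Rightarrow> complex" where
  "ds u w = (\<Sum>n. ds_term u w n)"

lemma norm_of_nat_powr: "norm (of_nat (Suc n) powr (z::complex)) = real (Suc n) powr Re z"
  using norm_powr_real_powr[of "of_nat (Suc n)" z] by simp

text \<open>Mean value estimate on the segment from n + 1 to n + 2; it gains the factor 1/(n + 1)
  used by Abel summation.\<close>

lemma powr_diff_bound:
  assumes "Re w > 0"
  shows "norm (of_nat (Suc n) powr (- w) - of_nat (Suc (Suc n)) powr (- w))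
    \<le> norm w * real (Suc n) powr (- Re w - 1)"
proof -
  let ?S = "closed_segment (complex_of_real (real (Suc n))) (complex_of_real (real (Suc (Suc n))))"
  have seg: "\<exists>x. z = of_real x \<and> real (Suc n) \<le> x" if "z \<in> ?S" for z
    using that unfolding closed_segment_of_real by (auto simp: closed_segment_eq_real_ivl)
  have "norm (of_real (real (Suc n)) powr (- w) - of_real (real (Suc (Suc n))) powr (- w))
    \<le> (norm w * real (Suc n) powr (- Re w - 1)) * norm (complex_of_real (real (Suc n)) - of_real (real (Suc (Suc n))))"
  proof (rule field_differentiable_bound[of ?S])
    fix z assume z: "z \<in> ?S"
    then obtain x where x: "z = of_real x" "real (Suc n) \<le> x" using seg by blast
    have x0: "x > 0" using x(2) by (simp add: less_le_trans[of 0 "real (Suc n)"])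
    show "((\<lambda>z. z powr (- w)) has_field_derivative (- w * z powr (- w - 1))) (at z within ?S)"
    proof (rule has_field_derivative_at_within, rule has_field_derivative_powr)
      show "z \<notin> \<real>\<^sub>\<le>\<^sub>0" using x0 by (simp add: x(1))
    qed
    have "norm (- w * z powr (- w - 1)) = norm w * x powr (- Re w - 1)"
      using x0 by (simp add: x norm_mult norm_powr_real_powr)
    also have "\<dots> \<le> norm w * real (Suc n) powr (- Re w - 1)"
      using x(2) assms by (intro mult_left_mono powr_mono2') auto
    finally show "norm (- w * z powr (- w - 1)) \<le> norm w * real (Suc n) powr (- Re w - 1)" .
  qed auto
  thus ?thesis by (simp flip: of_real_diff)
qed

lemma abel_summation:
  fixes u g :: "nat \<Rightarrow> 'a :: comm_ring"
  shows "(\<Sum>n<N. u n * g n) = (\<Sum>k<N. u k) * g N + (\<Sum>n<N. (\<Sum>k<Suc n. u k) * (g n - g (Suc n)))"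
  by (induction N) (auto simp: algebra_simps)

lemma summable_Suc_powr:
  assumes "s < -1"
  shows "summable (\<lambda>n. real (Suc n) powr s)"
  using assms by (subst summable_Suc_iff) (simp add: summable_real_powr_iff)

text \<open>Abel summation turns the series into one with terms of size O(n^(theta - Re w - 1)),
  which converges absolutely and locally uniformly, even where the original series does so only
  conditionally. All continuations below come from this.\<close>

lemma dirichlet_series_bounded_sums:
  assumes bd: "\<And>N. norm (\<Sum>k<N. u (Suc k)) \<le> K * real N powr \<theta>" and \<theta>: "\<theta> \<ge> 0"
  shows dirichlet_series_summable: "Re w > \<theta> \<Longrightarrow> summable (ds_term u w)"
    and dirichlet_series_holomorphic: "ds u holomorphic_on {w. Re w > \<theta>}"
proof -
  define g where "g = (\<lambda>n w. complex_of_nat (Suc n) powr (- w))"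
  define V where "V = (\<lambda>N. \<Sum>k<N. u (Suc k))"
  define h where "h = (\<lambda>n w. V (Suc n) * (g n w - g (Suc n) w))"
  have K: "K \<ge> 0" using bd[of 1] by (smt (verit) norm_ge_zero of_nat_1 powr_one_eq_one mult_cancel_left2)
  have hb: "norm (h n w) \<le> K * norm w * real (Suc n) powr (\<theta> - Re w - 1)" if "Re w > \<theta>" for n w
  proof -
    have "norm (h n w) = norm (V (Suc n)) * norm (g n w - g (Suc n) w)" by (simp add: h_def norm_mult)
    also have "\<dots> \<le> (K * real (Suc n) powr \<theta>) * (norm w * real (Suc n) powr (- Re w - 1))"
      using that \<theta> K bd[of "Suc n"] powr_diff_bound[of w n] unfolding V_def g_def
      by (intro mult_mono) auto
    also have "\<dots> = K * norm w * (real (Suc n) powr \<theta> * real (Suc n) powr (- Re w - 1))" by simp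
    also have "real (Suc n) powr \<theta> * real (Suc n) powr (- Re w - 1) = real (Suc n) powr (\<theta> - Re w - 1)"
      by (simp flip: powr_add add: algebra_simps)
    finally show ?thesis .
  qed
  have sm: "summable (\<lambda>n. K * C * real (Suc n) powr (\<theta> - s - 1))" if "s > \<theta>" for s C
    using that by (intro summable_mult summable_Suc_powr) simp
  have hs: "summable (\<lambda>n. h n w)" if "Re w > \<theta>" for w
    by (rule summable_comparison_test'[OF sm[OF that, of "norm w"]]) (use hb[OF that] in auto)
  have sums: "ds_term u w sums (\<Sum>n. h n w)" if w: "Re w > \<theta>" for w
  proof -
    have "(\<lambda>N. V N * g N w) \<longlonglongrightarrow> 0"
    proof (rule Lim_null_comparison)
      show "\<forall>\<^sub>F N in sequentially. norm (V N * g N w) \<le> K * real N powr (\<theta> - Re w)"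
        using eventually_gt_at_top[of 0]
      proof eventually_elim
        case (elim N)
        have "norm (V N * g N w) \<le> (K * real N powr \<theta>) * real (Suc N) powr (- Re w)"
          unfolding norm_mult g_def norm_of_nat_powr using bd[of N] K
          by (intro mult_mono) (auto simp: V_def)
        also have "\<dots> \<le> (K * real N powr \<theta>) * real N powr (- Re w)"
          using K w \<theta> elim by (intro mult_left_mono powr_mono2') auto
        also have "\<dots> = K * real N powr (\<theta> - Re w)"
          by (simp add: powr_diff powr_minus field_simps)
        finally show ?case .
      qed
      have "(\<lambda>N. real N powr (\<theta> - Re w)) \<longlonglongrightarrow> 0"
        using w by (intro tendsto_neg_powr filterlim_real_sequentially) auto
      from tendsto_mult_left[OF this, of K] show "(\<lambda>N. K * real N powr (\<theta> - Re w)) \<longlonglongrightarrow> 0" by simp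
    qed
    moreover have "(\<lambda>N. \<Sum>n<N. h n w) \<longlonglongrightarrow> (\<Sum>n. h n w)" by (rule summable_LIMSEQ[OF hs[OF w]])
    ultimately have "(\<lambda>N. V N * g N w + (\<Sum>n<N. h n w)) \<longlonglongrightarrow> 0 + (\<Sum>n. h n w)" by (rule tendsto_add)
    moreover have "(\<Sum>n<N. ds_term u w n) = V N * g N w + (\<Sum>n<N. h n w)" for N
      using abel_summation[of "\<lambda>k. u (Suc k)" "\<lambda>n. g n w" N] by (simp add: ds_term_def V_def g_def h_def)
    ultimately show ?thesis unfolding sums_def by simp
  qed
  show "summable (ds_term u w)" if "Re w > \<theta>" using sums[OF that] by (rule sums_summable)
  have open_half: "open {w. Re w > \<theta>}" by (rule open_halfspace_Re_gt)
  have "(\<lambda>w. \<Sum>n. h n w) holomorphic_on {w. Re w > \<theta>}"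
  proof (rule holomorphic_uniform_sequence[OF open_half])
    show "(\<lambda>w. \<Sum>n<N. h n w) holomorphic_on {w. Re w > \<theta>}" for N
      unfolding h_def g_def by (intro holomorphic_intros)
    fix x assume x: "x \<in> {w. Re w > \<theta>}"
    define d where "d = (Re x - \<theta>) / 2"
    have d: "d > 0" using x by (simp add: d_def)
    have near: "Re w \<ge> \<theta> + d" "norm w \<le> norm x + d" if "w \<in> cball x d" for w
    proof -
      have "\<bar>Re (x - w)\<bar> \<le> d" using that abs_Re_le_cmod[of "x - w"] by (simp add: dist_norm)
      moreover have "Re x = \<theta> + 2 * d" by (simp add: d_def field_simps)
      ultimately show "Re w \<ge> \<theta> + d" by simp
      show "norm w \<le> norm x + d"
        using that norm_triangle_ineq2[of w x] by (simp add: dist_norm norm_minus_commute)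
    qed
    have "uniform_limit (cball x d) (\<lambda>N w. \<Sum>n<N. h n w) (\<lambda>w. \<Sum>n. h n w) sequentially"
    proof (rule Weierstrass_m_test)
      fix n w assume w: "w \<in> cball x d"
      have "norm (h n w) \<le> K * norm w * real (Suc n) powr (\<theta> - Re w - 1)"
        using near[OF w] d by (intro hb) auto
      also have "\<dots> \<le> K * (norm x + d) * real (Suc n) powr (\<theta> - (\<theta> + d) - 1)"
        using near[OF w] K d by (intro mult_mono powr_mono) auto
      finally show "norm (h n w) \<le> K * (norm x + d) * real (Suc n) powr (\<theta> - (\<theta> + d) - 1)" .
    qed (use sm[of "\<theta> + d"] d in auto)
    moreover have "cball x d \<subseteq> {w. Re w > \<theta>}" using near d by force
    ultimately show "\<exists>d>0. cball x d \<subseteq> {w. Re w > \<theta>} \<and>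
      uniform_limit (cball x d) (\<lambda>N w. \<Sum>n<N. h n w) (\<lambda>w. \<Sum>n. h n w) sequentially" using d by blast
  qed
  moreover have "ds u w = (\<Sum>n. h n w)" if "Re w > \<theta>" for w
    unfolding ds_def using sums[OF that] by (simp add: sums_iff)
  ultimately show "ds u holomorphic_on {w. Re w > \<theta>}"
    by (subst holomorphic_cong[OF refl, where g = "\<lambda>w. \<Sum>n. h n w"]) auto
qed

lemma ds_double:
  assumes "summable (ds_term u w)"
  shows "ds_term (\<lambda>n. if even n then u (n div 2) else 0) w sums (2 powr (- w) * ds u w)"
proof -
  let ?v = "\<lambda>n. if even n then u (n div 2) else 0"
  have "of_nat (Suc (2 * n + 1)) powr (- w) = 2 powr (- w) * of_nat (Suc n) powr (- w)" for n
    using powr_times_real[of 2 "of_nat (Suc n)" "- w"] by (simp add: algebra_simps)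
  hence "ds_term ?v w (2 * n + 1) = 2 powr (- w) * ds_term u w n" for n
    unfolding ds_term_def by simp
  moreover have "(\<lambda>n. 2 powr (- w) * ds_term u w n) sums (2 powr (- w) * ds u w)"
    unfolding ds_def using assms by (intro sums_mult summable_sums)
  ultimately have "(\<lambda>n. ds_term ?v w (2 * n + 1)) sums (2 powr (- w) * ds u w)" by simp
  thus ?thesis by (rule sums_double_index[rotated]) (simp add: ds_term_def)
qed

section \<open>The Dirichlet series of the Hurwitz ring\<close>

text \<open>Groups an unordered sum over \<open>X\<close> into the finite fibres of
  \<open>\<nu>\<close>. It links sums over lattice points, which can be reindexed by bijections,
  with Dirichlet series.\<close>

lemma sum_by_norm:
  fixes \<nu> :: "'a \<Rightarrow> nat" and \<phi> :: "nat \<Rightarrow> complex"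
  assumes pos: "\<And>x. x \<in> X \<Longrightarrow> \<nu> x > 0" and fin: "\<And>n. n > 0 \<Longrightarrow> finite {x \<in> X. \<nu> x = n}"
    and c: "\<And>n. n > 0 \<Longrightarrow> c n = card {x \<in> X. \<nu> x = n}"
  shows abs_summable_by_norm: "(\<lambda>x. \<phi> (\<nu> x)) abs_summable_on X \<longleftrightarrow>
      summable (\<lambda>n. norm (of_nat (c (Suc n)) * \<phi> (Suc n)))"
    and sums_by_norm: "(\<lambda>x. \<phi> (\<nu> x)) abs_summable_on X \<Longrightarrow>
      (\<lambda>n. of_nat (c (Suc n)) * \<phi> (Suc n)) sums (\<Sum>\<^sub>\<infinity>x\<in>X. \<phi> (\<nu> x))"
proof -
  define B where "B = (\<lambda>n. {x \<in> X. \<nu> x = Suc n})"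
  define S where "S = Sigma (UNIV :: nat set) B"
  have finB: "finite (B n)" for n using fin by (simp add: B_def)
  have bij: "bij_betw snd S X"
    unfolding bij_betw_def
  proof
    show "inj_on snd S" by (auto simp: inj_on_def S_def B_def)
    show "snd ` S = X"
    proof (intro equalityI subsetI)
      fix x assume "x \<in> X"
      hence "(\<nu> x - 1, x) \<in> S" using pos[of x] by (simp add: S_def B_def)
      thus "x \<in> snd ` S" by force
    qed (auto simp: S_def B_def)
  qed
  have nB: "(\<Sum>\<^sub>\<infinity>x\<in>B n. norm (\<phi> (\<nu> x))) = norm (of_nat (c (Suc n)) * \<phi> (Suc n))" for n
    using finB[of n] by (simp add: B_def c norm_mult)
  have sB: "(\<Sum>\<^sub>\<infinity>x\<in>B n. \<phi> (\<nu> x)) = of_nat (c (Suc n)) * \<phi> (Suc n)" for n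
    using finB[of n] by (simp add: B_def c)
  have 1: "(\<lambda>x. \<phi> (\<nu> x)) abs_summable_on X \<longleftrightarrow> (\<lambda>p. \<phi> (\<nu> (snd p))) abs_summable_on S"
    by (rule summable_on_reindex_bij_betw[OF bij, symmetric])
  also have "\<dots> \<longleftrightarrow> (\<lambda>n. norm (of_nat (c (Suc n)) * \<phi> (Suc n))) summable_on UNIV"
    unfolding S_def Infinite_Sum.abs_summable_on_Sigma_iff using finB by (simp add: nB)
  also have "\<dots> \<longleftrightarrow> summable (\<lambda>n. norm (of_nat (c (Suc n)) * \<phi> (Suc n)))"
    by (rule summable_on_UNIV_nonneg_real_iff) simp
  finally show iff: "(\<lambda>x. \<phi> (\<nu> x)) abs_summable_on X \<longleftrightarrow>
      summable (\<lambda>n. norm (of_nat (c (Suc n)) * \<phi> (Suc n)))" .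
  assume abs: "(\<lambda>x. \<phi> (\<nu> x)) abs_summable_on X"
  have "(\<Sum>\<^sub>\<infinity>x\<in>X. \<phi> (\<nu> x)) = (\<Sum>\<^sub>\<infinity>p\<in>S. \<phi> (\<nu> (snd p)))"
    by (rule infsum_reindex_bij_betw[OF bij, symmetric])
  also have "\<dots> = (\<Sum>\<^sub>\<infinity>n. \<Sum>\<^sub>\<infinity>x\<in>B n. \<phi> (\<nu> x))"
    using Infinite_Sum.abs_summable_summable[OF abs[unfolded 1]] unfolding S_def
    by (subst infsum_Sigma_banach[symmetric]) auto
  finally have e: "(\<Sum>\<^sub>\<infinity>x\<in>X. \<phi> (\<nu> x)) = (\<Sum>\<^sub>\<infinity>n. of_nat (c (Suc n)) * \<phi> (Suc n))"
    by (simp add: sB)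
  have sm: "summable (\<lambda>n. norm (of_nat (c (Suc n)) * \<phi> (Suc n)))" using abs iff by blast
  note s = summable_sums[OF summable_norm_cancel[OF sm]]
  show "(\<lambda>n. of_nat (c (Suc n)) * \<phi> (Suc n)) sums (\<Sum>\<^sub>\<infinity>x\<in>X. \<phi> (\<nu> x))"
    unfolding e infsumI[OF norm_summable_imp_has_sum[OF sm s]] by (rule s)
qed

lemma infsum_times_abs:
  fixes f :: "'a \<Rightarrow> complex" and g :: "'b \<Rightarrow> complex"
  assumes f: "f abs_summable_on A" and g: "g abs_summable_on B"
  shows abs_summable_times: "(\<lambda>(a, b). f a * g b) abs_summable_on A \<times> B"
    and infsum_times: "(\<Sum>\<^sub>\<infinity>(a, b)\<in>A \<times> B. f a * g b) = (\<Sum>\<^sub>\<infinity>a\<in>A. f a) * (\<Sum>\<^sub>\<infinity>b\<in>B. g b)"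
proof -
  let ?h = "\<lambda>p. f (fst p) * g (snd p)"
  have "?h abs_summable_on Sigma A (\<lambda>_. B)"
    unfolding Infinite_Sum.abs_summable_on_Sigma_iff
  proof (intro conjI ballI)
    show "(\<lambda>y. ?h (x, y)) abs_summable_on B" for x
      using g by (simp add: norm_mult summable_on_cmult_right)
    have "(\<lambda>x. norm (f x) * (\<Sum>\<^sub>\<infinity>y\<in>B. norm (g y))) summable_on A"
      using f by (rule summable_on_cmult_left)
    thus "(\<lambda>x. \<Sum>\<^sub>\<infinity>y\<in>B. norm (?h (x, y))) abs_summable_on A"
      by (simp add: norm_mult infsum_cmult_right' abs_mult infsum_nonneg)
  qed
  thus 1: "(\<lambda>(a, b). f a * g b) abs_summable_on A \<times> B" by (simp add: case_prod_unfold)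
  have "(\<Sum>\<^sub>\<infinity>p\<in>A \<times> B. ?h p) = (\<Sum>\<^sub>\<infinity>x\<in>A. \<Sum>\<^sub>\<infinity>y\<in>B. ?h (x, y))"
    by (rule infsum_Sigma_banach[symmetric])
       (use Infinite_Sum.abs_summable_summable[OF 1] in \<open>simp add: case_prod_unfold\<close>)
  also have "\<dots> = (\<Sum>\<^sub>\<infinity>a\<in>A. f a) * (\<Sum>\<^sub>\<infinity>b\<in>B. g b)"
    by (simp add: infsum_cmult_right' infsum_cmult_left')
  finally show "(\<Sum>\<^sub>\<infinity>(a, b)\<in>A \<times> B. f a * g b) = (\<Sum>\<^sub>\<infinity>a\<in>A. f a) * (\<Sum>\<^sub>\<infinity>b\<in>B. g b)"
    by (simp add: case_prod_unfold)
qed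

section \<open>Counting Hurwitz quaternions by norm\<close>

definition norm_count :: "nat \<Rightarrow> nat" where
  "norm_count n = card {x \<in> J - {0}. nrm x = n}"

definition hurwitz_count :: "real \<Rightarrow> nat" where
  "hurwitz_count t = card {x \<in> J - {0}. real (nrm x) \<le> t}"

lemma finite_J_nrm_le_real: "finite {x \<in> J. real (nrm x) \<le> t}"
proof (cases "t \<ge> 0")
  case True
  have "{x \<in> J. real (nrm x) \<le> t} \<subseteq> {x \<in> J. nrm x \<le> nat \<lfloor>t\<rfloor>}"
    using True by (auto simp: le_nat_floor)
  thus ?thesis by (rule finite_subset) (rule finite_J_nrm_le)
next
  case False
  hence "{x \<in> J. real (nrm x) \<le> t} = {}" by (auto simp: not_le)
  thus ?thesis by (simp only: finite.emptyI)
qed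

text \<open>The constant of \<open>ball_count_hurwitz\<close>, plus 1 for the origin, which
  \<open>hurwitz_count\<close> omits.\<close>

definition hurwitz_err :: real where "hurwitz_err = 15 * pi\<^sup>2 + 1"

lemma hurwitz_count_bound:
  assumes "t \<ge> 1"
  shows "\<bar>real (hurwitz_count t) - pi\<^sup>2 * t\<^sup>2\<bar> \<le> hurwitz_err * t powr (3/2)"
proof -
  let ?r = "sqrt t"
  have r: "?r \<ge> 1" using assms by simp
  have r4: "?r ^ 4 = t\<^sup>2" using assms by (simp add: power4_eq_xxxx power2_eq_square)
  have r3: "?r ^ 3 = t powr (3/2)"
    using assms by (simp add: powr_half_sqrt[symmetric] powr_realpow[symmetric] powr_powr)
  have "{x \<in> J. norm x \<le> ?r} = insert 0 {x \<in> J - {0}. real (nrm x) \<le> t}"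
    using assms by (auto simp: norm_le_sqrt_iff real_nrm)
  hence "ball_count J ?r = card (insert 0 {x \<in> J - {0}. real (nrm x) \<le> t})"
    by (simp only: ball_count_def)
  also have "\<dots> = Suc (hurwitz_count t)"
    unfolding hurwitz_count_def
    by (rule card_insert_disjoint) (auto intro: finite_subset[OF _ finite_J_nrm_le_real[of t]])
  finally have "real (ball_count J ?r) = real (hurwitz_count t) + 1" by simp
  moreover have "\<bar>real (ball_count J ?r) - pi\<^sup>2 * ?r ^ 4\<bar> \<le> 15 * pi\<^sup>2 * ?r ^ 3"
    by (rule ball_count_hurwitz[OF r])
  moreover have "1 \<le> t powr (3/2)" using assms by (simp add: ge_one_powr_ge_zero)
  ultimately show ?thesis unfolding r4 r3 hurwitz_err_def abs_le_iff by (simp add: algebra_simps)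
qed

lemma hurwitz_count_upper:
  assumes "t \<ge> 0"
  shows "real (hurwitz_count t) \<le> (pi\<^sup>2 + hurwitz_err) * t\<^sup>2"
proof (cases "t \<ge> 1")
  case True
  have "t powr (3/2) \<le> t powr 2" using True by (intro powr_mono) auto
  hence "hurwitz_err * t powr (3/2) \<le> hurwitz_err * t\<^sup>2"
    using True by (intro mult_left_mono) (auto simp: hurwitz_err_def)
  thus ?thesis using hurwitz_count_bound[OF True] by (simp add: algebra_simps abs_le_iff)
next
  case False
  have "{x \<in> J - {0}. real (nrm x) \<le> t} = {}"
  proof -
    have "real (nrm x) \<ge> 1" if "x \<in> J - {0}" for x
    proof -
      have "nrm x > 0" using that by (simp add: nrm_pos_iff)
      thus ?thesis by linarith
    qed
    thus ?thesis using False by fastforce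
  qed
  hence "hurwitz_count t = 0" unfolding hurwitz_count_def by (simp only: card.empty)
  thus ?thesis by (simp add: hurwitz_err_def)
qed

lemma sum_norm_count: "(\<Sum>k<N. norm_count (Suc k)) = hurwitz_count (real N)"
proof -
  have "{x \<in> J - {0}. real (nrm x) \<le> real N} = (\<Union>k\<in>{..<N}. {x \<in> J - {0}. nrm x = Suc k})"
  proof (intro equalityI subsetI)
    fix x assume x: "x \<in> {x \<in> J - {0}. real (nrm x) \<le> real N}"
    hence "nrm x = Suc (nrm x - 1)" "nrm x - 1 < N" using nrm_pos_iff[of x] by auto
    thus "x \<in> (\<Union>k\<in>{..<N}. {x \<in> J - {0}. nrm x = Suc k})" using x by blast
  qed auto
  also have "card \<dots> = (\<Sum>k<N. norm_count (Suc k))"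
    unfolding norm_count_def
    by (rule card_UN_disjoint) (auto intro: finite_subset[OF _ finite_J_nrm_eq])
  finally show ?thesis by (simp add: hurwitz_count_def)
qed

lemma sum_Suc_real: "(\<Sum>k<N. real (Suc k)) = real N * (real N + 1) / 2"
  by (induction N) (auto simp: field_simps)

text \<open>\<open>2 * pi\<^sup>2 * n\<close> is the derivative of the main term
  \<open>pi\<^sup>2 * t\<^sup>2\<close>, hence the mean value of \<open>norm_count\<close>. Its
  removal lowers the exponent of the partial sums from 2 to 3/2, so the series converges past w =
  2.\<close>

definition excess :: "nat \<Rightarrow> complex" where
  "excess n = of_real (real (norm_count n) - 2 * pi\<^sup>2 * real n)"

lemma excess_sums_bound:
  "norm (\<Sum>k<N. excess (Suc k)) \<le> (hurwitz_err + pi\<^sup>2) * real N powr (3/2)"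
proof (cases "N = 0")
  case False
  have "(\<Sum>k<N. excess (Suc k)) = of_real (\<Sum>k<N. real (norm_count (Suc k)) - 2 * pi\<^sup>2 * real (Suc k))"
    by (simp add: excess_def)
  also have "(\<Sum>k<N. real (norm_count (Suc k)) - 2 * pi\<^sup>2 * real (Suc k))
     = real (hurwitz_count (real N)) - 2 * pi\<^sup>2 * (\<Sum>k<N. real (Suc k))"
    by (simp only: sum_subtractf sum_distrib_left sum_norm_count[symmetric] of_nat_sum)
  also have "\<dots> = real (hurwitz_count (real N)) - pi\<^sup>2 * (real N)\<^sup>2 - pi\<^sup>2 * real N"
    unfolding sum_Suc_real by (simp add: power2_eq_square algebra_simps)
  finally have "norm (\<Sum>k<N. excess (Suc k)) =
    \<bar>real (hurwitz_count (real N)) - pi\<^sup>2 * (real N)\<^sup>2 - pi\<^sup>2 * real N\<bar>" by (simp only: norm_of_real)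
  also have "\<dots> \<le> hurwitz_err * real N powr (3/2) + pi\<^sup>2 * real N"
  proof -
    have "\<bar>a - b\<bar> \<le> c + b" if "\<bar>a\<bar> \<le> c" "b \<ge> 0" for a b c :: real using that by linarith
    thus ?thesis using hurwitz_count_bound[of "real N"] False by simp
  qed
  also have "real N \<le> real N powr (3/2)"
    using powr_mono[of 1 "3/2" "real N"] False by simp
  hence "hurwitz_err * real N powr (3/2) + pi\<^sup>2 * real N \<le> (hurwitz_err + pi\<^sup>2) * real N powr (3/2)"
    by (simp add: algebra_simps mult_left_mono)
  finally show ?thesis .
qed simp

text \<open>Its Dirichlet series is (1 - 2^(2-w)) zeta(w-1). The partial sums are of order N instead
  of N^2, which gives holomorphy for Re w > 1.\<close>

definition alt :: "nat \<Rightarrow> complex" where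
  "alt n = (if even n then - of_nat n else of_nat n)"

lemma alt_sums_bound: "norm (\<Sum>k<N. alt (Suc k)) \<le> 1 * real N powr 1"
proof -
  have eq: "(\<Sum>k<N. alt (Suc k)) = (if even N then - of_nat (N div 2) else of_nat (Suc N div 2))"
  proof (induction N)
    case (Suc N)
    show ?case unfolding sum.lessThan_Suc Suc.IH
      by (cases "even N") (auto simp: alt_def elim!: evenE oddE)
  qed simp
  have "norm (\<Sum>k<N. alt (Suc k)) \<le> real (Suc N div 2)"
    unfolding eq by (cases "even N") (simp_all only: if_True if_False norm_minus_cancel norm_of_nat of_nat_le_iff div_le_mono le_SucI order_refl simp_thms)
  also have "\<dots> \<le> real N" by (cases N) auto
  finally show ?thesis by simp
qed

definition odd_ind :: "nat \<Rightarrow> complex" where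
  "odd_ind n = (if odd n then 1 else 0)"

lemma odd_ind_sums_bound: "norm (\<Sum>k<N. odd_ind (Suc k)) \<le> 1 * real N powr 1"
proof -
  have "norm (\<Sum>k<N. odd_ind (Suc k)) \<le> (\<Sum>k<N. norm (odd_ind (Suc k)))" by (rule norm_sum)
  also have "\<dots> \<le> (\<Sum>k<N. 1)" by (rule sum_mono) (simp add: odd_ind_def)
  finally show ?thesis by simp
qed

lemma norm_count_sums_bound:
  "norm (\<Sum>k<N. of_nat (norm_count (Suc k)) :: complex) \<le> (pi\<^sup>2 + hurwitz_err) * real N powr 2"
proof -
  have "(\<Sum>k<N. of_nat (norm_count (Suc k)) :: complex) = of_nat (hurwitz_count (real N))"
    by (simp only: sum_norm_count[symmetric] of_nat_sum)
  hence "norm (\<Sum>k<N. of_nat (norm_count (Suc k)) :: complex) = real (hurwitz_count (real N))"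
    by (simp only: norm_of_nat)
  also have "\<dots> \<le> (pi\<^sup>2 + hurwitz_err) * (real N)\<^sup>2" by (rule hurwitz_count_upper) simp
  also have "(real N)\<^sup>2 = real N powr 2" by simp
  finally show ?thesis .
qed

lemma norm_ds_term:
  "norm (ds_term u w n) = norm (u (Suc n)) * real (Suc n) powr (- Re w)"
  unfolding ds_term_def norm_mult norm_of_nat_powr by simp

lemma ds_norm_summable:
  assumes "\<And>N. norm (\<Sum>k<N. of_nat (a (Suc k)) :: complex) \<le> K * real N powr \<theta>" "\<theta> \<ge> 0" "Re w > \<theta>"
  shows "summable (\<lambda>n. norm (ds_term (\<lambda>n. of_nat (a n)) w n))"
proof -
  have s: "summable (ds_term (\<lambda>n. of_nat (a n)) (of_real (Re w)))"
    by (rule dirichlet_series_summable[OF assms(1,2)]) (use assms(3) in simp)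
  have e: "ds_term (\<lambda>n. of_nat (a n)) (of_real (Re w)) n
     = of_real (norm (ds_term (\<lambda>n. of_nat (a n)) w n))" for n
  proof -
    have "complex_of_real (real (Suc n)) powr of_real (- Re w) = of_real (real (Suc n) powr (- Re w))"
      by (rule powr_of_real) simp
    thus ?thesis unfolding norm_ds_term by (simp add: ds_term_def)
  qed
  have "summable (\<lambda>n. complex_of_real (norm (ds_term (\<lambda>n. of_nat (a n)) w n)))"
    unfolding e[symmetric] by (rule s)
  thus ?thesis by (simp only: summable_of_real_iff)
qed

lemma of_nat_powr_mult:
  "of_nat (m * n) powr (z::complex) = of_nat m powr z * of_nat n powr z"
  using powr_times_real[of "of_nat m" "of_nat n" z] by simp

lemma odd_elements_bij:
  "bij_betw (\<lambda>(d, y). real d *\<^sub>R y) ({d. odd d} \<times> odd_prims) {x \<in> J. odd (nrm x)}"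
  unfolding bij_betw_def
proof
  show "inj_on (\<lambda>(d, y). real d *\<^sub>R y) ({d. odd d} \<times> odd_prims)"
  proof (rule inj_onI, clarify)
    fix d e :: nat and x y
    assume *: "odd d" "x \<in> odd_prims" "odd e" "y \<in> odd_prims" "real d *\<^sub>R x = real e *\<^sub>R y"
    hence "d > 0" "e > 0" by (auto intro: Nat.gr0I)
    thus "d = e \<and> x = y" using odd_prims_scale_eq[OF *(2,4,5)] by simp
  qed
  show "(\<lambda>(d, y). real d *\<^sub>R y) ` ({d. odd d} \<times> odd_prims) = {x \<in> J. odd (nrm x)}"
  proof (intro equalityI subsetI)
    fix x assume "x \<in> (\<lambda>(d, y). real d *\<^sub>R y) ` ({d. odd d} \<times> odd_prims)"
    then obtain d :: nat and y where y: "odd d" "y \<in> odd_prims" "x = real d *\<^sub>R y" by auto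
    thus "x \<in> {x \<in> J. odd (nrm x)}"
      using J_scale_nat[of y d] nrm_scale[of y d] odd_primsD(1,2)[OF y(2)] by simp
  next
    fix x assume "x \<in> {x \<in> J. odd (nrm x)}"
    hence "x \<in> J" "odd (nrm x)" by auto
    then obtain d :: nat and y where "odd d" "y \<in> odd_prims" "x = real d *\<^sub>R y"
      by (rule odd_nrm_factor)
    thus "x \<in> (\<lambda>(d, y). real d *\<^sub>R y) ` ({d. odd d} \<times> odd_prims)" by force
  qed
qed

lemma J_nonzero_split:
  "J - {0} = {x \<in> J. odd (nrm x)} \<union> (\<lambda>x. one_plus_i \<odot> x) ` (J - {0})"
  "{x \<in> J. odd (nrm x)} \<inter> (\<lambda>x. one_plus_i \<odot> x) ` (J - {0}) = {}"
  "inj_on (\<lambda>x. one_plus_i \<odot> x) A"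
proof -
  have q0: "one_plus_i \<noteq> 0" using nrm_pos_iff[of one_plus_i] by simp
  show "J - {0} = {x \<in> J. odd (nrm x)} \<union> (\<lambda>x. one_plus_i \<odot> x) ` (J - {0})"
  proof (intro equalityI subsetI)
    fix x assume x: "x \<in> J - {0}"
    show "x \<in> {x \<in> J. odd (nrm x)} \<union> (\<lambda>x. one_plus_i \<odot> x) ` (J - {0})"
    proof (cases "even (nrm x)")
      case True
      then obtain y where "y \<in> J" "x = one_plus_i \<odot> y" using even_nrm_left_factor x by blast
      thus ?thesis using x by auto
    qed (use x in auto)
  next
    fix x assume "x \<in> {x \<in> J. odd (nrm x)} \<union> (\<lambda>x. one_plus_i \<odot> x) ` (J - {0})"
    thus "x \<in> J - {0}" using q0 by (auto simp: J_mult nrm_def)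
  qed
  show "{x \<in> J. odd (nrm x)} \<inter> (\<lambda>x. one_plus_i \<odot> x) ` (J - {0}) = {}"
    by (auto simp: nrm_mult)
  show "inj_on (\<lambda>x. one_plus_i \<odot> x) A" using qmult_left_cancel[OF q0] by (auto simp: inj_on_def)
qed

lemma odd_prims_nonzero: "odd_prims \<subseteq> J - {0}"
  by (auto dest: odd_primsD)

definition pair_count :: "nat \<Rightarrow> complex" where
  "pair_count m = of_nat (card (hurwitz_pairs m))"

text \<open>With \<open>PP\<close> the sum over \<open>odd_prims\<close> and \<open>EE\<close> that
  over \<open>J - {0}\<close>, the pairs give \<open>PP * EE\<close>, and the elements of odd norm
  are counted twice: as odd integers times \<open>odd_prims\<close>, and as what remains of
  \<open>J - {0}\<close> without the multiples of 1 + i. The product form postpones the question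
  whether \<open>ds odd_ind (2 * w)\<close> vanishes.\<close>

lemma hurwitz_dirichlet_identity:
  assumes w: "Re w > 2"
  shows "summable (ds_term pair_count w)"
    and "ds odd_ind (2 * w) * ds pair_count w = (1 - 2 powr (- w)) * (ds (\<lambda>n. of_nat (norm_count n)) w)\<^sup>2"
proof -
  define \<phi> where "\<phi> = (\<lambda>n::nat. complex_of_nat n powr (- w))"
  have \<phi>_mult: "\<phi> (m * n) = \<phi> m * \<phi> n" for m n
    unfolding \<phi>_def by (rule of_nat_powr_mult)
  have J0: "(\<lambda>x. \<phi> (nrm x)) abs_summable_on (J - {0})"
    and E: "(\<Sum>\<^sub>\<infinity>x\<in>J - {0}. \<phi> (nrm x)) = ds (\<lambda>n. of_nat (norm_count n)) w"
  proof -
    have fin: "finite {x \<in> J - {0}. nrm x = n}" for n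
      by (rule finite_subset[OF _ finite_J_nrm_eq[of n]]) auto
    have "summable (\<lambda>n. norm (ds_term (\<lambda>n. of_nat (norm_count n)) w n))"
      by (rule ds_norm_summable[OF norm_count_sums_bound]) (use w in auto)
    hence sm: "summable (\<lambda>n. norm (of_nat (norm_count (Suc n)) * \<phi> (Suc n)))"
      by (simp only: ds_term_def \<phi>_def)
    have pos: "nrm x > 0" if "x \<in> J - {0}" for x using that by (simp add: nrm_pos_iff)
    show abs: "(\<lambda>x. \<phi> (nrm x)) abs_summable_on (J - {0})"
      using sm abs_summable_by_norm[of "J - {0}" nrm norm_count \<phi>, OF pos fin norm_count_def] by blast
    have "(\<lambda>n. of_nat (norm_count (Suc n)) * \<phi> (Suc n)) sums (\<Sum>\<^sub>\<infinity>x\<in>J - {0}. \<phi> (nrm x))"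
      by (rule sums_by_norm[of "J - {0}" nrm norm_count \<phi>, OF pos fin norm_count_def abs])
    thus "(\<Sum>\<^sub>\<infinity>x\<in>J - {0}. \<phi> (nrm x)) = ds (\<lambda>n. of_nat (norm_count n)) w"
      by (simp add: ds_def ds_term_def \<phi>_def sums_iff)
  qed
  have P: "(\<lambda>x. \<phi> (nrm x)) abs_summable_on odd_prims"
    by (rule summable_on_subset_banach[OF J0 odd_prims_nonzero])
  define PP where "PP = (\<Sum>\<^sub>\<infinity>x\<in>odd_prims. \<phi> (nrm x))"
  define EE where "EE = (\<Sum>\<^sub>\<infinity>x\<in>J - {0}. \<phi> (nrm x))"
  have D: "(\<lambda>d. \<phi> (d\<^sup>2)) abs_summable_on {d. odd d}"
    and LD: "(\<Sum>\<^sub>\<infinity>d | odd d. \<phi> (d\<^sup>2)) = ds odd_ind (2 * w)"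
  proof -
    have sq: "\<phi> (n\<^sup>2) = of_nat n powr (- (2 * w))" for n
      unfolding power2_eq_square \<phi>_mult by (simp add: \<phi>_def algebra_simps flip: powr_add)
    have c: "card {d. odd d \<and> d = n} = (if odd n then 1 else 0)" "finite {d. odd d \<and> d = n}" for n :: nat
    proof -
      have "{d. odd d \<and> d = n} = (if odd n then {n} else {})" by auto
      thus "card {d. odd d \<and> d = n} = (if odd n then 1 else 0)" "finite {d. odd d \<and> d = n}" by auto
    qed
    have oi: "odd_ind = (\<lambda>n. of_nat (if odd n then 1 else 0))" by (auto simp: odd_ind_def)
    have "summable (\<lambda>n. norm (ds_term odd_ind (2 * w) n))"
      unfolding oi by (rule ds_norm_summable[OF odd_ind_sums_bound[unfolded oi]]) (use w in auto)
    hence sm: "summable (\<lambda>n. norm (of_nat (if odd (Suc n) then 1 else 0) * \<phi> ((Suc n)\<^sup>2)))"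
      by (simp only: ds_term_def oi sq)
    have pos: "d > 0" if "d \<in> {d. odd d}" for d :: nat using that by (auto intro: Nat.gr0I)
    note A = abs_summable_by_norm[where X = "{d. odd d}" and \<nu> = "\<lambda>d. d" and c = "\<lambda>n. if odd n then 1 else 0"
        and \<phi> = "\<lambda>d. \<phi> (d\<^sup>2)"]
    note B = sums_by_norm[where X = "{d. odd d}" and \<nu> = "\<lambda>d. d" and c = "\<lambda>n. if odd n then 1 else 0"
        and \<phi> = "\<lambda>d. \<phi> (d\<^sup>2)"]
    show abs: "(\<lambda>d. \<phi> (d\<^sup>2)) abs_summable_on {d. odd d}"
      by (subst A) (use sm pos c in simp_all)
    have "(\<lambda>n. of_nat (if odd (Suc n) then 1 else 0) * \<phi> ((Suc n)\<^sup>2)) sums (\<Sum>\<^sub>\<infinity>d | odd d. \<phi> (d\<^sup>2))"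
      by (rule B) (use abs pos c in simp_all)
    thus "(\<Sum>\<^sub>\<infinity>d | odd d. \<phi> (d\<^sup>2)) = ds odd_ind (2 * w)"
      by (simp only: ds_def ds_term_def oi sq sums_iff)
  qed
  have odd_sum: "(\<Sum>\<^sub>\<infinity>x | x \<in> J \<and> odd (nrm x). \<phi> (nrm x)) = ds odd_ind (2 * w) * PP"
  proof -
    have "(\<Sum>\<^sub>\<infinity>x | x \<in> J \<and> odd (nrm x). \<phi> (nrm x)) =
       (\<Sum>\<^sub>\<infinity>p\<in>{d. odd d} \<times> odd_prims. \<phi> (nrm ((\<lambda>(d, y). real d *\<^sub>R y) p)))"
      by (rule infsum_reindex_bij_betw[OF odd_elements_bij, symmetric])
    also have "\<dots> = (\<Sum>\<^sub>\<infinity>(d, y)\<in>{d. odd d} \<times> odd_prims. \<phi> (d\<^sup>2) * \<phi> (nrm y))"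
      by (rule infsum_cong) (clarify, simp add: nrm_scale[OF odd_primsD(1)] \<phi>_mult)
    also have "\<dots> = ds odd_ind (2 * w) * PP"
      unfolding LD[symmetric] PP_def by (rule infsum_times[OF D P])
    finally show ?thesis .
  qed
  have EE: "EE = ds odd_ind (2 * w) * PP + 2 powr (- w) * EE"
  proof -
    let ?A = "{x \<in> J. odd (nrm x)}" and ?B = "(\<lambda>x. one_plus_i \<odot> x) ` (J - {0})"
    have "?A \<subseteq> J - {0}" "?B \<subseteq> J - {0}" using J_nonzero_split(1) by auto
    hence "(\<lambda>x. \<phi> (nrm x)) summable_on ?A" "(\<lambda>x. \<phi> (nrm x)) summable_on ?B"
      using summable_on_subset_banach[OF Infinite_Sum.abs_summable_summable[OF J0]] by blast+
    hence "EE = (\<Sum>\<^sub>\<infinity>x\<in>?A. \<phi> (nrm x)) + (\<Sum>\<^sub>\<infinity>x\<in>?B. \<phi> (nrm x))"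
      unfolding EE_def using J_nonzero_split(2) by (subst J_nonzero_split(1)) (rule infsum_Un_disjoint)
    also have "(\<Sum>\<^sub>\<infinity>x\<in>?B. \<phi> (nrm x)) = (\<Sum>\<^sub>\<infinity>x\<in>J - {0}. \<phi> 2 * \<phi> (nrm x))"
      by (subst infsum_reindex[OF J_nonzero_split(3)])
         (auto intro!: infsum_cong simp: nrm_mult \<phi>_mult[of 2])
    also have "\<dots> = 2 powr (- w) * EE"
      unfolding EE_def by (simp add: infsum_cmult_right' \<phi>_def)
    finally show ?thesis unfolding odd_sum .
  qed
  let ?\<nu> = "\<lambda>p. nrm (fst p) * nrm (snd p)" and ?X = "odd_prims \<times> (J - {0})"
  have prod: "(\<lambda>p. \<phi> (?\<nu> p)) abs_summable_on ?X" "(\<Sum>\<^sub>\<infinity>p\<in>?X. \<phi> (?\<nu> p)) = PP * EE"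
    using abs_summable_times[OF P J0] infsum_times[OF P J0]
    by (simp_all add: \<phi>_mult case_prod_unfold PP_def EE_def)
  have hp: "{p \<in> ?X. ?\<nu> p = n} = hurwitz_pairs n" for n
    by (auto simp: hurwitz_pairs_def)
  have pos: "?\<nu> p > 0" if "p \<in> ?X" for p
    using that odd_primsD(1,3)[of "fst p"] by (auto simp: nrm_pos_iff mem_Times_iff)
  have "(\<lambda>n. of_nat (card (hurwitz_pairs (Suc n))) * \<phi> (Suc n)) sums (\<Sum>\<^sub>\<infinity>p\<in>?X. \<phi> (?\<nu> p))"
    by (rule sums_by_norm[where c = "\<lambda>n. card (hurwitz_pairs n)"])
       (use prod(1) pos in \<open>simp_all only: hp finite_hurwitz_pairs\<close>)
  hence "(\<lambda>n. of_nat (card (hurwitz_pairs (Suc n))) * \<phi> (Suc n)) sums (PP * EE)"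
    unfolding prod(2) .
  hence s: "ds_term pair_count w sums (PP * EE)"
    unfolding ds_term_def[abs_def] pair_count_def \<phi>_def .
  thus "summable (ds_term pair_count w)" by (rule sums_summable)
  have "ds pair_count w = PP * EE" using s by (simp add: ds_def sums_iff)
  moreover have "ds odd_ind (2 * w) * PP = (1 - 2 powr (- w)) * EE" using EE by (simp add: algebra_simps)
  ultimately show "ds odd_ind (2 * w) * ds pair_count w
     = (1 - 2 powr (- w)) * (ds (\<lambda>n. of_nat (norm_count n)) w)\<^sup>2"
    unfolding E[symmetric] EE_def[symmetric] by (simp add: power2_eq_square)
qed

text \<open>Subtracting 4 * 2^(-w) times the series of the integers n removes its even terms twice
  and makes it alternating. Both series on the right converge beyond Re w = 2; the prefactor
  vanishes at w = 2 and absorbs the pole.\<close>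

lemma alt_dirichlet_identity:
  assumes w: "Re w > 2"
  shows "(1 - 2 powr (2 - w)) * ds (\<lambda>n. of_nat (norm_count n)) w
    = (1 - 2 powr (2 - w)) * ds excess w + 2 * of_real (pi\<^sup>2) * ds alt w"
proof -
  let ?e = "\<lambda>n. complex_of_nat (norm_count n)" and ?id = "\<lambda>n. complex_of_nat n"
  have se: "summable (ds_term ?e w)"
    by (rule dirichlet_series_summable[OF norm_count_sums_bound]) (use w in auto)
  have sx: "summable (ds_term excess w)"
    by (rule dirichlet_series_summable[OF excess_sums_bound]) (use w in auto)
  have id: "ds_term ?id w n = (1 / (2 * of_real (pi\<^sup>2))) * (ds_term ?e w n - ds_term excess w n)" for n
    by (simp add: ds_term_def excess_def field_simps)
  have si: "summable (ds_term ?id w)"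
    unfolding id[abs_def] by (intro summable_mult summable_diff se sx)
  have "ds ?id w = (1 / (2 * of_real (pi\<^sup>2))) * (ds ?e w - ds excess w)"
    unfolding ds_def id[abs_def]
    by (subst suminf_mult) (auto intro: summable_diff se sx simp: suminf_diff[OF se sx])
  hence e: "ds ?e w = ds excess w + 2 * of_real (pi\<^sup>2) * ds ?id w" by (simp add: field_simps)
  have "(\<lambda>n. ds_term ?id w n - 4 * ds_term (\<lambda>n. if even n then ?id (n div 2) else 0) w n) sums
     (ds ?id w - 4 * (2 powr (- w) * ds ?id w))"
    unfolding ds_def[of ?id]
    by (intro sums_diff sums_mult summable_sums si ds_double[OF si, unfolded ds_def])
  also have "(\<lambda>n. ds_term ?id w n - 4 * ds_term (\<lambda>n. if even n then ?id (n div 2) else 0) w n) = ds_term alt w"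
    by (rule ext) (auto simp: ds_term_def alt_def algebra_simps elim!: oddE)
  finally have "ds alt w = (1 - 4 * 2 powr (- w)) * ds ?id w"
    by (simp add: ds_def sums_iff algebra_simps)
  also have "4 * 2 powr (- w) = 2 powr (2 - w)"
    by (simp add: powr_diff powr_minus field_simps)
  finally have a: "ds alt w = (1 - 2 powr (2 - w)) * ds ?id w" .
  show ?thesis unfolding e a by (simp add: algebra_simps)
qed

section \<open>Meromorphic continuation\<close>

lemma integer_neq_hurwitz: "integer_lattice \<noteq> J"
proof
  assume "integer_lattice = J"
  hence "hq 1 0 0 0 \<in> integer_lattice" by simp
  thus False by (simp add: hq_integer_iff)
qed

section \<open>Even arguments, and the transfer of the series from J to the integer lattice\<close>

lemma num_hurwitz:
  assumes "m > 0"
  shows "card (hurwitz_pairs m) = 576 * num_similarity_sublattices J m"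
  using card_hurwitz_pairs[OF assms] by (simp add: num_similarity_sublattices_ssl)

text \<open>As \<open>nrm a\<close> is odd, an even product forces \<open>nrm b\<close> to be even,
  and a factor 1 + i can be cancelled from \<open>b\<close>.\<close>

lemma card_hurwitz_pairs_double: "card (hurwitz_pairs (2 * m)) = card (hurwitz_pairs m)"
proof -
  let ?f = "\<lambda>(a, b). (a, one_plus_i \<odot> b)"
  have q0: "one_plus_i \<noteq> 0" using nrm_pos_iff[of one_plus_i] by simp
  have "?f ` hurwitz_pairs m = hurwitz_pairs (2 * m)"
  proof (intro equalityI subsetI)
    fix p assume "p \<in> ?f ` hurwitz_pairs m"
    thus "p \<in> hurwitz_pairs (2 * m)" using q0
      by (auto simp: hurwitz_pairs_def J_mult nrm_mult)
  next
    fix p assume "p \<in> hurwitz_pairs (2 * m)"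
    then obtain a b where p: "p = (a, b)" "a \<in> odd_prims" "b \<in> J" "b \<noteq> 0" "nrm a * nrm b = 2 * m"
      by (auto simp: hurwitz_pairs_def)
    have "even (nrm a * nrm b)" using p(5) by simp
    hence "even (nrm b)" using odd_primsD(2)[OF p(2)] by simp
    then obtain c where c: "c \<in> J" "b = one_plus_i \<odot> c" using even_nrm_left_factor p(3) by blast
    have "(a, c) \<in> hurwitz_pairs m" using p c by (auto simp: hurwitz_pairs_def nrm_mult)
    thus "p \<in> ?f ` hurwitz_pairs m" using p(1) c(2) by force
  qed
  moreover have "inj_on ?f (hurwitz_pairs m)"
    using qmult_left_cancel[OF q0] by (auto simp: inj_on_def)
  ultimately show ?thesis by (metis card_image)
qed

lemma num_hurwitz_double:
  "m > 0 \<Longrightarrow> num_similarity_sublattices J (2 * m) = num_similarity_sublattices J m"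
  using num_hurwitz[of m] num_hurwitz[of "2 * m"] card_hurwitz_pairs_double[of m] by simp

text \<open>The factor 3 is split as 1 + 2, the second part with halved argument. In this form it
  becomes a factor 1 + 2 * 2^(-2s) on series and a term \<open>summatory J (x / 2)\<close> on
  sums.\<close>

lemma num_integer:
  assumes "m > 0"
  shows "num_similarity_sublattices integer_lattice m = num_similarity_sublattices J m
    + 2 * (if even m then num_similarity_sublattices J (m div 2) else 0)"
proof -
  have "num_similarity_sublattices integer_lattice m = (if even m then 3 else 1) * num_similarity_sublattices J m"
    using card_ssl_integer[OF assms] by (simp add: num_similarity_sublattices_ssl)
  moreover have "num_similarity_sublattices J (m div 2) = num_similarity_sublattices J m" if "even m"
    using that assms num_hurwitz_double[of "m div 2"] by (auto elim!: evenE)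
  ultimately show ?thesis by simp
qed

lemma dirichlet_term_ds:
  "dirichlet_term \<Lambda> s = ds_term (\<lambda>n. of_nat (num_similarity_sublattices \<Lambda> n)) (2 * s)"
  by (rule ext) (simp add: dirichlet_term_def ds_term_def)

lemma dirichlet_hurwitz:
  assumes s: "Re s > 1"
  shows "summable (dirichlet_term J s)" "ds pair_count (2 * s) = 576 * dirichlet_gf J s"
proof -
  have e: "dirichlet_term J s = (\<lambda>n. (1 / 576) * ds_term pair_count (2 * s) n)"
    unfolding dirichlet_term_ds by (rule ext) (simp add: ds_term_def pair_count_def num_hurwitz)
  have sm: "summable (ds_term pair_count (2 * s))" by (rule hurwitz_dirichlet_identity(1)) (use s in simp)
  show "summable (dirichlet_term J s)" unfolding e by (rule summable_mult[OF sm])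
  show "ds pair_count (2 * s) = 576 * dirichlet_gf J s"
    unfolding dirichlet_gf_def ds_def e suminf_mult[OF sm] by simp
qed

lemma dirichlet_integer:
  assumes s: "Re s > 1"
  shows "summable (dirichlet_term integer_lattice s)"
    "dirichlet_gf integer_lattice s = (1 + 2 * 2 powr (- (2 * s))) * dirichlet_gf J s"
proof -
  let ?u = "\<lambda>n. complex_of_nat (num_similarity_sublattices J n)"
  let ?v = "\<lambda>n. if even n then ?u (n div 2) else 0"
  have e: "dirichlet_term integer_lattice s = (\<lambda>n. ds_term ?u (2 * s) n + 2 * ds_term ?v (2 * s) n)"
    unfolding dirichlet_term_ds by (rule ext) (simp add: ds_term_def num_integer algebra_simps)
  have sm: "summable (ds_term ?u (2 * s))" using dirichlet_hurwitz(1)[OF s] by (simp add: dirichlet_term_ds)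
  have "dirichlet_term integer_lattice s sums (ds ?u (2 * s) + 2 * (2 powr (- (2 * s)) * ds ?u (2 * s)))"
    unfolding e by (intro sums_add sums_mult ds_double sm) (simp add: ds_def summable_sums[OF sm])
  moreover have "ds ?u (2 * s) = dirichlet_gf J s" by (simp add: ds_def dirichlet_gf_def dirichlet_term_ds)
  ultimately have "dirichlet_term integer_lattice s sums ((1 + 2 * 2 powr (- (2 * s))) * dirichlet_gf J s)"
    by (simp add: algebra_simps)
  thus "summable (dirichlet_term integer_lattice s)"
    "dirichlet_gf integer_lattice s = (1 + 2 * 2 powr (- (2 * s))) * dirichlet_gf J s"
    by (auto simp: sums_iff dirichlet_gf_def)
qed

section \<open>The continued function and its double pole at s = 1\<close>

definition two_factor :: "(real^4) set \<Rightarrow> complex \<Rightarrow> complex" where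
  "two_factor \<Lambda> s = (if \<Lambda> = J then 1 else 1 + 2 * 2 powr (- (2 * s)))"

lemma dirichlet_gf_two_factor:
  assumes "\<Lambda> \<in> {J, integer_lattice}" "Re s > 1"
  shows "dirichlet_gf \<Lambda> s = two_factor \<Lambda> s * dirichlet_gf J s"
  using assms dirichlet_integer(2)[OF assms(2)] integer_neq_hurwitz by (auto simp: two_factor_def)

text \<open>For Re w > 2 this is 1 - 2^(2-w) times the Epstein zeta function, by
  \<open>alt_dirichlet_identity\<close>; the expression stays holomorphic for Re w > 3/2.\<close>

definition psi :: "complex \<Rightarrow> complex" where
  "psi w = (1 - 2 powr (2 - w)) * ds excess w + 2 * of_real (pi\<^sup>2) * ds alt w"

definition continued_num :: "(real^4) set \<Rightarrow> complex \<Rightarrow> complex" where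
  "continued_num \<Lambda> s = two_factor \<Lambda> s * (1 - 2 powr (- (2 * s))) * (psi (2 * s))\<^sup>2"

text \<open>The double pole at s = 1 is visible as the double zero of the denominator;
  \<open>continued_num\<close> and \<open>ds odd_ind (4 * s)\<close> are regular and nonzero
  there.\<close>

definition continued :: "(real^4) set \<Rightarrow> complex \<Rightarrow> complex" where
  "continued \<Lambda> s = continued_num \<Lambda> s / (576 * ds odd_ind (4 * s) * (1 - 2 powr (2 - 2 * s))\<^sup>2)"

lemma continued_eq:
  assumes \<Lambda>: "\<Lambda> \<in> {J, integer_lattice}" and s: "Re s > 1" and nz: "ds odd_ind (4 * s) \<noteq> 0"
  shows "continued \<Lambda> s = dirichlet_gf \<Lambda> s"
proof -
  let ?e = "ds (\<lambda>n. of_nat (norm_count n)) (2 * s)" and ?t = "1 - 2 powr (2 - 2 * s)"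
  have w: "Re (2 * s) > 2" using s by simp
  have "norm ((2::complex) powr (2 - 2 * s)) = 2 powr (2 - 2 * Re s)"
    by (simp add: norm_powr_real_powr)
  also have "\<dots> < 1" using s by (subst powr_less_one) auto
  finally have t: "?t \<noteq> 0" by auto
  have 1: "ds odd_ind (4 * s) * (576 * dirichlet_gf J s) = (1 - 2 powr (- (2 * s))) * ?e\<^sup>2"
    using hurwitz_dirichlet_identity(2)[OF w] dirichlet_hurwitz(2)[OF s] by (simp add: mult.assoc[symmetric])
  have 2: "?t * ?e = psi (2 * s)" using alt_dirichlet_identity[OF w] by (simp add: psi_def)
  have "continued_num \<Lambda> s = two_factor \<Lambda> s * ((1 - 2 powr (- (2 * s))) * ?e\<^sup>2) * ?t\<^sup>2"
    unfolding continued_num_def 2[symmetric] by (simp add: power_mult_distrib)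
  also have "\<dots> = dirichlet_gf \<Lambda> s * (576 * ds odd_ind (4 * s) * ?t\<^sup>2)"
    unfolding 1[symmetric] dirichlet_gf_two_factor[OF \<Lambda> s] by simp
  finally show ?thesis unfolding continued_def using nz t by simp
qed

lemma ds_alt_2: "ds alt 2 = of_real (ln 2)"
proof -
  have "ds_term alt 2 = (\<lambda>n. of_real ((-1) ^ n / real (Suc n)))"
  proof
    fix n
    have "of_nat (Suc n) powr (- 2 :: complex) = 1 / of_nat (Suc n) ^ 2"
      using powr_minus[of "of_nat (Suc n) :: complex" 2] by (simp add: divide_inverse del: of_nat_Suc)
    thus "ds_term alt 2 n = of_real ((-1) ^ n / real (Suc n))"
      by (cases "even n") (simp_all add: ds_term_def alt_def power2_eq_square del: of_nat_Suc)
  qed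
  thus ?thesis unfolding ds_def
    using sums_of_real[OF alternating_harmonic_series_sums, where 'a = complex] by (simp add: sums_iff)
qed

lemma ds_odd_ind_4: "ds odd_ind 4 = of_real (pi ^ 4 / 96)"
proof -
  have "ds_term odd_ind 4 = (\<lambda>n. of_real (if even n then 1 / real (n + 1) ^ 4 else 0))"
  proof
    fix n
    have "of_nat (Suc n) powr (- 4 :: complex) = 1 / of_nat (Suc n) ^ 4"
      using powr_minus[of "of_nat (Suc n) :: complex" 4] by (simp add: divide_inverse del: of_nat_Suc)
    thus "ds_term odd_ind 4 n = of_real (if even n then 1 / real (n + 1) ^ 4 else 0)"
      by (cases "even n") (simp_all add: ds_term_def odd_ind_def)
  qed
  thus ?thesis unfolding ds_def
    using sums_of_real[OF inverse_odd_fourth_powers_sums, where 'a = complex] by (simp add: sums_iff)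
qed

text \<open>Re s > 3/4 corresponds to Re w > 3/2 under w = 2s, the half-plane obtained for
  \<open>excess\<close>; the other series reach further.\<close>

lemma holomorphic_parts:
  shows "continued_num \<Lambda> holomorphic_on {s. Re s > 3/4}"
    and "(\<lambda>s. ds odd_ind (4 * s)) holomorphic_on {s. Re s > 3/4}"
proof -
  have c: "(\<lambda>s. ds u (k * s)) holomorphic_on {s. Re s > 3/4}"
    if "ds u holomorphic_on {w. Re w > \<theta>}" "\<theta> \<le> 3/4 * Re k" "k \<in> \<real>" "Re k > 0" for u k \<theta>
  proof -
    have "(ds u \<circ> (\<lambda>s. k * s)) holomorphic_on {s. Re s > 3/4}"
    proof (rule holomorphic_on_compose_gen[OF _ that(1)])
      show "(\<lambda>s. k * s) ` {s. Re s > 3/4} \<subseteq> {w. Re w > \<theta>}"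
      proof clarify
        fix s assume "Re s > 3/4"
        hence "Re k * Re s > Re k * (3/4)" using that(4) by (intro mult_strict_left_mono)
        thus "Re (k * s) > \<theta>" using that(2,3) by (auto simp: complex_is_Real_iff)
      qed
    qed (intro holomorphic_intros)
    thus ?thesis by (simp add: o_def)
  qed
  have ex: "(\<lambda>s. ds excess (2 * s)) holomorphic_on {s. Re s > 3/4}"
    by (rule c[OF dirichlet_series_holomorphic[OF excess_sums_bound]]) auto
  have al: "(\<lambda>s. ds alt (2 * s)) holomorphic_on {s. Re s > 3/4}"
    by (rule c[OF dirichlet_series_holomorphic[OF alt_sums_bound]]) auto
  show "(\<lambda>s. ds odd_ind (4 * s)) holomorphic_on {s. Re s > 3/4}"
    by (rule c[OF dirichlet_series_holomorphic[OF odd_ind_sums_bound]]) auto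
  show "continued_num \<Lambda> holomorphic_on {s. Re s > 3/4}"
  proof -
    have tf: "two_factor \<Lambda> holomorphic_on {s. Re s > 3/4}"
    proof (cases "\<Lambda> = J")
      case True
      hence "two_factor \<Lambda> = (\<lambda>s. 1)" by (simp add: two_factor_def fun_eq_iff)
      thus ?thesis by simp
    next
      case False
      hence "two_factor \<Lambda> = (\<lambda>s. 1 + 2 * 2 powr (- (2 * s)))" by (simp add: two_factor_def fun_eq_iff)
      thus ?thesis by (auto intro!: holomorphic_intros)
    qed
    show ?thesis unfolding continued_num_def[abs_def] psi_def
      by (intro holomorphic_intros tf ex al) auto
  qed
qed

lemma two_powr_limit: "((\<lambda>s. (1 - 2 powr (2 - 2 * s)) / (s - 1)) \<longlongrightarrow> 2 * of_real (ln 2)) (at (1::complex))"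
proof -
  have "((\<lambda>s::complex. 1 - 2 powr (2 - 2 * s)) has_field_derivative 2 * of_real (ln 2)) (at 1)"
  proof -
    have "Ln 2 = complex_of_real (ln 2)" using Ln_of_real[of 2] by simp
    hence e: "(\<lambda>s::complex. 1 - 2 powr (2 - 2 * s)) = (\<lambda>s. 1 - exp ((2 - 2 * s) * of_real (ln 2)))"
      by (simp add: powr_def)
    show ?thesis unfolding e by (auto intro!: derivative_eq_intros)
  qed
  thus ?thesis by (simp add: has_field_derivative_iff)
qed

text \<open>The denominator also vanishes at the points 1 + k pi i / ln 2; \<open>U\<close> avoids
  these and the zeros of \<open>ds odd_ind (4 * s)\<close>, so that 1 remains the only possible
  singularity.\<close>

lemma continued_near_1:
  fixes \<Lambda> :: "(real^4) set"
  obtains U where "open U" "1 \<in> U" "\<And>s. s \<in> U \<Longrightarrow> ds odd_ind (4 * s) \<noteq> 0"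
    "continued \<Lambda> meromorphic_on U" "continued \<Lambda> holomorphic_on U - {1}"
proof -
  let ?H = "{s::complex. Re s > 3/4}"
  have oH: "open ?H" by (rule open_halfspace_Re_gt)
  have "\<forall>\<^sub>F s in at 1. (1 - 2 powr (2 - 2 * s)) / (s - 1) \<noteq> (0::complex)"
    by (rule tendsto_imp_eventually_ne[OF two_powr_limit]) simp
  then obtain U1 where U1: "open U1" "1 \<in> U1" "\<And>s. s \<in> U1 \<Longrightarrow> s \<noteq> 1 \<Longrightarrow> 1 - 2 powr (2 - 2 * s) \<noteq> (0::complex)"
    by (auto simp: eventually_at_topological)
  define U2 where "U2 = {s \<in> ?H. ds odd_ind (4 * s) \<noteq> 0}"
  have "continuous_on ?H (\<lambda>s. ds odd_ind (4 * s))"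
    using holomorphic_parts(2) by (rule holomorphic_on_imp_continuous_on)
  hence "open ((\<lambda>s. ds odd_ind (4 * s)) -` (- {0}) \<inter> ?H)"
    using continuous_on_open_vimage[OF oH] by blast
  also have "(\<lambda>s. ds odd_ind (4 * s)) -` (- {0}) \<inter> ?H = U2" by (auto simp: U2_def)
  finally have U2: "open U2" .
  have 1: "1 \<in> U2" by (simp add: U2_def ds_odd_ind_4)
  define U where "U = U1 \<inter> U2"
  have U: "open U" "1 \<in> U" "U \<subseteq> ?H" using U1 U2 1 by (auto simp: U_def U2_def)
  have num: "continued_num \<Lambda> holomorphic_on U" and lam: "(\<lambda>s. ds odd_ind (4 * s)) holomorphic_on U"
    using holomorphic_on_subset[OF _ U(3)] holomorphic_parts by blast+
  have den: "(\<lambda>s. 576 * ds odd_ind (4 * s) * (1 - 2 powr (2 - 2 * s))\<^sup>2) holomorphic_on U"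
    by (intro holomorphic_intros lam)
  show ?thesis
  proof (rule that[OF U(1,2)])
    show "ds odd_ind (4 * s) \<noteq> 0" if "s \<in> U" for s using that by (simp add: U_def U2_def)
    show "continued \<Lambda> meromorphic_on U"
      unfolding continued_def[abs_def]
      by (intro meromorphic_on_divide analytic_on_imp_meromorphic_on)
         (use num den U(1) in \<open>simp_all add: analytic_on_open\<close>)
    show "continued \<Lambda> holomorphic_on U - {1}"
      unfolding continued_def[abs_def]
    proof (rule holomorphic_on_divide)
      show "continued_num \<Lambda> holomorphic_on U - {1}" by (rule holomorphic_on_subset[OF num]) auto
      show "(\<lambda>s. 576 * ds odd_ind (4 * s) * (1 - 2 powr (2 - 2 * s))\<^sup>2) holomorphic_on U - {1}"
        by (rule holomorphic_on_subset[OF den]) auto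
      show "576 * ds odd_ind (4 * s) * (1 - 2 powr (2 - 2 * s))\<^sup>2 \<noteq> 0" if "s \<in> U - {1}" for s
        using that U1(3)[of s] by (auto simp: U_def U2_def)
    qed
  qed
qed

text \<open>The value of \<open>two_factor\<close> at s = 1, where 1 + 2 * 2^(-2) = 3/2.\<close>

definition leading :: "(real^4) set \<Rightarrow> real" where
  "leading \<Lambda> = (if \<Lambda> = J then 1 else 3/2)"

text \<open>The squares of ln 2 from \<open>ds_alt_2\<close> and from \<open>two_powr_limit\<close>
  cancel, leaving 3 pi^4 / (24 pi^4) = 1/8. One factor \<open>s - 1\<close> belongs to the function
  whose residue is taken, the other removes its simple pole.\<close>

lemma continued_limit: "((\<lambda>s. (s - 1) * continued \<Lambda> s * (s - 1)) \<longlongrightarrow> of_real (leading \<Lambda> / 8)) (at 1)"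
proof -
  have oH: "open {s::complex. Re s > 3/4}" by (rule open_halfspace_Re_gt)
  have cont: "f \<midarrow>1\<rightarrow> f 1" if "f holomorphic_on {s. Re s > 3/4}" for f :: "complex \<Rightarrow> complex"
  proof -
    have "isCont f 1"
      using holomorphic_on_imp_continuous_on[OF that] unfolding continuous_on_eq_continuous_at[OF oH] by simp
    thus ?thesis by (simp add: isCont_def)
  qed
  have "((\<lambda>s. continued_num \<Lambda> s / (576 * ds odd_ind (4 * s) * ((1 - 2 powr (2 - 2 * s)) / (s - 1))\<^sup>2)) \<longlongrightarrow>
     continued_num \<Lambda> 1 / (576 * ds odd_ind (4 * 1) * (2 * of_real (ln 2))\<^sup>2)) (at 1)"
    by (intro tendsto_intros cont[OF holomorphic_parts(1)] cont[OF holomorphic_parts(2)] two_powr_limit)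
       (simp add: ds_odd_ind_4)
  also have "continued_num \<Lambda> 1 / (576 * ds odd_ind (4 * 1) * (2 * of_real (ln 2))\<^sup>2) = of_real (leading \<Lambda> / 8)"
  proof -
    have p2: "(2::complex) powr (- 2) = 1/4" using powr_minus[of "2::complex" 2] by simp
    have "two_factor \<Lambda> 1 = of_real (leading \<Lambda>)" by (simp add: two_factor_def leading_def p2)
    moreover have "psi 2 = of_real (2 * pi\<^sup>2 * ln 2)" by (simp add: psi_def ds_alt_2)
    ultimately have num: "continued_num \<Lambda> 1 = of_real (leading \<Lambda> * (3/4) * (2 * pi\<^sup>2 * ln 2)\<^sup>2)"
      by (simp add: continued_num_def p2)
    have "continued_num \<Lambda> 1 / (576 * ds odd_ind (4 * 1) * (2 * of_real (ln 2))\<^sup>2) =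
      of_real (leading \<Lambda> * (3/4) * (2 * pi\<^sup>2 * ln 2)\<^sup>2 / (576 * (pi ^ 4 / 96) * (2 * ln 2)\<^sup>2))"
      unfolding num by (simp add: ds_odd_ind_4)
    also have "leading \<Lambda> * (3/4) * (2 * pi\<^sup>2 * ln 2)\<^sup>2 / (576 * (pi ^ 4 / 96) * (2 * ln 2)\<^sup>2) = leading \<Lambda> / 8"
      by (simp add: power2_eq_square power4_eq_xxxx)
    finally show ?thesis .
  qed
  finally show ?thesis
  proof (rule Lim_transform_eventually)
    show "\<forall>\<^sub>F s in at 1. continued_num \<Lambda> s / (576 * ds odd_ind (4 * s) * ((1 - 2 powr (2 - 2 * s)) / (s - 1))\<^sup>2)
       = (s - 1) * continued \<Lambda> s * (s - 1)"
    proof -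
      have "x / (y * (z / t)\<^sup>2) = t * (x / (y * z\<^sup>2)) * t" if "t \<noteq> 0" for x y z t :: complex
        using that by (simp add: power2_eq_square field_simps)
      thus ?thesis unfolding continued_def by (auto simp: eventually_at_filter)
    qed
  qed
qed

lemma meromorphic_continuation_continued:
  assumes "\<Lambda> \<in> {J, integer_lattice}"
  shows "meromorphic_continuation_near_1 (dirichlet_gf \<Lambda>) (continued \<Lambda>)"
proof -
  obtain U where "open U" "1 \<in> U" "\<And>s. s \<in> U \<Longrightarrow> ds odd_ind (4 * s) \<noteq> 0" "continued \<Lambda> meromorphic_on U"
    using continued_near_1[of \<Lambda>] by metis
  thus ?thesis unfolding meromorphic_continuation_near_1_def
    using continued_eq[OF assms] by (intro exI[of _ U]) auto
qed

lemma residue_continued: "residue (\<lambda>s. (s - 1) * continued \<Lambda> s) 1 = of_real (leading \<Lambda> / 8)"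
proof -
  obtain U where U: "open U" "1 \<in> U" "continued \<Lambda> holomorphic_on U - {1}"
    using continued_near_1[of \<Lambda>] by metis
  show ?thesis
    by (rule residue_simple'[OF U(1,2) _ continued_limit]) (intro holomorphic_intros U(3))
qed

text \<open>The points 1 + t with small t > 0 lie in the half-plane and accumulate at 1, and a
  difference meromorphic at 1 that vanishes at such points vanishes on a punctured neighbourhood.
  Residues at 1 are thus independent of the continuation.\<close>

lemma continuation_unique:
  assumes "meromorphic_continuation_near_1 F G" "meromorphic_continuation_near_1 F G'"
  shows "\<forall>\<^sub>F s in at 1. G s = G' s"
proof -
  obtain U where U: "open U" "1 \<in> U" "G meromorphic_on U" "\<And>s. s \<in> U \<Longrightarrow> Re s > 1 \<Longrightarrow> G s = F s"
    using assms(1) by (auto simp: meromorphic_continuation_near_1_def)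
  obtain V where V: "open V" "1 \<in> V" "G' meromorphic_on V" "\<And>s. s \<in> V \<Longrightarrow> Re s > 1 \<Longrightarrow> G' s = F s"
    using assms(2) by (auto simp: meromorphic_continuation_near_1_def)
  have "G meromorphic_on {1}" "G' meromorphic_on {1}"
    using U V by (auto intro: meromorphic_on_subset)
  hence d: "(\<lambda>s. G s - G' s) meromorphic_on {1}" by (rule meromorphic_on_diff)
  have "1 islimpt {s. s \<in> U \<inter> V \<and> Re s > 1}"
    unfolding islimpt_approachable
  proof (intro allI impI)
    fix e :: real assume e: "e > 0"
    have "open (U \<inter> V)" "1 \<in> U \<inter> V" using U V by auto
    then obtain r where r: "r > 0" "ball 1 r \<subseteq> U \<inter> V" by (meson open_contains_ball)
    define t where "t = min r e / 2"
    have t: "t > 0" "t < r" "t < e" using e r by (auto simp: t_def)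
    have d: "dist (1 + of_real t) (1::complex) = t" using t by (simp add: dist_norm)
    have "1 + of_real t \<in> ball (1::complex) r" using d t by (simp add: dist_commute)
    thus "\<exists>x'\<in>{s. s \<in> U \<inter> V \<and> Re s > 1}. x' \<noteq> 1 \<and> dist x' 1 < e"
      using t d r by (intro bexI[of _ "1 + of_real t"]) auto
  qed
  hence "\<exists>\<^sub>F s in at 1. s \<in> U \<inter> V \<and> Re s > 1" by (simp add: islimpt_conv_frequently_at)
  hence "\<exists>\<^sub>F s in at 1. G s - G' s = 0" by (rule frequently_elim1) (use U V in auto)
  hence "\<forall>\<^sub>F s in at 1. G s - G' s = 0"
    using d by (intro not_essential_frequently_0_imp_eventually_0)
      (auto intro: meromorphic_on_isolated_singularity meromorphic_on_not_essential)
  thus ?thesis by simp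
qed

lemma residue_continuation:
  assumes "\<Lambda> \<in> {J, integer_lattice}" "meromorphic_continuation_near_1 (dirichlet_gf \<Lambda>) G"
  shows "residue (\<lambda>s. (s - 1) * G s) 1 = of_real (leading \<Lambda> / 8)"
proof -
  have "\<forall>\<^sub>F s in at 1. (s - 1) * G s = (s - 1) * continued \<Lambda> s"
    using continuation_unique[OF assms(2) meromorphic_continuation_continued[OF assms(1)]]
    by eventually_elim simp
  thus ?thesis using residue_cong residue_continued by metis
qed

section \<open>Asymptotics of the summatory function\<close>

text \<open>The exponent 2 comes from the main term \<open>pi\<^sup>2 * (x / nrm a)\<^sup>2\<close>
  of \<open>hurwitz_count\<close>. This sum and the next two are the partial sums at w = 2 over all
  elements, those of odd norm, and the primitive ones.\<close>

definition Jsum :: "real \<Rightarrow> real" where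
  "Jsum t = (\<Sum>x | x \<in> J - {0} \<and> real (nrm x) \<le> t. 1 / real (nrm x) ^ 2)"

definition Osum :: "real \<Rightarrow> real" where
  "Osum t = (\<Sum>x | x \<in> J \<and> odd (nrm x) \<and> real (nrm x) \<le> t. 1 / real (nrm x) ^ 2)"

definition Psum :: "real \<Rightarrow> real" where
  "Psum t = (\<Sum>x | x \<in> odd_prims \<and> real (nrm x) \<le> t. 1 / real (nrm x) ^ 2)"

lemma finite_nrm_le_sets:
  "finite {x. x \<in> J - {0} \<and> real (nrm x) \<le> t}"
  "finite {x. x \<in> J \<and> odd (nrm x) \<and> real (nrm x) \<le> t}"
  "finite {x. x \<in> odd_prims \<and> real (nrm x) \<le> t}"
  by (rule finite_subset[OF _ finite_J_nrm_le_real[of t]]; auto dest: odd_primsD)+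

lemma bounded_partial_sums:
  fixes f :: "nat \<Rightarrow> real"
  assumes "summable f"
  obtains K where "K \<ge> 0" "\<And>N. \<bar>\<Sum>n<N. f n\<bar> \<le> K"
proof -
  have "Bseq (\<lambda>N. \<Sum>n<N. f n)"
    using summable_LIMSEQ[OF assms] by (intro convergent_imp_Bseq) (auto simp: convergent_def)
  then obtain K where "K > 0" "\<And>N. norm (\<Sum>n<N. f n) \<le> K" by (auto elim: BseqE)
  thus ?thesis using that[of K] by auto
qed

lemma harm_ln_bound:
  obtains K where "K \<ge> 0" "\<And>N. N > 0 \<Longrightarrow> \<bar>(\<Sum>n<N. 1 / real (Suc n)) - ln (real N)\<bar> \<le> K"
proof -
  have "Bseq (\<lambda>n. harm n - ln (real n) :: real)"
    using euler_mascheroni_LIMSEQ by (intro convergent_imp_Bseq) (auto simp: convergent_def)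
  then obtain K where K: "K > 0" "\<And>n. norm (harm n - ln (real n) :: real) \<le> K" by (auto elim: BseqE)
  have "(\<Sum>n<N. 1 / real (Suc n)) = harm N" for N
    unfolding harm_def
    by (rule sum.reindex_bij_witness[of _ "\<lambda>n. n - 1" Suc]) (auto simp: divide_inverse)
  thus ?thesis using that[of K] K by auto
qed

lemma Jsum_eq: "Jsum (real N) = (\<Sum>n<N. real (norm_count (Suc n)) / real (Suc n) ^ 2)"
proof -
  have "Jsum (real N) = (\<Sum>n\<in>{..<N}. \<Sum>x\<in>{x \<in> J - {0}. nrm x = Suc n}. 1 / real (nrm x) ^ 2)"
  proof -
    have "{x. x \<in> J - {0} \<and> real (nrm x) \<le> real N} = (\<Union>n\<in>{..<N}. {x \<in> J - {0}. nrm x = Suc n})"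
    proof (intro equalityI subsetI)
      fix x assume x: "x \<in> {x. x \<in> J - {0} \<and> real (nrm x) \<le> real N}"
      hence "nrm x = Suc (nrm x - 1)" "nrm x - 1 < N" using nrm_pos_iff[of x] by auto
      thus "x \<in> (\<Union>n\<in>{..<N}. {x \<in> J - {0}. nrm x = Suc n})" using x by blast
    qed auto
    moreover have "finite {x \<in> J - {0}. nrm x = Suc n}" for n
      by (rule finite_subset[OF _ finite_J_nrm_eq[of "Suc n"]]) auto
    ultimately show ?thesis unfolding Jsum_def
      by (subst sum.UNION_disjoint[symmetric]) auto
  qed
  also have "\<dots> = (\<Sum>n<N. real (norm_count (Suc n)) / real (Suc n) ^ 2)"
    by (intro sum.cong refl) (simp add: norm_count_def)
  finally show ?thesis .
qed

text \<open>At w = 2 the series of \<open>excess\<close> still converges, so its partial sums are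
  bounded; the rest is \<open>2 * pi\<^sup>2\<close> times a harmonic sum. Passing from
  \<open>t\<close> to its floor changes the logarithm by at most ln 2.\<close>

lemma Jsum_bound:
  obtains K where "K \<ge> 0" "\<And>t. t \<ge> 1 \<Longrightarrow> \<bar>Jsum t - 2 * pi\<^sup>2 * ln t\<bar> \<le> K"
proof -
  have "summable (ds_term excess 2)"
    by (rule dirichlet_series_summable[OF excess_sums_bound]) auto
  hence "summable (\<lambda>n. Re (ds_term excess 2 n))" by (rule summable_Re)
  then obtain K1 where K1: "K1 \<ge> 0" "\<And>N. \<bar>\<Sum>n<N. Re (ds_term excess 2 n)\<bar> \<le> K1"
    using bounded_partial_sums by blast
  obtain K2 where K2: "K2 \<ge> 0" "\<And>N. N > 0 \<Longrightarrow> \<bar>(\<Sum>n<N. 1 / real (Suc n)) - ln (real N)\<bar> \<le> K2"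
    using harm_ln_bound by blast
  have t: "Re (ds_term excess 2 n) = real (norm_count (Suc n)) / real (Suc n) ^ 2 - 2 * pi\<^sup>2 * (1 / real (Suc n))" for n
  proof -
    have "of_nat (Suc n) powr (- 2 :: complex) = of_real (1 / real (Suc n) ^ 2)"
      using powr_minus[of "of_nat (Suc n) :: complex" 2] by (simp add: divide_inverse del: of_nat_Suc)
    hence "ds_term excess 2 n = of_real ((real (norm_count (Suc n)) - 2 * pi\<^sup>2 * real (Suc n)) * (1 / real (Suc n) ^ 2))"
      unfolding ds_term_def excess_def by (simp only: of_real_mult)
    hence "Re (ds_term excess 2 n) = (real (norm_count (Suc n)) - 2 * pi\<^sup>2 * real (Suc n)) * (1 / real (Suc n) ^ 2)"
      by (simp only: Re_complex_of_real)
    thus ?thesis by (simp add: power2_eq_square field_simps del: of_nat_Suc)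
  qed
  have N: "\<bar>Jsum (real N) - 2 * pi\<^sup>2 * ln (real N)\<bar> \<le> K1 + 2 * pi\<^sup>2 * K2" if "N > 0" for N
  proof -
    have "Jsum (real N) = (\<Sum>n<N. Re (ds_term excess 2 n)) + 2 * pi\<^sup>2 * (\<Sum>n<N. 1 / real (Suc n))"
      unfolding Jsum_eq t sum_subtractf sum_distrib_left by simp
    hence "Jsum (real N) - 2 * pi\<^sup>2 * ln (real N) =
      (\<Sum>n<N. Re (ds_term excess 2 n)) + 2 * pi\<^sup>2 * ((\<Sum>n<N. 1 / real (Suc n)) - ln (real N))"
      by (simp add: algebra_simps)
    also have "\<bar>\<dots>\<bar> \<le> \<bar>\<Sum>n<N. Re (ds_term excess 2 n)\<bar> + 2 * pi\<^sup>2 * \<bar>(\<Sum>n<N. 1 / real (Suc n)) - ln (real N)\<bar>"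
      by (rule order_trans[OF abs_triangle_ineq]) (simp add: abs_mult)
    also have "\<dots> \<le> K1 + 2 * pi\<^sup>2 * K2"
      using K1 K2(2)[OF that] by (intro add_mono mult_left_mono) auto
    finally show ?thesis .
  qed
  have "\<bar>Jsum t - 2 * pi\<^sup>2 * ln t\<bar> \<le> K1 + 2 * pi\<^sup>2 * K2 + 2 * pi\<^sup>2 * ln 2" if "t \<ge> 1" for t
  proof -
    define N where "N = nat \<lfloor>t\<rfloor>"
    have N1: "N > 0" "real N \<le> t" "t \<le> 2 * real N"
    proof -
      have "1 \<le> \<lfloor>t\<rfloor>" using that by simp
      hence f: "real N = of_int \<lfloor>t\<rfloor>" "(1::real) \<le> of_int \<lfloor>t\<rfloor>" by (simp_all add: N_def)
      show "N > 0" "real N \<le> t" "t \<le> 2 * real N"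
        using f floor_correct[of t] by linarith+
    qed
    have "nrm x \<le> N \<longleftrightarrow> real (nrm x) \<le> t" for x
      using that unfolding N_def by (simp add: le_nat_iff le_floor_iff)
    hence J: "Jsum t = Jsum (real N)" by (simp add: Jsum_def)
    have "ln (real N) \<le> ln t" "ln t \<le> ln (2 * real N)" using N1 that by (simp_all del: ln_mult_pos)
    moreover have "ln (2 * real N) = ln 2 + ln (real N)" using N1 by (simp add: ln_mult)
    ultimately have "\<bar>ln t - ln (real N)\<bar> \<le> ln 2" by linarith
    hence "\<bar>2 * pi\<^sup>2 * (ln t - ln (real N))\<bar> \<le> 2 * pi\<^sup>2 * ln 2"
      unfolding abs_mult by (intro mult_mono) auto
    moreover have "Jsum t - 2 * pi\<^sup>2 * ln t = (Jsum (real N) - 2 * pi\<^sup>2 * ln (real N)) - 2 * pi\<^sup>2 * (ln t - ln (real N))"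
      by (simp add: J algebra_simps)
    ultimately show ?thesis using N[OF N1(1)] by linarith
  qed
  thus ?thesis using that K1(1) K2(1) by (metis add_nonneg_nonneg ln_ge_zero mult_nonneg_nonneg one_le_numeral zero_le_numeral zero_le_power2)
qed

text \<open>Truncated form of removing the multiples of 1 + i: their norms are doubled, hence the
  bound \<open>t / 2\<close> and the weight 1/4.\<close>

lemma Jsum_split: "Jsum t = Osum t + Jsum (t / 2) / 4"
proof -
  let ?A = "{x. x \<in> J \<and> odd (nrm x) \<and> real (nrm x) \<le> t}"
  let ?B = "{x. x \<in> J - {0} \<and> real (nrm x) \<le> t / 2}"
  let ?q = "\<lambda>x. one_plus_i \<odot> x"
  have n2: "nrm (?q x) = 2 * nrm x" if "x \<in> J" for x using that by (simp add: nrm_mult)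
  have set: "{x. x \<in> J - {0} \<and> real (nrm x) \<le> t} = ?A \<union> ?q ` ?B"
  proof (intro equalityI subsetI)
    fix x assume x: "x \<in> {x. x \<in> J - {0} \<and> real (nrm x) \<le> t}"
    hence "x \<in> {x \<in> J. odd (nrm x)} \<union> ?q ` (J - {0})" using J_nonzero_split(1) by blast
    thus "x \<in> ?A \<union> ?q ` ?B"
    proof
      assume "x \<in> ?q ` (J - {0})"
      then obtain y where y: "y \<in> J - {0}" "x = ?q y" by blast
      hence "y \<in> ?B" using x n2[of y] by simp
      thus ?thesis using y by blast
    qed (use x in simp)
  next
    fix x assume x: "x \<in> ?A \<union> ?q ` ?B"
    hence "x \<in> J - {0}" using J_nonzero_split(1) by blast
    moreover have "real (nrm x) \<le> t" using x by (auto simp: n2)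
    ultimately show "x \<in> {x. x \<in> J - {0} \<and> real (nrm x) \<le> t}" by blast
  qed
  have "?A \<inter> ?q ` ?B = {}" using J_nonzero_split(2) by blast
  hence "Jsum t = Osum t + (\<Sum>x\<in>?q ` ?B. 1 / real (nrm x) ^ 2)"
    unfolding Jsum_def Osum_def set by (intro sum.union_disjoint finite_nrm_le_sets finite_imageI)
  also have "(\<Sum>x\<in>?q ` ?B. 1 / real (nrm x) ^ 2) = (\<Sum>x\<in>?B. 1 / real (nrm (?q x)) ^ 2)"
    by (subst sum.reindex[OF J_nonzero_split(3)]) simp
  also have "\<dots> = (\<Sum>x\<in>?B. (1 / real (nrm x) ^ 2) / 4)"
    by (intro sum.cong refl) (simp add: n2 power2_eq_square)
  also have "\<dots> = Jsum (t / 2) / 4" by (simp add: Jsum_def sum_divide_distrib)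
  finally show ?thesis .
qed

text \<open>The coefficient is 2 - 2/4 = 3/2; replacing ln(t/2) by ln t affects only the constant,
  and \<open>t \<ge> 2\<close> keeps \<open>t / 2\<close> in the range of
  \<open>Jsum_bound\<close>.\<close>

lemma Osum_bound:
  obtains K where "\<And>t. t \<ge> 2 \<Longrightarrow> \<bar>Osum t - 3/2 * pi\<^sup>2 * ln t\<bar> \<le> K"
proof -
  obtain K where K: "K \<ge> 0" "\<And>t. t \<ge> 1 \<Longrightarrow> \<bar>Jsum t - 2 * pi\<^sup>2 * ln t\<bar> \<le> K" using Jsum_bound by blast
  have "\<bar>Osum t - 3/2 * pi\<^sup>2 * ln t\<bar> \<le> K + K / 4 + pi\<^sup>2 * ln 2 / 2" if t: "t \<ge> 2" for t
  proof -
    have ln: "ln (t / 2) = ln t - ln 2" using t by (simp add: ln_div)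
    have "Osum t - 3/2 * pi\<^sup>2 * ln t = (Jsum t - 2 * pi\<^sup>2 * ln t)
      - (Jsum (t / 2) - 2 * pi\<^sup>2 * ln (t / 2)) / 4 + pi\<^sup>2 * ln 2 / 2"
      using Jsum_split[of t] unfolding ln by (simp add: field_simps)
    moreover have "\<bar>Jsum t - 2 * pi\<^sup>2 * ln t\<bar> \<le> K" "\<bar>Jsum (t / 2) - 2 * pi\<^sup>2 * ln (t / 2)\<bar> \<le> K"
      using K(2)[of t] K(2)[of "t / 2"] t by auto
    moreover have "pi\<^sup>2 * ln 2 / 2 \<ge> 0" by simp
    moreover have "\<bar>x\<bar> \<le> K + K / 4 + c" if "x = a - b / 4 + c" "\<bar>a\<bar> \<le> K" "\<bar>b\<bar> \<le> K" "c \<ge> 0" for x a b c :: real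
      using that by linarith
    ultimately show ?thesis by blast
  qed
  thus ?thesis using that by blast
qed

section \<open>From elements of odd norm to primitive ones, by removing integer factors\<close>

definition odd_zeta4 :: "nat \<Rightarrow> real" where
  "odd_zeta4 D = (\<Sum>d | odd d \<and> d \<le> D. 1 / real d ^ 4)"

lemma odd_zeta4_eq: "odd_zeta4 D = (\<Sum>n<D. if even n then 1 / real (n + 1) ^ 4 else 0)"
proof -
  have "(\<Sum>n<D. if even n then 1 / real (n + 1) ^ 4 else 0) = (\<Sum>n | n < D \<and> even n. 1 / real (n + 1) ^ 4)"
    by (subst sum.inter_filter[symmetric]) (auto intro: sum.cong)
  also have "\<dots> = odd_zeta4 D" unfolding odd_zeta4_def
    by (rule sum.reindex_bij_witness[of _ "\<lambda>d. d - 1" "\<lambda>n. n + 1"]) (auto elim: oddE)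
  finally show ?thesis ..
qed

lemma odd_zeta4_lim: "odd_zeta4 \<longlonglongrightarrow> pi ^ 4 / 96"
  using inverse_odd_fourth_powers_sums unfolding sums_def odd_zeta4_eq[abs_def] .

lemma odd_zeta4_le: "odd_zeta4 D \<le> pi ^ 4 / 96"
  unfolding odd_zeta4_eq sums_unique[OF inverse_odd_fourth_powers_sums]
  by (rule sum_le_suminf[OF sums_summable[OF inverse_odd_fourth_powers_sums]]) auto

lemma odd_zeta4_pos: "D > 0 \<Longrightarrow> odd_zeta4 D > 0"
  unfolding odd_zeta4_def by (rule sum_pos2[of _ 1]) auto

lemma Osum_pairs: "Osum t = (\<Sum>(d, y) | odd d \<and> y \<in> odd_prims \<and> real (d\<^sup>2 * nrm y) \<le> t.
   1 / real d ^ 4 * (1 / real (nrm y) ^ 2))"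
proof -
  let ?Z = "{(d, y). odd d \<and> y \<in> odd_prims \<and> real (d\<^sup>2 * nrm y) \<le> t}"
  let ?f = "\<lambda>(d::nat, y). real d *\<^sub>R y"
  have inj: "inj_on ?f ?Z"
    by (rule inj_on_subset[OF bij_betw_imp_inj_on[OF odd_elements_bij]]) auto
  have ns: "nrm (real d *\<^sub>R y) = d\<^sup>2 * nrm y" if "y \<in> odd_prims" for d :: nat and y
    using nrm_scale[OF odd_primsD(1)[OF that]] .
  have img: "?f ` ?Z = {x. x \<in> J \<and> odd (nrm x) \<and> real (nrm x) \<le> t}"
  proof (intro equalityI subsetI)
    fix x assume "x \<in> ?f ` ?Z"
    then obtain d :: nat and y where y: "odd d" "y \<in> odd_prims" "real (d\<^sup>2 * nrm y) \<le> t" "x = real d *\<^sub>R y" by auto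
    have "x \<in> {x \<in> J. odd (nrm x)}"
      using bij_betw_imp_surj_on[OF odd_elements_bij] y by force
    thus "x \<in> {x. x \<in> J \<and> odd (nrm x) \<and> real (nrm x) \<le> t}" using y ns by simp
  next
    fix x assume x: "x \<in> {x. x \<in> J \<and> odd (nrm x) \<and> real (nrm x) \<le> t}"
    hence "x \<in> ?f ` ({d. odd d} \<times> odd_prims)" using bij_betw_imp_surj_on[OF odd_elements_bij] by blast
    then obtain d :: nat and y where y: "odd d" "y \<in> odd_prims" "x = real d *\<^sub>R y" by auto
    hence "(d, y) \<in> ?Z" using x ns by simp
    thus "x \<in> ?f ` ?Z" using y(3) by force
  qed
  have "Osum t = (\<Sum>p\<in>?Z. 1 / real (nrm (?f p)) ^ 2)"
    unfolding Osum_def img[symmetric] by (subst sum.reindex[OF inj]) simp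
  also have "\<dots> = (\<Sum>(d, y)\<in>?Z. 1 / real d ^ 4 * (1 / real (nrm y) ^ 2))"
    by (intro sum.cong refl) (auto simp: ns power_mult_distrib)
  finally show ?thesis .
qed

lemma odd_zeta4_Psum: "odd_zeta4 D * Psum t = (\<Sum>(d, y)\<in>{d. odd d \<and> d \<le> D} \<times> {y. y \<in> odd_prims \<and> real (nrm y) \<le> t}.
   1 / real d ^ 4 * (1 / real (nrm y) ^ 2))"
  unfolding odd_zeta4_def Psum_def sum_product sum.cartesian_product ..

text \<open>The region \<open>d\<^sup>2 * nrm y \<le> t\<close> lies in the rectangle
  \<open>d \<le> t\<close>, \<open>nrm y \<le> t\<close>, on which the double sum is a
  product.\<close>

lemma Psum_lower: "Osum t \<le> pi ^ 4 / 96 * Psum t"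
proof -
  let ?D = "nat \<lfloor>t\<rfloor>"
  have nn: "Psum t \<ge> 0" unfolding Psum_def by (intro sum_nonneg) auto
  have "Osum t \<le> odd_zeta4 ?D * Psum t"
    unfolding Osum_pairs odd_zeta4_Psum
  proof (rule sum_mono2)
    show "finite ({d. odd d \<and> d \<le> ?D} \<times> {y. y \<in> odd_prims \<and> real (nrm y) \<le> t})"
      by (intro finite_cartesian_product finite_nrm_le_sets) auto
    show "{(d, y). odd d \<and> y \<in> odd_prims \<and> real (d\<^sup>2 * nrm y) \<le> t} \<subseteq>
      {d. odd d \<and> d \<le> ?D} \<times> {y. y \<in> odd_prims \<and> real (nrm y) \<le> t}"
    proof
      fix p assume "p \<in> {(d, y). odd d \<and> y \<in> odd_prims \<and> real (d\<^sup>2 * nrm y) \<le> t}"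
      then obtain d y where dy: "p = (d, y)"
        and *: "odd d" "y \<in> odd_prims" "real (d\<^sup>2 * nrm y) \<le> t" by blast
      have p: "d \<ge> 1" "nrm y \<ge> 1"
        using *(1) odd_primsD[OF *(2)] by (auto simp: Suc_le_eq intro: Nat.gr0I)
      have "d * 1 \<le> d\<^sup>2 * nrm y" unfolding power2_eq_square using p by (intro mult_mono) auto
      hence "real d \<le> real (d\<^sup>2 * nrm y)" by (simp only: of_nat_le_iff mult_1_right)
      hence "real d \<le> t" using *(3) by linarith
      moreover have "1 * nrm y \<le> d\<^sup>2 * nrm y" using p by (intro mult_mono) auto
      hence "real (nrm y) \<le> real (d\<^sup>2 * nrm y)" by (simp only: of_nat_le_iff mult_1)
      hence "real (nrm y) \<le> t" using *(3) by linarith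
      ultimately show "p \<in> {d. odd d \<and> d \<le> ?D} \<times> {y. y \<in> odd_prims \<and> real (nrm y) \<le> t}"
        using * by (simp add: dy le_nat_floor)
    qed
  qed auto
  also have "\<dots> \<le> pi ^ 4 / 96 * Psum t" by (intro mult_right_mono odd_zeta4_le nn)
  finally show ?thesis .
qed

text \<open>The rectangle \<open>d \<le> D\<close>, \<open>nrm y \<le> t\<close> lies in the region
  for \<open>t * (real D)\<^sup>2\<close>; for fixed \<open>D\<close> this shifts the logarithm only
  by a constant.\<close>

lemma Psum_upper:
  assumes "D > 0"
  shows "odd_zeta4 D * Psum t \<le> Osum (t * (real D)\<^sup>2)"
  unfolding Osum_pairs odd_zeta4_Psum
proof (rule sum_mono2)
  let ?Z = "{(d, y). odd d \<and> y \<in> odd_prims \<and> real (d\<^sup>2 * nrm y) \<le> t * (real D)\<^sup>2}"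
  have "finite ((\<lambda>(d::nat, y). real d *\<^sub>R y) ` ?Z)"
  proof (rule finite_subset[OF _ finite_nrm_le_sets(2)[of "t * (real D)\<^sup>2"]], rule subsetI)
    fix x assume "x \<in> (\<lambda>(d::nat, y). real d *\<^sub>R y) ` ?Z"
    then obtain d :: nat and y where x: "x = real d *\<^sub>R y" and y: "odd d" "y \<in> odd_prims" "real (d\<^sup>2 * nrm y) \<le> t * (real D)\<^sup>2"
      by auto
    hence "real d *\<^sub>R y \<in> {x \<in> J. odd (nrm x)}"
      using bij_betw_imp_surj_on[OF odd_elements_bij] by force
    thus "x \<in> {x. x \<in> J \<and> odd (nrm x) \<and> real (nrm x) \<le> t * (real D)\<^sup>2}"
      unfolding x using y nrm_scale[OF odd_primsD(1)[OF y(2)], of d] by simp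
  qed
  moreover have "inj_on (\<lambda>(d::nat, y). real d *\<^sub>R y) ?Z"
    by (rule inj_on_subset[OF bij_betw_imp_inj_on[OF odd_elements_bij]]) auto
  ultimately show "finite ?Z" by (rule finite_imageD)
  show "{d. odd d \<and> d \<le> D} \<times> {y. y \<in> odd_prims \<and> real (nrm y) \<le> t} \<subseteq> ?Z"
  proof
    fix p assume "p \<in> {d. odd d \<and> d \<le> D} \<times> {y. y \<in> odd_prims \<and> real (nrm y) \<le> t}"
    then obtain d y where dy: "p = (d, y)"
      and *: "odd d" "d \<le> D" "y \<in> odd_prims" "real (nrm y) \<le> t" by blast
    have "real (nrm y) * (real d)\<^sup>2 \<le> t * (real D)\<^sup>2"
      using * by (intro mult_mono power_mono) (auto intro: order_trans[of _ "real (nrm y)"])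
    thus "p \<in> ?Z" using * by (simp add: dy mult.commute)
  qed
qed auto

text \<open>144/pi^2 is (3/2) pi^2 divided by pi^4/96. For the upper bound \<open>D\<close> is fixed
  first, with \<open>odd_zeta4 D\<close> close to its limit, and only then does \<open>t\<close>
  grow.\<close>

lemma Psum_asymp: "((\<lambda>t. Psum t / ln t) \<longlongrightarrow> 144 / pi\<^sup>2) at_top"
proof -
  obtain K where K: "\<And>t. t \<ge> 2 \<Longrightarrow> \<bar>Osum t - 3/2 * pi\<^sup>2 * ln t\<bar> \<le> K" using Osum_bound by blast
  have c: "3/2 * pi\<^sup>2 / (pi ^ 4 / 96) = 144 / pi\<^sup>2" by (simp add: power4_eq_xxxx power2_eq_square)
  have ev: "\<forall>\<^sub>F t in at_top. t \<ge> (2::real)" by (rule eventually_ge_at_top)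
  show ?thesis
  proof (rule order_tendstoI)
    fix a assume a: "a < 144 / pi\<^sup>2"
    have "((\<lambda>t. (3/2 * pi\<^sup>2 - K / ln t) / (pi ^ 4 / 96)) \<longlongrightarrow> (3/2 * pi\<^sup>2 - 0) / (pi ^ 4 / 96)) at_top"
      by (intro tendsto_intros) (real_asymp | simp)+
    hence "\<forall>\<^sub>F t in at_top. a < (3/2 * pi\<^sup>2 - K / ln t) / (pi ^ 4 / 96)"
      using a c by (intro order_tendstoD) (auto simp only: diff_zero)
    thus "\<forall>\<^sub>F t in at_top. a < Psum t / ln t" using ev
    proof eventually_elim
      case (elim t)
      have l: "ln t > 0" using elim by simp
      have "(3/2 * pi\<^sup>2 - K / ln t) * ln t = 3/2 * pi\<^sup>2 * ln t - K" using l by (simp add: field_simps)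
      also have "\<dots> \<le> Osum t" using K[of t] elim by linarith
      also have "\<dots> \<le> pi ^ 4 / 96 * Psum t" by (rule Psum_lower)
      finally have "(3/2 * pi\<^sup>2 - K / ln t) / (pi ^ 4 / 96) \<le> Psum t / ln t"
        using l by (simp add: field_simps)
      thus ?case using elim by linarith
    qed
  next
    fix a assume a: "144 / pi\<^sup>2 < a"
    have "(\<lambda>D. 3/2 * pi\<^sup>2 / odd_zeta4 D) \<longlonglongrightarrow> 3/2 * pi\<^sup>2 / (pi ^ 4 / 96)"
      by (intro tendsto_intros odd_zeta4_lim) auto
    hence "\<forall>\<^sub>F D in sequentially. 3/2 * pi\<^sup>2 / odd_zeta4 D < a"
      using a c by (intro order_tendstoD) auto
    hence "\<forall>\<^sub>F D in sequentially. 3/2 * pi\<^sup>2 / odd_zeta4 D < a \<and> D > 0"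
      by (rule eventually_conj) (rule eventually_gt_at_top)
    then obtain D where D: "3/2 * pi\<^sup>2 / odd_zeta4 D < a" "D > 0"
      by (metis (no_types, lifting) eventually_sequentially order_refl)
    have lp: "odd_zeta4 D > 0" using D odd_zeta4_pos by simp
    define C where "C = 3/2 * pi\<^sup>2 * ln ((real D)\<^sup>2) + K"
    have "((\<lambda>t. (3/2 * pi\<^sup>2 + C / ln t) / odd_zeta4 D) \<longlongrightarrow> (3/2 * pi\<^sup>2 + 0) / odd_zeta4 D) at_top"
      using lp by (intro tendsto_intros) (real_asymp | simp)+
    hence "\<forall>\<^sub>F t in at_top. (3/2 * pi\<^sup>2 + C / ln t) / odd_zeta4 D < a"
      using D by (intro order_tendstoD) auto
    thus "\<forall>\<^sub>F t in at_top. Psum t / ln t < a" using ev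
    proof eventually_elim
      case (elim t)
      have l: "ln t > 0" using elim by simp
      have D1: "(real D)\<^sup>2 \<ge> 1" using D(2) by (simp add: one_le_power)
      have "2 * 1 \<le> t * (real D)\<^sup>2" using elim D1 by (intro mult_mono) auto
      hence "Osum (t * (real D)\<^sup>2) \<le> 3/2 * pi\<^sup>2 * ln (t * (real D)\<^sup>2) + K"
        using K[of "t * (real D)\<^sup>2"] by linarith
      also have "ln (t * (real D)\<^sup>2) = ln t + ln ((real D)\<^sup>2)"
        using elim D(2) by (intro ln_mult_pos) auto
      finally have "odd_zeta4 D * Psum t \<le> 3/2 * pi\<^sup>2 * (ln t + ln ((real D)\<^sup>2)) + K"
        using Psum_upper[OF D(2), of t] by (rule order_trans[rotated])
      also have "\<dots> = 3/2 * pi\<^sup>2 * ln t + C" by (simp add: C_def distrib_left)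
      also have "\<dots> = (3/2 * pi\<^sup>2 + C / ln t) * ln t" using l by (simp add: field_simps)
      finally have "odd_zeta4 D * Psum t \<le> (3/2 * pi\<^sup>2 + C / ln t) * ln t" .
      moreover have "p / L \<le> q / m" if "m * p \<le> q * L" "L > 0" "m > 0" for p q L m :: real
        using that by (simp add: field_simps)
      ultimately have "Psum t / ln t \<le> (3/2 * pi\<^sup>2 + C / ln t) / odd_zeta4 D" using l lp by blast
      thus ?case using elim by linarith
    qed
  qed
qed

section \<open>The summatory function as a sum of ball counts over the primitive factor\<close>

lemma summatory_hurwitz:
  "576 * summatory J x = (\<Sum>a | a \<in> odd_prims \<and> real (nrm a) \<le> x. real (hurwitz_count (x / real (nrm a))))"
proof -
  let ?A = "{a. a \<in> odd_prims \<and> real (nrm a) \<le> x}"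
  let ?B = "\<lambda>a. {b \<in> J - {0}. real (nrm b) \<le> x / real (nrm a)}"
  let ?M = "{m. 1 \<le> m \<and> real m \<le> x}"
  have finM: "finite ?M"
    by (rule finite_subset[of _ "{..nat \<lfloor>x\<rfloor>}"]) (auto simp: le_nat_floor)
  have "576 * summatory J x = real (\<Sum>m\<in>?M. card (hurwitz_pairs m))"
    unfolding summatory_def sum_distrib_left of_nat_sum
    by (intro sum.cong refl) (simp add: num_hurwitz)
  also have "(\<Sum>m\<in>?M. card (hurwitz_pairs m)) = card (\<Union>m\<in>?M. hurwitz_pairs m)"
    by (rule card_UN_disjoint[symmetric]) (use finM finite_hurwitz_pairs in \<open>auto simp: hurwitz_pairs_def\<close>)
  also have "(\<Union>m\<in>?M. hurwitz_pairs m) = Sigma ?A ?B"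
  proof -
    have "(a, b) \<in> (\<Union>m\<in>?M. hurwitz_pairs m) \<longleftrightarrow> (a, b) \<in> Sigma ?A ?B" for a b
    proof (cases "a \<in> odd_prims \<and> b \<in> J - {0}")
      case True
      have p: "nrm a > 0" "nrm b > 0" using True odd_primsD(1,3)[of a] by (auto simp: nrm_pos_iff)
      have "(a, b) \<in> (\<Union>m\<in>?M. hurwitz_pairs m) \<longleftrightarrow> real (nrm a * nrm b) \<le> x"
        using True p by (auto simp: hurwitz_pairs_def Suc_le_eq)
      also have "\<dots> \<longleftrightarrow> real (nrm b) \<le> x / real (nrm a)" using p by (simp add: field_simps)
      also have "\<dots> \<longleftrightarrow> real (nrm a) \<le> x \<and> real (nrm b) \<le> x / real (nrm a)"
      proof -
        have "real (nrm a) \<le> x" if "real (nrm b) \<le> x / real (nrm a)"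
        proof -
          have "real (nrm a) * 1 \<le> real (nrm a) * real (nrm b)" using p by (intro mult_left_mono) auto
          also have "\<dots> \<le> x" using that p by (simp add: field_simps)
          finally show ?thesis by simp
        qed
        thus ?thesis by blast
      qed
      also have "\<dots> \<longleftrightarrow> (a, b) \<in> Sigma ?A ?B" using True by auto
      finally show ?thesis .
    next
      case False
      have "(a, b) \<notin> Sigma ?A ?B" "(a, b) \<notin> (\<Union>m\<in>?M. hurwitz_pairs m)"
        using False unfolding hurwitz_pairs_def by blast+
      thus ?thesis by blast
    qed
    thus ?thesis by auto
  qed
  also have "card (Sigma ?A ?B) = (\<Sum>a\<in>?A. hurwitz_count (x / real (nrm a)))"
    unfolding hurwitz_count_def
    by (rule card_SigmaI[OF finite_nrm_le_sets(3)]) (use finite_nrm_le_sets(1) in auto)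
  finally show ?thesis by simp
qed

text \<open>Bounds the error of \<open>hurwitz_count\<close> without a new sum over
  \<open>a\<close>: the first term sums to \<open>Psum\<close> with a small factor, the second is a
  constant to be multiplied by the O(x^2) values of \<open>a\<close>.\<close>

lemma powr_three_halves_split:
  assumes "y > 0" "T > (0::real)"
  shows "y powr (3/2) \<le> y\<^sup>2 * T powr (- 1/2) + T powr (3/2)"
proof (cases "y \<ge> T")
  case True
  have "y powr (3/2) = y powr 2 * y powr (- 1/2)" by (simp flip: powr_add)
  also have "\<dots> \<le> y powr 2 * T powr (- 1/2)"
    using True assms by (intro mult_left_mono powr_mono2') auto
  also have "y powr 2 = y\<^sup>2" using assms by simp
  finally show ?thesis by (simp add: add_increasing2)
next
  case False
  hence "y powr (3/2) \<le> T powr (3/2)" using assms by (intro powr_mono2) auto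
  thus ?thesis by (simp add: add_increasing)
qed

lemma summatory_hurwitz_error:
  assumes x: "x > 0" and T: "T > 0"
  shows "\<bar>576 * summatory J x - pi\<^sup>2 * x\<^sup>2 * Psum x\<bar>
    \<le> hurwitz_err * (x\<^sup>2 * Psum x * T powr (- 1/2) + (pi\<^sup>2 + hurwitz_err) * x\<^sup>2 * T powr (3/2))"
proof -
  let ?A = "{a. a \<in> odd_prims \<and> real (nrm a) \<le> x}"
  have finA: "finite ?A" by (rule finite_nrm_le_sets)
  have E: "hurwitz_err \<ge> 0" by (simp add: hurwitz_err_def)
  have "pi\<^sup>2 * x\<^sup>2 * Psum x = (\<Sum>a\<in>?A. pi\<^sup>2 * (x / real (nrm a))\<^sup>2)"
    unfolding Psum_def sum_distrib_left by (intro sum.cong refl) (simp add: power_divide)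
  hence "\<bar>576 * summatory J x - pi\<^sup>2 * x\<^sup>2 * Psum x\<bar> =
    \<bar>\<Sum>a\<in>?A. real (hurwitz_count (x / real (nrm a))) - pi\<^sup>2 * (x / real (nrm a))\<^sup>2\<bar>"
    unfolding summatory_hurwitz by (simp add: sum_subtractf)
  also have "\<dots> \<le> (\<Sum>a\<in>?A. hurwitz_err * ((x / real (nrm a))\<^sup>2 * T powr (- 1/2) + T powr (3/2)))"
  proof (rule order_trans[OF sum_abs], rule sum_mono)
    fix a assume a: "a \<in> ?A"
    hence "nrm a > 0" using odd_primsD(1,3)[of a] by (auto simp: nrm_pos_iff)
    hence y: "x / real (nrm a) \<ge> 1" using a by (simp add: field_simps)
    have "\<bar>real (hurwitz_count (x / real (nrm a))) - pi\<^sup>2 * (x / real (nrm a))\<^sup>2\<bar>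
       \<le> hurwitz_err * (x / real (nrm a)) powr (3/2)" by (rule hurwitz_count_bound[OF y])
    also have "\<dots> \<le> hurwitz_err * ((x / real (nrm a))\<^sup>2 * T powr (- 1/2) + T powr (3/2))"
      using y T by (intro mult_left_mono powr_three_halves_split E) auto
    finally show "\<bar>real (hurwitz_count (x / real (nrm a))) - pi\<^sup>2 * (x / real (nrm a))\<^sup>2\<bar>
       \<le> hurwitz_err * ((x / real (nrm a))\<^sup>2 * T powr (- 1/2) + T powr (3/2))" .
  qed
  also have "\<dots> = hurwitz_err * (x\<^sup>2 * Psum x * T powr (- 1/2) + real (card ?A) * T powr (3/2))"
    unfolding sum_distrib_left[symmetric] sum.distrib Psum_def
    by (simp add: power_divide sum_distrib_left sum_distrib_right mult_ac)
  also have "\<dots> \<le> hurwitz_err * (x\<^sup>2 * Psum x * T powr (- 1/2) + (pi\<^sup>2 + hurwitz_err) * x\<^sup>2 * T powr (3/2))"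
  proof -
    have "card ?A \<le> hurwitz_count x" unfolding hurwitz_count_def
      by (rule card_mono) (use finite_nrm_le_sets(1)[of x] odd_prims_nonzero in auto)
    hence "real (card ?A) \<le> (pi\<^sup>2 + hurwitz_err) * x\<^sup>2"
      using hurwitz_count_upper[of x] x by (meson less_imp_le of_nat_le_iff order_trans)
    thus ?thesis by (intro mult_left_mono add_left_mono mult_right_mono E) auto
  qed
  finally show ?thesis .
qed

lemma summatory_hurwitz_limit: "((\<lambda>x. summatory J x / (x\<^sup>2 * ln x)) \<longlongrightarrow> 1/4) at_top"
proof -
  let ?E = hurwitz_err and ?C = "pi\<^sup>2 + hurwitz_err"
  have main: "((\<lambda>x. pi\<^sup>2 * (Psum x / ln x)) \<longlongrightarrow> pi\<^sup>2 * (144 / pi\<^sup>2)) at_top"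
    by (intro tendsto_intros Psum_asymp)
  have z1: "((\<lambda>x::real. (ln x powr (1/2)) powr (- 1/2)) \<longlongrightarrow> 0) at_top"
    and z2: "((\<lambda>x::real. (ln x powr (1/2)) powr (3/2) / ln x) \<longlongrightarrow> 0) at_top"
    by real_asymp+
  have "((\<lambda>x. ?E * (Psum x / ln x * (ln x powr (1/2)) powr (- 1/2) + ?C * ((ln x powr (1/2)) powr (3/2) / ln x)))
     \<longlongrightarrow> ?E * (144 / pi\<^sup>2 * 0 + ?C * 0)) at_top"
    by (intro tendsto_intros Psum_asymp z1 z2)
  hence err: "((\<lambda>x. ?E * (Psum x / ln x * (ln x powr (1/2)) powr (- 1/2) + ?C * ((ln x powr (1/2)) powr (3/2) / ln x)))
     \<longlongrightarrow> 0) at_top" by simp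
  have "((\<lambda>x. 576 * (summatory J x / (x\<^sup>2 * ln x)) - pi\<^sup>2 * (Psum x / ln x)) \<longlongrightarrow> 0) at_top"
  proof (rule Lim_null_comparison[OF _ err])
    show "\<forall>\<^sub>F x in at_top. norm (576 * (summatory J x / (x\<^sup>2 * ln x)) - pi\<^sup>2 * (Psum x / ln x)) \<le>
      ?E * (Psum x / ln x * (ln x powr (1/2)) powr (- 1/2) + ?C * ((ln x powr (1/2)) powr (3/2) / ln x))"
      using eventually_gt_at_top[of 1]
    proof eventually_elim
      case (elim x)
      have x: "x > 0" "ln x > 0" using elim by auto
      \<comment> \<open>This choice balances the errors: T^(-1/2) and T^(3/2) / ln x both equal (ln
        x)^(-1/4).\<close>
      define T where "T = ln x powr (1/2)"
      have T: "T > 0" using x by (simp add: T_def)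
      have d: "x\<^sup>2 * ln x > 0" using x by simp
      have "norm (576 * (summatory J x / (x\<^sup>2 * ln x)) - pi\<^sup>2 * (Psum x / ln x))
        = \<bar>(576 * summatory J x - pi\<^sup>2 * x\<^sup>2 * Psum x) / (x\<^sup>2 * ln x)\<bar>"
        using x by (simp add: diff_divide_distrib)
      also have "\<dots> = \<bar>576 * summatory J x - pi\<^sup>2 * x\<^sup>2 * Psum x\<bar> / (x\<^sup>2 * ln x)"
        using d by (simp add: abs_divide)
      also have "\<dots> \<le> ?E * (x\<^sup>2 * Psum x * T powr (- 1/2) + ?C * x\<^sup>2 * T powr (3/2)) / (x\<^sup>2 * ln x)"
        using d by (intro divide_right_mono summatory_hurwitz_error x T) auto
      also have "\<dots> = ?E * (Psum x / ln x * T powr (- 1/2) + ?C * (T powr (3/2) / ln x))"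
        using x by (simp add: field_simps)
      finally show ?case unfolding T_def .
    qed
  qed
  from tendsto_add[OF this main] have "((\<lambda>x. 576 * (summatory J x / (x\<^sup>2 * ln x))) \<longlongrightarrow> 144) at_top" by simp
  from tendsto_mult_left[OF this, of "1/576"] show ?thesis by simp
qed

lemma summatory_integer: "summatory integer_lattice x = summatory J x + 2 * summatory J (x / 2)"
proof -
  let ?M = "\<lambda>x. {m. 1 \<le> m \<and> real m \<le> x}"
  let ?f = "\<lambda>m. real (num_similarity_sublattices J m)"
  have finM: "finite (?M x)" for x
    by (rule finite_subset[of _ "{..nat \<lfloor>x\<rfloor>}"]) (auto simp: le_nat_floor)
  have "summatory integer_lattice x = (\<Sum>m\<in>?M x. ?f m + 2 * (if even m then ?f (m div 2) else 0))"
    unfolding summatory_def by (intro sum.cong refl) (simp add: num_integer)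
  also have "\<dots> = summatory J x + 2 * (\<Sum>m\<in>?M x. if even m then ?f (m div 2) else 0)"
    by (simp add: sum.distrib sum_distrib_left summatory_def)
  also have "(\<Sum>m\<in>?M x. if even m then ?f (m div 2) else 0) = (\<Sum>m | m \<in> ?M x \<and> even m. ?f (m div 2))"
    by (rule sum.inter_filter[OF finM, symmetric])
  also have "\<dots> = summatory J (x / 2)"
    unfolding summatory_def
    by (rule sum.reindex_bij_witness[of _ "\<lambda>m. 2 * m" "\<lambda>m. m div 2"]) (auto elim!: evenE)
  finally show ?thesis .
qed

lemma summatory_limit:
  assumes "\<Lambda> \<in> {J, integer_lattice}"
  shows "((\<lambda>x. summatory \<Lambda> x / (x\<^sup>2 * ln x)) \<longlongrightarrow> leading \<Lambda> / 4) at_top"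
proof (cases "\<Lambda> = J")
  case True
  thus ?thesis using summatory_hurwitz_limit by (simp add: leading_def)
next
  case False
  hence L: "\<Lambda> = integer_lattice" using assms by simp
  have half: "filterlim (\<lambda>x::real. x / 2) at_top at_top" by real_asymp
  have r: "((\<lambda>x::real. (x / 2)\<^sup>2 * ln (x / 2) / (x\<^sup>2 * ln x)) \<longlongrightarrow> 1/4) at_top"
    by real_asymp (simp add: power2_eq_square)
  have "((\<lambda>x. summatory J (x / 2) / ((x / 2)\<^sup>2 * ln (x / 2)) * ((x / 2)\<^sup>2 * ln (x / 2) / (x\<^sup>2 * ln x)))
     \<longlongrightarrow> 1/4 * (1/4)) at_top"
    by (intro tendsto_mult r filterlim_compose[OF summatory_hurwitz_limit half])
  hence "((\<lambda>x. summatory J (x / 2) / (x\<^sup>2 * ln x)) \<longlongrightarrow> 1/4 * (1/4)) at_top"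
  proof (rule Lim_transform_eventually)
    show "\<forall>\<^sub>F x in at_top. summatory J (x / 2) / ((x / 2)\<^sup>2 * ln (x / 2)) * ((x / 2)\<^sup>2 * ln (x / 2) / (x\<^sup>2 * ln x))
      = summatory J (x / 2) / (x\<^sup>2 * ln x)"
      using eventually_gt_at_top[of 2] by eventually_elim simp
  qed
  \<comment> \<open>The limit is 1/4 + 2 * (1/4 * 1/4) = 3/8, a quarter of 3/2.\<close>
  from tendsto_add[OF summatory_hurwitz_limit tendsto_mult_left[OF this, of 2]]
  show ?thesis using False by (simp add: L summatory_integer leading_def add_divide_distrib)
qed

theorem corollary2:
  fixes \<Lambda> :: "(real^4) set"
  assumes "\<Lambda> \<in> {hurwitz_lattice, integer_lattice}"
  shows "(\<lambda>x::real. x) \<in> o[at_top](\<lambda>x. 1 / x * summatory \<Lambda> x)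
    \<and> (\<forall>s. Re s > 1 \<longrightarrow> summable (dirichlet_term \<Lambda> s))
    \<and> (\<exists>G. meromorphic_continuation_near_1 (dirichlet_gf \<Lambda>) G)
    \<and> (\<exists>C::real.
          summatory \<Lambda> \<sim>[at_top] (\<lambda>x. C * x\<^sup>2 * ln x)
        \<and> (\<forall>G. meromorphic_continuation_near_1 (dirichlet_gf \<Lambda>) G
              \<longrightarrow> complex_of_real C = 2 * residue (\<lambda>s. (s - 1) * G s) 1)
        \<and> C = 1/4 * (if \<Lambda> = hurwitz_lattice then 1 else 3/2))"
proof (intro conjI exI[of _ "leading \<Lambda> / 4"] allI impI)
  note lim = summatory_limit[OF assms]
  have pos: "leading \<Lambda> > 0" by (simp add: leading_def)
  have ev: "\<forall>\<^sub>F x in at_top. x > 1 \<and> summatory \<Lambda> x / (x\<^sup>2 * ln x) > 0"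
    using order_tendstoD(1)[OF lim, of 0] pos by (intro eventually_conj eventually_gt_at_top) simp
  show "(\<lambda>x::real. x) \<in> o[at_top](\<lambda>x. 1 / x * summatory \<Lambda> x)"
  proof (rule smalloI_tendsto)
    \<comment> \<open>The quotient x / (summatory / x) is the inverse of the normalized sum times 1
      / ln x: the logarithm is what exceeds linear growth.\<close>
    have "((\<lambda>x. inverse (summatory \<Lambda> x / (x\<^sup>2 * ln x)) * (1 / ln x)) \<longlongrightarrow> inverse (leading \<Lambda> / 4) * 0) at_top"
      using pos by (intro tendsto_intros lim) (simp, real_asymp)
    hence "((\<lambda>x. inverse (summatory \<Lambda> x / (x\<^sup>2 * ln x)) * (1 / ln x)) \<longlongrightarrow> 0) at_top" by simp
    thus "((\<lambda>x. x / (1 / x * summatory \<Lambda> x)) \<longlongrightarrow> 0) at_top"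
    proof (rule Lim_transform_eventually)
      show "\<forall>\<^sub>F x in at_top. inverse (summatory \<Lambda> x / (x\<^sup>2 * ln x)) * (1 / ln x) = x / (1 / x * summatory \<Lambda> x)"
        using ev by eventually_elim (auto simp: field_simps power2_eq_square)
    qed
    show "\<forall>\<^sub>F x in at_top. 1 / x * summatory \<Lambda> x \<noteq> 0" using ev by eventually_elim auto
  qed
  show "summable (dirichlet_term \<Lambda> s)" if "Re s > 1" for s
    using assms dirichlet_hurwitz(1)[OF that] dirichlet_integer(1)[OF that] by auto
  show "\<exists>G. meromorphic_continuation_near_1 (dirichlet_gf \<Lambda>) G"
    using meromorphic_continuation_continued[OF assms] by blast
  show "summatory \<Lambda> \<sim>[at_top] (\<lambda>x. leading \<Lambda> / 4 * x\<^sup>2 * ln x)"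
  proof (rule asymp_equivI')
    have "((\<lambda>x. summatory \<Lambda> x / (x\<^sup>2 * ln x) / (leading \<Lambda> / 4)) \<longlongrightarrow> leading \<Lambda> / 4 / (leading \<Lambda> / 4)) at_top"
      using pos by (intro tendsto_intros lim) simp
    thus "((\<lambda>x. summatory \<Lambda> x / (leading \<Lambda> / 4 * x\<^sup>2 * ln x)) \<longlongrightarrow> 1) at_top"
      using pos by (simp add: mult_ac)
  qed
  show "complex_of_real (leading \<Lambda> / 4) = 2 * residue (\<lambda>s. (s - 1) * G s) 1"
    if "meromorphic_continuation_near_1 (dirichlet_gf \<Lambda>) G" for G
    unfolding residue_continuation[OF assms that] by simp
  show "leading \<Lambda> / 4 = 1/4 * (if \<Lambda> = hurwitz_lattice then 1 else 3/2)"
    by (simp add: leading_def)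
qed

end
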